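(* The mapping $\Theta\colon \mathcal P(\mathbb R_+)\to\mathcal P(\mathbb R_+)$, $\Theta(\mu)=\Phi(\pi^{-1}\boxtimes\mu)$, is a homomorphism from the semigroup $(\mathcal P(\mathbb R_+),\boxplus)$ to the semigroup $(\mathcal P(\mathbb R_+),\vee_{\mathrm f})$; that is, $\Theta(\mu\boxplus\nu)=\Theta(\mu)\vee_{\mathrm f}\Theta(\nu)$ for all $\mu,\nu\in\mathcal P(\mathbb R_+)$.
   Context: $\mathbb R_+=[0,\infty)$ and $\mathcal P(\mathbb R_+)$ is the set of Borel probability measures on $\mathbb R_+$. For a measure $\nu$ on $\mathbb R_+$ and $\alpha\in\mathbb R$, $\nu^{\alpha}$ denotes the push-forward of $\nu$ by $x\mapsto x^\alpha$ (for $\alpha<0$ this is used only when $\nu(\{0\})=0$). Free additive convolution $\boxplus$: for $\mu\in\mathcal P(\mathbb R_+)$ let $G_\mu(s)=\int_0^\infty\frac{1}{s-x}\,d\mu(x)$, $s<0$, and $\kappa_\mu=\int_0^\infty x^{-1}\,d\mu(x)\in(0,\infty]$ (with $\kappa_\mu=\infty$ if $\mu(\{0\})>0$). $G_\mu$ is a strictly decreasing bijection from $(-\infty,0)$ onto $(-\kappa_\mu,0)$, and the $R$-transform is $R_\mu(t)=tG_\mu^{-1}(t)-1$, $t\in(-\kappa_\mu,0)$. The measure $\mu\boxplus\nu\in\mathcal P(\mathbb R_+)$ is characterized by $R_{\mu\boxplus\nu}=R_\mu+R_\nu$ on $(-\kappa_{\mu\boxplus\nu},0)$ (one has $\kappa_{\mu\boxplus\nu}\le\min\{\kappa_\mu,\kappa_\nu\}$).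 Free multiplicative convolution $\boxtimes$: for $\mu\in\mathcal P(\mathbb R_+)\setminus\{\delta_0\}$ let $\psi_\mu(t)=\int_{\mathbb R_+}\frac{tu}{1-tu}\,d\mu(u)$, $t<0$, a strictly increasing bijection from $(-\infty,0)$ onto $(-1+\mu(\{0\}),0)$, and let the $S$-transform be $S_\mu(t)=\frac{1+t}{t}\psi_\mu^{-1}(t)$, $t\in(-1+\mu(\{0\}),0)$. For $\mu,\nu\ne\delta_0$, $\mu\boxtimes\nu$ is characterized by $S_{\mu\boxtimes\nu}=S_\mu S_\nu$ on $(-1+\max\{\mu(\{0\}),\nu(\{0\})\},0)$; and $\mu\boxtimes\delta_0=\delta_0\boxtimes\mu=\delta_0$. $\Phi(\mu)$ denotes the weak limit of $(\mu^{\boxtimes n})^{1/n}$ as $n\to\infty$ (the limit distribution of the free multiplicative law of large numbers, which exists for every $\mu\in\mathcal P(\mathbb R_+)$), where $\mu^{\boxtimes n}$ is the $n$-fold free multiplicative convolution. $\pi$ is the standard Marchenko--Pastur law, $\pi(dx)=\frac{\sqrt{x(4-x)}}{2\pi x}\mathbf 1_{(0,4)}(x)\,dx$ (the $\pi$ in the denominator is the number), and $\pi^{-1}$ is its push-forward by $x\mapsto x^{-1}$. Free max-convolution $\vee_{\mathrm f}$: $(\mu\vee_{\mathrm f}\nu)([0,t])=\max\{\mu([0,t])+\nu([0,t])-1,0\}$ for $t\ge0$. *)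

theory Defs
  imports "HOL-Probability.Probability"
begin

text \<open>Borel probability measures on \<open>[0, \<infinity>)\<close>, encoded as Borel probability measures on
  the real line that give no mass to the negative half-line.\<close>

definition prob_Rplus :: "real measure set" where
  "prob_Rplus = {\<mu>. real_distribution \<mu> \<and> emeasure \<mu> {..<0} = 0}"

text \<open>Push-forward by \<open>x \<mapsto> x\<^sup>\<alpha>\<close>, to be used with \<open>\<alpha> \<noteq> 0\<close> only: \<open>powr\<close> satisfies \<open>0 powr \<alpha> = 0\<close>
  for every \<open>\<alpha>\<close>, which is the intended value for \<open>\<alpha> > 0\<close>, and irrelevant for \<open>\<alpha> < 0\<close>,
  where only measures without atom at \<open>0\<close> are considered.\<close>

definition measure_powr :: "real measure \<Rightarrow> real \<Rightarrow> real measure" where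
  "measure_powr \<mu> \<alpha> = distr \<mu> borel (\<lambda>x. x powr \<alpha>)"

subsection \<open>Free additive convolution\<close>

definition G_transform :: "real measure \<Rightarrow> real \<Rightarrow> real" where
  "G_transform \<mu> s = (\<integral>x. 1 / (s - x) \<partial>\<mu>)"

text \<open>The extended non-negative reals satisfy \<open>inverse 0 = \<infinity>\<close>, so an atom at \<open>0\<close> gives \<open>\<kappa> = \<infinity>\<close>.\<close>

definition kappa :: "real measure \<Rightarrow> ennreal" where
  "kappa \<mu> = (\<integral>\<^sup>+ x. inverse (ennreal x) \<partial>\<mu>)"

text \<open>Meaningful for \<open>t \<in> (-\<kappa>\<^sub>\<mu>, 0)\<close>, the image of \<open>(-\<infinity>, 0)\<close> under the injective function \<open>G\<^sub>\<mu>\<close>.\<close>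

definition R_transform :: "real measure \<Rightarrow> real \<Rightarrow> real" where
  "R_transform \<mu> t = t * the_inv_into {..<0} (G_transform \<mu>) t - 1"

text \<open>The condition on \<open>\<kappa>\<close> guarantees that both R-transforms on the right-hand side are defined
  wherever they are evaluated.\<close>

definition free_add_conv :: "real measure \<Rightarrow> real measure \<Rightarrow> real measure"
    (infixl "\<boxplus>" 65) where
  "\<mu> \<boxplus> \<nu> = (THE \<rho>. \<rho> \<in> prob_Rplus \<and> kappa \<rho> \<le> min (kappa \<mu>) (kappa \<nu>) \<and>
     (\<forall>t<0. ennreal (- t) < kappa \<rho> \<longrightarrow>
        R_transform \<rho> t = R_transform \<mu> t + R_transform \<nu> t))"

subsection \<open>Free multiplicative convolution\<close>

definition psi_transform :: "real measure \<Rightarrow> real \<Rightarrow> real" where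
  "psi_transform \<mu> t = (\<integral>u. t * u / (1 - t * u) \<partial>\<mu>)"

text \<open>Meaningful for \<open>\<mu> \<noteq> \<delta>\<^sub>0\<close> and \<open>t \<in> (-1 + \<mu>({0}), 0)\<close>, the image of \<open>(-\<infinity>, 0)\<close> under the
  injective function \<open>\<psi>\<^sub>\<mu>\<close>.\<close>

definition S_transform :: "real measure \<Rightarrow> real \<Rightarrow> real" where
  "S_transform \<mu> t = (1 + t) / t * the_inv_into {..<0} (psi_transform \<mu>) t"

text \<open>The condition on the atom at \<open>0\<close> guarantees that the S-transform of the convolution is
  defined wherever it is evaluated.\<close>

definition free_mult_conv :: "real measure \<Rightarrow> real measure \<Rightarrow> real measure"
    (infixl "\<boxtimes>" 70) where
  "\<mu> \<boxtimes> \<nu> =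
    (if \<mu> = return borel 0 \<or> \<nu> = return borel 0 then return borel 0
     else (THE \<rho>. \<rho> \<in> prob_Rplus \<and> \<rho> \<noteq> return borel 0 \<and>
        measure \<rho> {0} \<le> max (measure \<mu> {0}) (measure \<nu> {0}) \<and>
        (\<forall>t. -1 + max (measure \<mu> {0}) (measure \<nu> {0}) < t \<and> t < 0 \<longrightarrow>
           S_transform \<rho> t = S_transform \<mu> t * S_transform \<nu> t)))"

text \<open>The empty convolution is the unit \<open>\<delta>\<^sub>1\<close> of \<open>\<boxtimes>\<close>.\<close>

primrec free_mult_power :: "real measure \<Rightarrow> nat \<Rightarrow> real measure" where
  "free_mult_power \<mu> 0 = return borel 1"
| "free_mult_power \<mu> (Suc n) = free_mult_power \<mu> n \<boxtimes> \<mu>"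

text \<open>The limit law in the free multiplicative law of large numbers.\<close>

definition Phi :: "real measure \<Rightarrow> real measure" where
  "Phi \<mu> = (THE \<rho>. \<rho> \<in> prob_Rplus \<and>
     weak_conv_m (\<lambda>n. measure_powr (free_mult_power \<mu> n) (1 / real n)) \<rho>)"

subsection \<open>Free max-convolution and the map \<open>\<Theta>\<close>\<close>

definition free_max_conv :: "real measure \<Rightarrow> real measure \<Rightarrow> real measure"
    (infixl "\<or>\<^sub>f" 65) where
  "\<mu> \<or>\<^sub>f \<nu> = (THE \<rho>. \<rho> \<in> prob_Rplus \<and>
     (\<forall>t\<ge>0. measure \<rho> {0..t} = max (measure \<mu> {0..t} + measure \<nu> {0..t} - 1) 0))"

definition marchenko_pastur :: "real measure" where
  "marchenko_pastur = density lborel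
     (\<lambda>x. ennreal (sqrt (x * (4 - x)) / (2 * pi * x) * indicator {0<..<4} x))"

definition Theta :: "real measure \<Rightarrow> real measure" where
  "Theta \<mu> = Phi (measure_powr marchenko_pastur (-1) \<boxtimes> \<mu>)"

end

theory Submission
  imports Defs "HOL-Computational_Algebra.Fundamental_Theorem_Algebra"
begin

text \<open>The \<open>S\<close>-transform of \<open>\<pi>\<^sup>-\<^sup>1\<close> is \<open>-t\<close>, so the \<open>S\<close>-transform of \<open>\<pi>\<^sup>-\<^sup>1 \<boxtimes> \<mu>\<close> at \<open>R\<^sub>\<mu>(z)\<close> is \<open>-z\<close>.
  The \<open>n\<close>-th power has the \<open>n\<close>-th power of this \<open>S\<close>-transform, and since \<open>1 + \<psi>(-y\<^sup>-\<^sup>n)\<close> is almost the mass of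
  \<open>[0, y\<^sup>n]\<close>, the limit law \<open>\<Theta>(\<mu>)\<close> has distribution function \<open>1 + R\<^sub>\<mu>(-1/y)\<close> for \<open>1/y < \<kappa>\<^sub>\<mu>\<close> and \<open>0\<close> for
  \<open>1/y \<ge> \<kappa>\<^sub>\<mu>\<close>. Additivity of \<open>R\<close> is then exactly the rule for the free max-convolution.

  That the convolutions of arbitrary measures exist is shown by finite free probability. The coefficients of a
  polynomial with \<open>d\<close> negative roots, normalized by binomials, may be multiplied termwise, or combined as a
  truncated Cauchy product after division by \<open>k!\<close>, without leaving this class (Grace--Walsh--Szego). The
  coefficients, weighted by \<open>x\<^sup>k\<close>, concentrate at \<open>k \<approx> -d \<psi>(-x)\<close>. As they are log-concave (Newton), this is
  equivalent to a limit for the ratios of consecutive coefficients, and these limits turn the finite convolutions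
  into the defining equations for \<open>S\<close> and \<open>R\<close>; a tightness argument provides the measure.\<close>

section \<open>Zeros of polynomials and finite free convolutions\<close>

text \<open>Each convolution is a definite description, so nothing can be said about it before a
  measure with the prescribed transform is known to exist and to be unique. Uniqueness is real
  analysis: the values of \<open>npsi\<close> near 0 fix the measure. Existence is the obstacle:
  nothing in the equations shows that a product of S-transforms, or a sum of R-transforms, comes
  from a positive measure. Finite free convolution supplies positivity, since it returns lists of
  positive numbers, hence genuine empirical measures. One list serves both convolutions. At index t
  d the tilt that balances neighbouring coefficients is x for \<open>esym\<close> and (1 - t) x for
  \<open>csym\<close>. With t = \<open>npsi M x\<close> the second tilt is \<open>ncau M x\<close>,
  the number s with R(-s) = -t. The passage between concentration and ratios needs strictly monotone
  profiles. This singles out \<delta>_0, and it makes the monotonicity of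
  \<open>ncau M x / npsi M x\<close>, that of S, essential. The law \<pi>^-1 enters through S(-t) =
  t only: the S-transform of M at -t is \<open>ncau M x / npsi M x\<close>, and the factor t removes
  the denominator.\<close>

definition esym :: "'a::comm_ring_1 list \<Rightarrow> nat \<Rightarrow> 'a" where
  "esym l k = coeff (\<Prod>a\<leftarrow>l. [:1, a:]) k"

lemma esym_Nil: "esym [] k = (if k = 0 then 1 else 0)"
  by (simp add: esym_def)

lemma esym_0 [simp]: "esym l 0 = 1"
  by (induction l) (auto simp: esym_def)

lemma esym_Cons_Suc: "esym (a # l) (Suc k) = esym l (Suc k) + a * esym l k"
  by (simp add: esym_def)

lemma esym_eq_0: "length l < k \<Longrightarrow> esym l k = 0"
proof (induction l arbitrary: k)
  case (Cons a l)
  then show ?case by (cases k) (auto simp: esym_Cons_Suc)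
qed (auto simp: esym_Nil)

lemma esym_pos:
  fixes l :: "'a::linordered_idom list"
  assumes "\<forall>a\<in>set l. 0 < a" "k \<le> length l"
  shows "0 < esym l k"
  using assms
proof (induction l arbitrary: k)
  case (Cons a l)
  show ?case
  proof (cases k)
    case (Suc j)
    have "0 \<le> esym l (Suc j)"
      using Cons by (cases "Suc j \<le> length l") (auto simp: less_imp_le esym_eq_0)
    with Suc Cons show ?thesis
      by (auto simp: esym_Cons_Suc intro!: add_nonneg_pos)
  qed simp
qed (auto simp: esym_Nil)

lemma esym_map_of_real: "esym (map of_real l) k = (of_real (esym l k) :: 'a::{real_algebra_1,comm_ring_1})"
proof (induction l arbitrary: k)
  case (Cons a l)
  then show ?case by (cases k) (auto simp: esym_Cons_Suc)
qed (auto simp: esym_Nil)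

lemma esym_map_mult: "esym (map (\<lambda>a. a * z) l) k = esym l k * z ^ k"
proof (induction l arbitrary: k)
  case (Cons a l)
  then show ?case by (cases k) (auto simp: esym_Cons_Suc algebra_simps)
qed (auto simp: esym_Nil)

text \<open>Laguerre's theorem on polar derivatives: the mean of the numbers \<open>1 / (y - b)\<close> over the roots
  \<open>b\<close> lies in the disc that is the inverse image of a half-plane.\<close>

lemma Im_inverse_sum_ge:
  fixes ws :: "complex list"
  assumes "0 < h" "\<forall>w\<in>set ws. h \<le> Im w" "ws \<noteq> []"
    and "(\<Sum>w\<leftarrow>ws. inverse w) * v = of_nat (length ws)"
  shows "h \<le> Im v"
proof -
  \<comment> \<open>Inversion takes the half-plane \<open>h \<le> Im w\<close> into the disc with
    diameter from 0 to \<open>- \<i> / h\<close>; the inequality describes that disc.\<close>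
  have disc: "Im (inverse w) \<le> - h * (cmod (inverse w))\<^sup>2" if "h \<le> Im w" for w
  proof -
    from that assms(1) have "w \<noteq> 0" by auto
    then have "Im (inverse w) = - Im w * (cmod (inverse w))\<^sup>2"
      by (simp add: norm_inverse power_inverse cmod_power2 divide_inverse)
    then show ?thesis using that by (simp add: mult_right_mono)
  qed
  \<comment> \<open>A disc is convex, so it contains the mean of the inverses; convexity is
    Cauchy-Schwarz against the constant sequence 1. The number \<open>v\<close> is the inverse of
    this mean, which leads back to the half-plane.\<close>
  have S: "real (length ws) * Im (\<Sum>w\<leftarrow>ws. inverse w) \<le> - h * (cmod (\<Sum>w\<leftarrow>ws. inverse w))\<^sup>2"
  proof -
    let ?n = "length ws" and ?v = "\<lambda>i. inverse (ws ! i)"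
    have sl: "(\<Sum>w\<leftarrow>ws. inverse w) = (\<Sum>i<?n. ?v i)"
      by (simp add: sum_list_sum_nth atLeast0LessThan)
    have "(cmod (\<Sum>i<?n. ?v i))\<^sup>2 \<le> (\<Sum>i<?n. 1 * cmod (?v i))\<^sup>2"
      by (intro power_mono) (auto intro: norm_sum)
    also have "\<dots> \<le> (\<Sum>i<?n. 1\<^sup>2) * (\<Sum>i<?n. (cmod (?v i))\<^sup>2)"
      by (rule Cauchy_Schwarz_ineq_sum)
    finally have "h * (cmod (\<Sum>i<?n. ?v i))\<^sup>2 \<le> h * (real ?n * (\<Sum>i<?n. (cmod (?v i))\<^sup>2))"
      using assms(1) by (intro mult_left_mono) auto
    moreover have "Im (\<Sum>i<?n. ?v i) \<le> (\<Sum>i<?n. - h * (cmod (?v i))\<^sup>2)"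
      unfolding Im_sum using assms(2) by (intro sum_mono disc) auto
    then have "real ?n * Im (\<Sum>i<?n. ?v i) \<le> real ?n * (\<Sum>i<?n. - h * (cmod (?v i))\<^sup>2)"
      by (intro mult_left_mono) auto
    ultimately show ?thesis
      unfolding sl by (simp add: sum_negf sum_distrib_left[symmetric] algebra_simps)
  qed
  define u where "u = (\<Sum>w\<leftarrow>ws. inverse w)"
  have n: "0 < length ws" using assms(3) by simp
  have u0: "u \<noteq> 0" using assms(4) n unfolding u_def[symmetric] by auto
  have v: "v = of_nat (length ws) / u"
    using assms(4) u0 unfolding u_def[symmetric] by (simp add: field_simps)
  have "Im v = - real (length ws) * Im u / (cmod u)\<^sup>2"
    unfolding v by (simp add: Im_divide cmod_power2)
  moreover have "h * (cmod u)\<^sup>2 \<le> - real (length ws) * Im u"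
    using S unfolding u_def[symmetric] by simp
  moreover have "Im v * (cmod u)\<^sup>2 = - real (length ws) * Im u"
    using calculation(1) u0 by simp
  ultimately have "h * (cmod u)\<^sup>2 \<le> Im v * (cmod u)\<^sup>2"
    by simp
  then show ?thesis using u0 by simp
qed

lemma poly_pderiv_prod_linear:
  fixes y :: "'a::field"
  assumes "\<forall>b\<in>set bs. y \<noteq> b"
  shows "poly (pderiv (\<Prod>b\<leftarrow>bs. [:- b, 1:])) y =
    poly (\<Prod>b\<leftarrow>bs. [:- b, 1:]) y * (\<Sum>b\<leftarrow>bs. inverse (y - b))"
  using assms
proof (induction bs)
  case (Cons b bs)
  define P where "P = (\<Prod>b\<leftarrow>bs. [:- b, 1:])"
  define L where "L = [:- b, 1:]"
  have L: "pderiv L = 1" "poly L y = y - b"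
    by (simp_all add: L_def pderiv_pCons)
  have "y - b \<noteq> 0" "poly (pderiv P) y = poly P y * (\<Sum>b\<leftarrow>bs. inverse (y - b))"
    using Cons by (auto simp: P_def)
  then have "poly (pderiv (L * P)) y = poly (L * P) y * (inverse (y - b) + (\<Sum>b\<leftarrow>bs. inverse (y - b)))"
    by (simp add: pderiv_mult L field_simps)
  then show ?case by (simp only: P_def L_def list.map prod_list.Cons sum_list.Cons)
qed auto

lemma complex_poly_linear_factors:
  fixes p :: "complex poly"
  assumes "p \<noteq> 0"
  obtains bs where "length bs = degree p" "p = smult (lead_coeff p) (\<Prod>b\<leftarrow>bs. [:- b, 1:])"
proof -
  obtain A where "size A = degree p" "p = smult (lead_coeff p) (\<Prod>x\<in>#A. [:- x, 1:])"
    using alg_closed_imp_factorization[OF assms] by blast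
  moreover obtain bs where "mset bs = A" using ex_mset by blast
  ultimately show ?thesis
    using that[of bs] by (metis mset_map prod_mset_prod_list size_mset)
qed

text \<open>Vieta's formula. It exposes the leading coefficient of a polar derivative, a multiple of
  the difference between the pole and the mean of the roots.\<close>

lemma coeff_prod_linear_subleading:
  fixes bs :: "'a::idom list"
  assumes "bs \<noteq> []"
  shows "coeff (\<Prod>b\<leftarrow>bs. [:- b, 1:]) (length bs - 1) = - sum_list bs"
proof -
  have deg: "degree (\<Prod>b\<leftarrow>bs. [:- b, 1:]) = length bs" for bs :: "'a list"
  proof (induction bs)
    case (Cons b bs)
    have "(\<Prod>b\<leftarrow>bs. [:- b, 1:]) \<noteq> 0" by (auto simp: prod_list_zero_iff)
    with Cons show ?case
      unfolding list.map prod_list.Cons by (subst degree_mult_eq) auto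
  qed simp
  have lc: "coeff (\<Prod>b\<leftarrow>bs. [:- b, 1:]) (length bs) = 1" for bs :: "'a list"
    by (induction bs) (auto simp: coeff_eq_0 deg)
  show ?thesis using assms
  proof (induction bs)
    case (Cons b bs)
    show ?case
    proof (cases bs)
      case (Cons c cs)
      then have "length bs = Suc (length cs)" by simp
      with Cons.IH Cons lc[of bs] show ?thesis by (simp add: algebra_simps)
    qed simp
  qed simp
qed

text \<open>If \<open>h\<close> vanished at \<open>y\<close>, the harmonic mean of the numbers
  \<open>y - b\<close> over the roots \<open>b\<close> of \<open>g\<close> would be
  \<open>y - a\<close>. All \<open>y - b\<close> have imaginary part at least
  \<open>Im y - s\<close>, hence so would \<open>y - a\<close>, against \<open>s < Im a\<close>. The
  degree drops by exactly one because \<open>a\<close> lies above the mean of the roots.\<close>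

lemma polar_derivative_no_roots:
  fixes g :: "complex poly"
  assumes deg: "degree g = Suc n" and g: "\<And>y. s < Im y \<Longrightarrow> poly g y \<noteq> 0" and a: "s < Im a"
  defines "h \<equiv> g + smult (1 / of_nat (Suc n)) ([:a, -1:] * pderiv g)"
  shows "degree h = n" "\<And>y. s < Im y \<Longrightarrow> poly h y \<noteq> 0"
    "\<And>k. coeff h k = (of_nat (Suc n) - of_nat k) / of_nat (Suc n) * coeff g k
        + a * of_nat (Suc k) / of_nat (Suc n) * coeff g (Suc k)"
proof -
  have coeff_h: "coeff h k = (of_nat (Suc n) - of_nat k) / of_nat (Suc n) * coeff g k
        + a * of_nat (Suc k) / of_nat (Suc n) * coeff g (Suc k)" for k
  proof -
    have "coeff ([:a, -1:] * pderiv g) k = a * of_nat (Suc k) * coeff g (Suc k) - of_nat k * coeff g k"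
      by (cases k) (simp_all add: coeff_pderiv)
    then show ?thesis
      unfolding h_def by (simp add: field_simps del: of_nat_Suc mult_pCons_left)
  qed
  then show "\<And>k. coeff h k = (of_nat (Suc n) - of_nat k) / of_nat (Suc n) * coeff g k
        + a * of_nat (Suc k) / of_nat (Suc n) * coeff g (Suc k)" .
  have g0: "g \<noteq> 0" using deg by auto
  obtain bs where bs: "length bs = Suc n" "g = smult (lead_coeff g) (\<Prod>b\<leftarrow>bs. [:- b, 1:])"
    using complex_poly_linear_factors[OF g0] deg by metis
  define c where "c = lead_coeff g"
  have c: "c \<noteq> 0" using g0 by (simp add: c_def)
  have gc: "g = smult c (\<Prod>b\<leftarrow>bs. [:- b, 1:])" using bs(2) by (simp add: c_def)
  have ne: "bs \<noteq> []" using bs(1) by auto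
  have pz: "poly (\<Prod>b\<leftarrow>bs. [:- b, 1:]) b = 0" if "b \<in> set bs" for b
    using that by (induction bs) auto
  have Imb: "Im b \<le> s" if "b \<in> set bs" for b
    using g[of b] pz[OF that] gc by (metis leI mult_zero_right poly_smult)
  show "degree h = n"
  proof (rule antisym)
    show "degree h \<le> n"
    proof (rule degree_le, safe)
      fix k assume "n < k"
      then consider "k = Suc n" | "Suc n < k" by linarith
      then show "coeff h k = 0"
        by cases (use deg in \<open>auto simp: coeff_h coeff_eq_0 simp del: of_nat_Suc\<close>)
    qed
    have sub: "coeff g n = - c * sum_list bs"
      using coeff_prod_linear_subleading[OF ne] bs(1) gc by (metis coeff_smult diff_Suc_1 mult_minus_right mult_minus_left)
    have top: "coeff g (Suc n) = c" using deg c_def by simp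
    have "coeff h n * of_nat (Suc n) = c * (of_nat (Suc n) * a - sum_list bs)"
      unfolding coeff_h sub top by (simp add: field_simps del: of_nat_Suc) (simp add: algebra_simps)
    moreover have "Im (sum_list bs) < Im (of_nat (Suc n) * a)"
    proof -
      have "Im (sum_list bs) \<le> real (length bs) * s"
        using Imb
      proof (induction bs)
        case (Cons b bs)
        then have "Im b \<le> s" "Im (sum_list bs) \<le> real (length bs) * s" by auto
        then show ?case by (simp add: algebra_simps)
      qed simp
      also have "\<dots> < real (Suc n) * Im a" using bs(1) a by simp
      finally show ?thesis by simp
    qed
    then have "of_nat (Suc n) * a - sum_list bs \<noteq> 0" by (metis eq_iff_diff_eq_0 less_irrefl)
    ultimately have "coeff h n \<noteq> 0" using c by (metis mult_eq_0_iff)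
    then show "n \<le> degree h" by (rule le_degree)
  qed
  fix y assume y: "s < Im y"
  show "poly h y \<noteq> 0"
  proof
    assume 0: "poly h y = 0"
    define u where "u = (\<Sum>b\<leftarrow>bs. inverse (y - b))"
    have "\<forall>b\<in>set bs. y \<noteq> b" using Imb y by force
    from poly_pderiv_prod_linear[OF this] have "poly (pderiv g) y = poly g y * u"
      unfolding u_def gc by (simp add: pderiv_smult)
    with 0 have "poly g y * (of_nat (Suc n) + (a - y) * u) = 0"
      unfolding h_def by (simp add: field_simps del: of_nat_Suc)
    with g[OF y] have "of_nat (Suc n) + (a - y) * u = 0"
      by (metis mult_eq_0_iff)
    then have "u * (y - a) = of_nat (length bs)"
      unfolding bs(1) by (simp add: algebra_simps)
    then have "(\<Sum>w\<leftarrow>map (\<lambda>b. y - b) bs. inverse w) * (y - a) = of_nat (length (map (\<lambda>b. y - b) bs))"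
      by (simp add: u_def o_def)
    moreover have "\<forall>w\<in>set (map (\<lambda>b. y - b) bs). Im y - s \<le> Im w"
      using Imb by auto
    ultimately have "Im y - s \<le> Im (y - a)"
      using y ne by (intro Im_inverse_sum_ge[of _ "map (\<lambda>b. y - b) bs"]) auto
    then show False using a by simp
  qed
qed

text \<open>The sum is the value at \<open>as\<close> of the symmetric multiaffine form that equals
  \<open>g\<close> on the diagonal. Fixing one argument at \<open>a\<close> replaces
  \<open>g\<close> by its polar derivative with pole \<open>a\<close>, so the list is consumed point
  by point until a nonzero constant is left.\<close>

theorem grace_walsh:
  fixes g :: "complex poly"
  assumes "degree g = length as" "\<And>y. s < Im y \<Longrightarrow> poly g y \<noteq> 0" "\<forall>a\<in>set as. s < Im a"
  shows "(\<Sum>k\<le>length as. esym as k * coeff g k / of_nat (length as choose k)) \<noteq> 0"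
  using assms
proof (induction as arbitrary: g)
  case Nil
  then obtain c where "g = [:c:]" using degree_eq_zeroE by (metis list.size(3))
  with Nil.prems(2)[of "\<i> * of_real (s + 1)"] show ?case by (simp add: esym_Nil)
next
  case (Cons a as)
  let ?n = "length as"
  define h where "h = g + smult (1 / of_nat (Suc ?n)) ([:a, -1:] * pderiv g)"
  note h = polar_derivative_no_roots[of g ?n s a, folded h_def]
  have "(\<Sum>k\<le>?n. esym as k * coeff h k / of_nat (?n choose k)) \<noteq> 0"
    using Cons h by (intro Cons.IH) auto
  also have "(\<Sum>k\<le>?n. esym as k * coeff h k / of_nat (?n choose k)) =
    (\<Sum>k\<le>?n. esym as k * coeff g k / of_nat (Suc ?n choose k))
    + (\<Sum>k\<le>?n. a * esym as k * coeff g (Suc k) / of_nat (Suc ?n choose Suc k))"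
    unfolding sum.distrib[symmetric]
  proof (rule sum.cong[OF refl])
    fix k assume "k \<in> {..?n}"
    then have k: "k \<le> ?n" by simp
    \<comment> \<open>The two absorption identities trade \<open>?n choose k\<close> for
      \<open>Suc ?n choose k\<close> and \<open>Suc ?n choose Suc k\<close>; the two terms of the
      polar derivative then become the two terms in the recursion for
      \<open>esym (a # as)\<close>.\<close>
    have 1: "of_nat (Suc ?n choose k) * (of_nat (Suc ?n) - of_nat k) = (of_nat (Suc ?n) * of_nat (?n choose k) :: complex)"
    proof -
      have "(Suc ?n choose k) * (Suc ?n - k) = Suc ?n * (?n choose k)"
        using k by (metis binomial_absorb_comp mult.commute diff_Suc_1)
      then have "of_nat ((Suc ?n choose k) * (Suc ?n - k)) = (of_nat (Suc ?n * (?n choose k)) :: complex)"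
        by presburger
      then show ?thesis using k by (simp only: of_nat_mult of_nat_diff le_SucI)
    qed
    have 2: "of_nat (Suc k) * of_nat (Suc ?n choose Suc k) = (of_nat (Suc ?n) * of_nat (?n choose k) :: complex)"
      using Suc_times_binomial[of k ?n] by (metis of_nat_mult)
    have nz: "of_nat (Suc ?n choose k) \<noteq> (0::complex)" "of_nat (?n choose k) \<noteq> (0::complex)"
        "of_nat (Suc ?n choose Suc k) \<noteq> (0::complex)" "of_nat (Suc ?n) \<noteq> (0::complex)"
      using k by (auto simp del: of_nat_Suc binomial_Suc_Suc)
    have 3: "(of_nat (Suc ?n) - of_nat k) / of_nat (Suc ?n) / of_nat (?n choose k) = 1 / (of_nat (Suc ?n choose k) :: complex)"
      using 1 nz by (simp add: divide_simps mult.commute del: of_nat_Suc binomial_Suc_Suc)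
    have 4: "of_nat (Suc k) / of_nat (Suc ?n) / of_nat (?n choose k) = 1 / (of_nat (Suc ?n choose Suc k) :: complex)"
      using 2 nz by (simp add: divide_simps mult.commute del: of_nat_Suc binomial_Suc_Suc)
    have "esym as k * coeff h k / of_nat (?n choose k)
      = esym as k * coeff g k * ((of_nat (Suc ?n) - of_nat k) / of_nat (Suc ?n) / of_nat (?n choose k))
       + a * esym as k * coeff g (Suc k) * (of_nat (Suc k) / of_nat (Suc ?n) / of_nat (?n choose k))"
      using Cons.prems by (subst h(3)) (auto simp: add_divide_distrib algebra_simps simp del: of_nat_Suc)
    also have "\<dots> = esym as k * coeff g k / of_nat (Suc ?n choose k)
        + a * esym as k * coeff g (Suc k) / of_nat (Suc ?n choose Suc k)"
      unfolding 3 4 by simp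
    finally show "esym as k * coeff h k / of_nat (?n choose k) =
        esym as k * coeff g k / of_nat (Suc ?n choose k)
        + a * esym as k * coeff g (Suc k) / of_nat (Suc ?n choose Suc k)" .
  qed
  also have "(\<Sum>k\<le>?n. esym as k * coeff g k / of_nat (Suc ?n choose k))
    = (\<Sum>k\<le>Suc ?n. esym as k * coeff g k / of_nat (Suc ?n choose k))"
    by (simp add: esym_eq_0)
  also have "\<dots> = coeff g 0 + (\<Sum>k\<le>?n. esym as (Suc k) * coeff g (Suc k) / of_nat (Suc ?n choose Suc k))"
    by (subst sum.atMost_Suc_shift) (simp del: binomial_Suc_Suc)
  also have "\<dots> + (\<Sum>k\<le>?n. a * esym as k * coeff g (Suc k) / of_nat (Suc ?n choose Suc k)) =
      coeff g 0 + (\<Sum>k\<le>?n. esym (a # as) (Suc k) * coeff g (Suc k) / of_nat (Suc ?n choose Suc k))"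
    by (simp add: esym_Cons_Suc sum.distrib add_divide_distrib algebra_simps del: binomial_Suc_Suc)
  also have "\<dots> = (\<Sum>k\<le>Suc ?n. esym (a # as) k * coeff g k / of_nat (Suc ?n choose k))"
    by (simp only: sum.atMost_Suc_shift) (simp del: binomial_Suc_Suc)
  finally show ?case by (simp del: binomial_Suc_Suc)
qed

section \<open>Coefficients in the binomial basis and the two finite free convolutions\<close>

definition nesym :: "'a::field_char_0 list \<Rightarrow> nat \<Rightarrow> 'a" where
  "nesym l k = esym l k / of_nat (length l choose k)"

lemma nesym_0 [simp]: "nesym l 0 = 1"
  by (simp add: nesym_def)

lemma nesym_eq_0: "length l < k \<Longrightarrow> nesym l k = 0"
  by (simp add: nesym_def)

lemma nesym_pos:
  fixes l :: "real list"
  assumes "\<forall>a\<in>set l. 0 < a" "k \<le> length l"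
  shows "0 < nesym l k"
  using esym_pos[OF assms] assms(2) by (simp add: nesym_def)

lemma real_poly_negative_roots_factorization:
  fixes p :: "real poly"
  assumes "coeff p 0 = 1"
    "\<And>z. poly (map_poly of_real p) z = (0::complex) \<Longrightarrow> \<exists>r<0. z = of_real r"
  shows "\<exists>m. length m = degree p \<and> (\<forall>a\<in>set m. 0 < a) \<and> p = (\<Prod>a\<leftarrow>m. [:1, a:])"
  using assms
proof (induction "degree p" arbitrary: p)
  case 0
  then obtain c where "p = [:c:]" using degree_eq_zeroE by metis
  with 0 show ?case by (intro exI[of _ "[]"]) (auto simp: one_pCons)
next
  case (Suc n)
  have "degree (map_poly of_real p :: complex poly) = Suc n"
    using Suc.hyps(2) by (simp add: degree_map_poly)
  then obtain z where z: "poly (map_poly of_real p) z = (0::complex)"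
    using alg_closed_imp_poly_has_root[of "map_poly of_real p :: complex poly"] by auto
  then obtain r where r: "r < 0" "z = of_real r" using Suc.prems(2) by blast
  have "poly (map_poly of_real p) (of_real r) = (of_real (poly p r) :: complex)"
    by (induction p) (auto simp: map_poly_pCons)
  then have "poly p r = 0" using z unfolding r(2) by (metis of_real_eq_0_iff)
  then obtain q0 where q0: "p = [:- r, 1:] * q0"
    by (metis dvdE poly_eq_0_iff_dvd)
  define q where "q = smult (- r) q0"
  have pq: "p = [:1, - 1 / r:] * q"
    using r unfolding q0 q_def by (simp add: field_simps)
  have "p \<noteq> 0" using Suc.prems(1) by auto
  then have "q \<noteq> 0" using pq by auto
  have dq: "n = degree q"
  proof -
    have "degree p = degree [:1, - 1 / r:] + degree q"
      unfolding pq using \<open>q \<noteq> 0\<close> by (intro degree_mult_eq) auto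
    then show ?thesis using Suc.hyps(2) r by simp
  qed
  have "coeff q 0 = 1" using Suc.prems(1) unfolding pq by simp
  moreover have "\<exists>r<0. y = of_real r" if "poly (map_poly of_real q) y = (0::complex)" for y
  proof (rule Suc.prems(2))
    have "map_poly of_real p = map_poly of_real [:1, - 1 / r:] * (map_poly of_real q :: complex poly)"
      unfolding pq by (rule poly_eqI) (simp add: coeff_map_poly coeff_mult del: mult_pCons_left)
    then show "poly (map_poly of_real p) y = 0" using that by simp
  qed
  ultimately obtain m where m: "length m = degree q" "\<forall>a\<in>set m. 0 < a" "q = (\<Prod>a\<leftarrow>m. [:1, a:])"
    using Suc.hyps(1)[OF dq] by blast
  show ?case
    using m r dq Suc.hyps(2) pq by (intro exI[of _ "(- 1 / r) # m"]) (auto simp: divide_neg_neg)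
qed

text \<open>Excluding zeros in the open upper half-plane is enough: real coefficients carry this to
  the lower half-plane by conjugation, and positive coefficients leave no zero on the nonnegative
  real axis. All zeros are then negative, and \<open>c 0 = 1\<close> turns them into factors
  \<open>1 + a X\<close>.\<close>

lemma list_with_esym:
  fixes c :: "nat \<Rightarrow> real"
  assumes c0: "c 0 = 1" and pos: "\<And>k. k \<le> d \<Longrightarrow> 0 < c k"
    and nz: "\<And>z. 0 < Im z \<Longrightarrow> (\<Sum>k\<le>d. of_real (c k) * z ^ k) \<noteq> 0"
  obtains m where "length m = d" "\<forall>a\<in>set m. 0 < a" "\<And>k. k \<le> d \<Longrightarrow> esym m k = c k"
proof -
  define p where "p = (\<Sum>k\<le>d. monom (c k) k)"
  have cf: "coeff p k = (if k \<le> d then c k else 0)" for k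
    unfolding p_def by (auto simp: coeff_sum)
  have "degree p = d"
    using pos[of d] by (intro antisym degree_le le_degree) (auto simp: cf)
  have ev: "poly (map_poly of_real p) z = (\<Sum>k\<le>d. of_real (c k) * z ^ k)" for z :: complex
    using \<open>degree p = d\<close> by (auto simp: poly_altdef cf coeff_map_poly degree_map_poly)
  have "\<exists>r<0. z = of_real r" if z: "poly (map_poly of_real p) z = (0::complex)" for z
  proof -
    have "\<not> 0 < Im z" using nz[of z] z ev by auto
    moreover have "\<not> Im z < 0"
    proof
      assume "Im z < 0"
      then have "(\<Sum>k\<le>d. of_real (c k) * cnj z ^ k) \<noteq> 0" by (intro nz) simp
      also have "(\<Sum>k\<le>d. of_real (c k) * cnj z ^ k) = cnj (\<Sum>k\<le>d. of_real (c k) * z ^ k)"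
        by simp
      finally show False using z ev by (metis complex_cnj_zero)
    qed
    ultimately have zr: "z = of_real (Re z)" by (simp add: complex_eq_iff)
    have "Re z < 0"
    proof (rule ccontr)
      assume "\<not> Re z < 0"
      then have "0 < (\<Sum>k\<le>d. c k * Re z ^ k)"
        using c0 pos by (intro sum_pos2[of _ 0]) (auto simp: less_imp_le)
      moreover have "of_real (\<Sum>k\<le>d. c k * Re z ^ k) = (0::complex)"
        using z unfolding ev by (subst (asm) zr) simp
      ultimately show False by (metis less_irrefl of_real_eq_0_iff)
    qed
    with zr show ?thesis by blast
  qed
  moreover have "coeff p 0 = 1" using c0 cf by simp
  ultimately obtain m where "length m = degree p" "\<forall>a\<in>set m. 0 < a" "p = (\<Prod>a\<leftarrow>m. [:1, a:])"
    using real_poly_negative_roots_factorization by blast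
  with \<open>degree p = d\<close> cf that show ?thesis by (auto simp: esym_def)
qed

text \<open>Szego's composition: the polynomial with coefficients \<open>c k\<close>, at
  \<open>z\<close>, is the Grace-Walsh pairing of the points \<open>a * z\<close>, which lie in the
  upper half-plane together with \<open>z\<close>, and the real-rooted polynomial built from
  \<open>l'\<close>.\<close>

theorem finite_free_mult_conv:
  fixes l l' :: "real list"
  assumes "length l = d" "length l' = d" "\<forall>a\<in>set l. 0 < a" "\<forall>a\<in>set l'. 0 < a"
  obtains m where "length m = d" "\<forall>a\<in>set m. 0 < a" "\<And>k. k \<le> d \<Longrightarrow> nesym m k = nesym l k * nesym l' k"
proof -
  define c where "c k = esym l k * esym l' k / (d choose k)" for k
  have nz: "(\<Sum>k\<le>d. of_real (c k) * z ^ k) \<noteq> 0" if z: "0 < Im z" for z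
  proof -
    define as where "as = map (\<lambda>a. of_real a * z) l"
    define g where "g = (\<Prod>a\<leftarrow>map of_real l'. [:1, a:] :: complex poly)"
    have cg: "coeff g k = of_real (esym l' k)" for k
      unfolding g_def by (metis esym_def esym_map_of_real)
    have "degree g = length as"
    proof (rule antisym)
      show "degree g \<le> length as"
        by (rule degree_le) (auto simp: cg esym_eq_0 as_def assms)
      have "coeff g (length as) \<noteq> 0"
        using esym_pos[OF assms(4), of d] by (simp add: cg as_def assms)
      then show "length as \<le> degree g" by (rule le_degree)
    qed
    moreover have "poly g y \<noteq> 0" if "0 < Im y" for y
    proof
      assume "poly g y = 0"
      moreover have "poly g y = (\<Prod>a\<leftarrow>l'. 1 + y * of_real a)"
        unfolding g_def by (induction l') (auto simp: algebra_simps)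
      ultimately obtain a where a: "a \<in> set l'" "1 + y * of_real a = 0"
        by (auto simp: prod_list_zero_iff)
      then have "Im (1 + y * of_real a) = 0" by (metis zero_complex.sel(2))
      moreover have "a \<noteq> 0" using a(1) assms by auto
      ultimately show False using that by auto
    qed
    moreover have "\<forall>a\<in>set as. 0 < Im a" using assms z by (auto simp: as_def)
    ultimately have "(\<Sum>k\<le>length as. esym as k * coeff g k / of_nat (length as choose k)) \<noteq> 0"
      using grace_walsh by blast
    moreover have "as = map (\<lambda>a. a * z) (map of_real l)" by (simp add: as_def)
    then have "esym as k = of_real (esym l k) * z ^ k" for k
      by (simp only: esym_map_mult esym_map_of_real)
    ultimately show ?thesis
      using assms by (simp add: cg c_def as_def algebra_simps)
  qed
  have "c 0 = 1" by (simp add: c_def)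
  moreover have "0 < c k" if "k \<le> d" for k
    using that assms by (simp add: c_def esym_pos)
  ultimately obtain m where m: "length m = d" "\<forall>a\<in>set m. 0 < a" "\<And>k. k \<le> d \<Longrightarrow> esym m k = c k"
    using list_with_esym nz by blast
  with assms show ?thesis
    by (intro that[of m]) (auto simp: c_def nesym_def)
qed

text \<open>In a product of \<open>m\<close> factors \<open>x + a\<close>, the factors that
  contribute \<open>a\<close> form a set of some size \<open>j\<close>; the other
  \<open>m - j\<close> factors are chosen freely among the remaining \<open>length l - j\<close>
  entries.\<close>

lemma esym_shift:
  "esym (map (\<lambda>a. x + a) l) m = (\<Sum>j\<le>m. of_nat ((length l - j) choose (m - j)) * esym l j * x ^ (m - j))"
proof (induction l arbitrary: m)
  case Nil
  show ?case by (cases m) (auto simp: esym_Nil sum.atMost_Suc_shift simp del: sum.atMost_Suc)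
next
  case (Cons b l)
  show ?case
  proof (cases m)
    case (Suc n)
    let ?L = "length l"
    \<comment> \<open>Beyond the length the truncated subtraction breaks Pascal's rule, but there
      \<open>esym l j\<close> vanishes.\<close>
    have pascal: "of_nat ((Suc ?L - j) choose (Suc n - j)) * esym l j
        = of_nat ((?L - j) choose (Suc n - j)) * esym l j + of_nat ((?L - j) choose (n - j)) * esym l j"
      if "j \<le> n" for j
    proof (cases "j \<le> ?L")
      case True
      then show ?thesis using that by (simp add: Suc_diff_le algebra_simps)
    qed (simp add: esym_eq_0)
    have "(\<Sum>j\<le>Suc n. of_nat ((Suc ?L - j) choose (Suc n - j)) * esym (b # l) j * x ^ (Suc n - j))
      = (\<Sum>j\<le>Suc n. of_nat ((Suc ?L - j) choose (Suc n - j)) * esym l j * x ^ (Suc n - j))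
        + (\<Sum>j\<le>n. b * (of_nat ((?L - j) choose (n - j)) * esym l j * x ^ (n - j)))"
      by (simp only: sum.atMost_Suc_shift[of _ n] diff_Suc_Suc esym_Cons_Suc esym_0)
        (simp add: sum.distrib algebra_simps)
    also have "(\<Sum>j\<le>Suc n. of_nat ((Suc ?L - j) choose (Suc n - j)) * esym l j * x ^ (Suc n - j))
      = (\<Sum>j\<le>n. of_nat ((Suc ?L - j) choose (Suc n - j)) * esym l j * x ^ (Suc n - j)) + esym l (Suc n)"
      by simp
    also have "(\<Sum>j\<le>n. of_nat ((Suc ?L - j) choose (Suc n - j)) * esym l j * x ^ (Suc n - j)) =
      (\<Sum>j\<le>n. of_nat ((?L - j) choose (Suc n - j)) * esym l j * x ^ (Suc n - j))
      + (\<Sum>j\<le>n. x * (of_nat ((?L - j) choose (n - j)) * esym l j * x ^ (n - j)))"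
      unfolding sum.distrib[symmetric]
    proof (rule sum.cong[OF refl])
      fix j assume "j \<in> {..n}"
      then have j: "j \<le> n" by simp
      then have "x ^ (Suc n - j) = x * x ^ (n - j)" by (simp add: Suc_diff_le)
      with pascal[OF j] show "of_nat ((Suc ?L - j) choose (Suc n - j)) * esym l j * x ^ (Suc n - j) =
          of_nat ((?L - j) choose (Suc n - j)) * esym l j * x ^ (Suc n - j)
          + x * (of_nat ((?L - j) choose (n - j)) * esym l j * x ^ (n - j))"
        by (simp only: distrib_right distrib_left mult.assoc mult.left_commute[of _ x])
    qed
    also have "\<dots> + esym l (Suc n) = 
       (\<Sum>j\<le>Suc n. of_nat ((?L - j) choose (Suc n - j)) * esym l j * x ^ (Suc n - j))
      + (\<Sum>j\<le>n. x * (of_nat ((?L - j) choose (n - j)) * esym l j * x ^ (n - j)))"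
      by simp
    finally show ?thesis
      unfolding Suc by (simp only: list.map esym_Cons_Suc Cons.IH list.size(4) add_0_right add_Suc_right)
         (simp add: sum_distrib_left algebra_simps sum.distrib)
  qed simp
qed

lemma coeff_prod_monic: "k \<le> length l \<Longrightarrow> coeff (\<Prod>a\<leftarrow>l. [:a, 1:]) k = esym l (length l - k)"
proof (induction l arbitrary: k)
  case (Cons a l)
  show ?case
  proof (cases k)
    case 0
    have "coeff (\<Prod>a\<leftarrow>l. [:a, 1:]) 0 = esym l (length l)" using Cons.IH[of 0] by simp
    then show ?thesis using 0 by (simp add: esym_Cons_Suc esym_eq_0)
  next
    case (Suc j)
    then have j: "j \<le> length l" using Cons.prems by simp
    show ?thesis
    proof (cases "j = length l")
      case True
      have "coeff (\<Prod>a\<leftarrow>l. [:a, 1:]) (Suc (length l)) = 0"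
      proof (rule coeff_eq_0)
        have "degree (\<Prod>a\<leftarrow>l. [:a, 1:]) \<le> length l" for l :: "'a list"
        proof (induction l)
          case (Cons a l)
          have "degree ([:a, 1:] * (\<Prod>a\<leftarrow>l. [:a, 1:])) \<le> degree [:a, 1:] + degree (\<Prod>a\<leftarrow>l. [:a, 1:])"
            by (rule degree_mult_le)
          with Cons show ?case by simp
        qed simp
        then show "degree (\<Prod>a\<leftarrow>l. [:a, 1:]) < Suc (length l)" by (simp add: less_Suc_eq_le)
      qed
      then show ?thesis using Suc True Cons.IH[of j] by simp
    next
      case False
      with j have "length l - j = Suc (length l - Suc j)" "Suc j \<le> length l" by auto
      then show ?thesis using Suc Cons.IH[of j] Cons.IH[of "Suc j"] j
        by (simp add: esym_Cons_Suc)
    qed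
  qed
qed (simp add: esym_Nil)

text \<open>For fixed \<open>x\<close> in the upper half-plane, the polynomial in \<open>y\<close>
  with factors \<open>x + a' + y\<close> has all zeros on the line \<open>Im y = - Im x\<close>,
  below the real points \<open>l\<close>. Its Grace-Walsh pairing with \<open>l\<close> is a
  polynomial in \<open>x\<close>; sorting by powers of \<open>x\<close> produces the Cauchy product
  with weights \<open>1 / fact k\<close>.\<close>

theorem finite_free_add_conv:
  fixes l l' :: "real list"
  assumes "length l = d" "length l' = d" "\<forall>a\<in>set l. 0 < a" "\<forall>a\<in>set l'. 0 < a"
  obtains m where "length m = d" "\<forall>a\<in>set m. 0 < a"
    "\<And>k. k \<le> d \<Longrightarrow> nesym m k / fact k = (\<Sum>j\<le>k. nesym l j / fact j * (nesym l' (k - j) / fact (k - j)))"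
proof -
  define b where "b k = (\<Sum>j\<le>k. nesym l j / fact j * (nesym l' (k - j) / fact (k - j)))" for k
  define c where "c k = (d choose k) * (fact k * b k)" for k
  have nz': "(\<Sum>k\<le>d. of_real (c k) * x ^ (d - k)) \<noteq> 0" if x: "0 < Im x" for x
  proof -
    define as where "as = (map of_real l :: complex list)"
    define bs where "bs = map (\<lambda>a. x + a) (map of_real l')"
    define g where "g = (\<Prod>a\<leftarrow>bs. [:a, 1:])"
    have lb: "length bs = d" by (simp add: bs_def assms)
    have la: "length as = d" by (simp add: as_def assms)
    have cg: "coeff g k = (\<Sum>j\<le>d - k. of_nat ((d - j) choose k) * of_real (esym l' j) * x ^ (d - k - j))"
      if "k \<le> d" for k
    proof -
      have "coeff g k = esym bs (d - k)"
        unfolding g_def using coeff_prod_monic[of k bs] that lb by simp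
      also have "\<dots> = (\<Sum>j\<le>d - k. of_nat ((d - j) choose (d - k - j)) * of_real (esym l' j) * x ^ (d - k - j))"
        unfolding bs_def esym_shift esym_map_of_real by (simp add: assms)
      also have "\<dots> = (\<Sum>j\<le>d - k. of_nat ((d - j) choose k) * of_real (esym l' j) * x ^ (d - k - j))"
      proof (rule sum.cong[OF refl])
        fix j assume "j \<in> {..d - k}"
        then have "k \<le> d - j" "d - k - j = (d - j) - k" using that by auto
        then have "(d - j) choose (d - k - j) = (d - j) choose k"
          using binomial_symmetric by metis
        then show "of_nat ((d - j) choose (d - k - j)) * of_real (esym l' j) * x ^ (d - k - j) =
          (of_nat ((d - j) choose k) * of_real (esym l' j) * x ^ (d - k - j) :: complex)"
          by simp
      qed
      finally show ?thesis .
    qed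
    have "degree g = d"
    proof -
      have "degree (\<Prod>a\<leftarrow>bs. [:a, 1:]) = length bs" for bs :: "complex list"
      proof (induction bs)
        case (Cons a bs)
        have "(\<Prod>a\<leftarrow>bs. [:a, 1:]) \<noteq> 0" by (auto simp: prod_list_zero_iff)
        with Cons show ?case
          unfolding list.map prod_list.Cons by (subst degree_mult_eq) auto
      qed simp
      then show ?thesis using lb by (simp add: g_def)
    qed
    moreover have "poly g y \<noteq> 0" if y: "- Im x < Im y" for y
    proof
      assume "poly g y = 0"
      moreover have "poly g y = (\<Prod>a\<leftarrow>l'. x + of_real a + y)"
        unfolding g_def bs_def by (induction l') (auto simp: algebra_simps)
      ultimately obtain a where a: "a \<in> set l'" "x + of_real a + y = 0"
        by (auto simp: prod_list_zero_iff)
      then have "Im (x + of_real a + y) = 0" by (metis zero_complex.sel(2))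
      then show False using y by auto
    qed
    moreover have "\<forall>a\<in>set as. - Im x < Im a" using x by (auto simp: as_def)
    ultimately have "(\<Sum>k\<le>length as. esym as k * coeff g k / of_nat (length as choose k)) \<noteq> 0"
      using la by (intro grace_walsh[of g as "- Im x"]) auto
    also have "(\<Sum>k\<le>length as. esym as k * coeff g k / of_nat (length as choose k))
        = (\<Sum>k\<le>d. \<Sum>j\<le>d - k. of_real (esym l k) / of_nat (d choose k) *
            (of_nat ((d - j) choose k) * of_real (esym l' j)) * x ^ (d - k - j))"
      unfolding la
      by (rule sum.cong[OF refl]) (simp add: cg as_def esym_map_of_real sum_distrib_left sum_distrib_right sum_divide_distrib algebra_simps)
    also have "\<dots> = (\<Sum>k\<le>d. \<Sum>j\<le>d - k. of_real (real (d choose (k + j)) * fact (k + j) *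
        (nesym l k / fact k * (nesym l' j / fact j))) * x ^ (d - (k + j)))"
    proof (intro sum.cong refl)
      fix k j assume "k \<in> {..d}" "j \<in> {..d - k}"
      then have kj: "k + j \<le> d" by auto
      \<comment> \<open>Trinomial revision: after the normalizations the remaining binomial and
        factorial depend only on \<open>k + j\<close>, so the double sum can be collected along
        \<open>i = k + j\<close>.\<close>
      have "(d choose (k + j)) * ((k + j) choose j) = (d choose j) * ((d - j) choose k)"
        using choose_mult[of j "k + j" d] kj by simp
      moreover have "fact (k + j) = ((k + j) choose j) * (fact j * fact k :: nat)"
        using binomial_fact_lemma[of j "k + j"] by (simp add: algebra_simps)
      ultimately have "(d choose (k + j)) * fact (k + j) = ((d choose j) * ((d - j) choose k)) * (fact j * fact k)"
        by (metis mult.assoc)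
      then have "real ((d choose (k + j)) * fact (k + j)) = real (((d choose j) * ((d - j) choose k)) * (fact j * fact k))"
        by presburger
      then have E: "real (d choose (k + j)) * fact (k + j) = real (d choose j) * real ((d - j) choose k) * (fact j * fact k)"
        by simp
      have "0 < d choose j" "0 < d choose k" using kj by auto
      then have "real (d choose (k + j)) * fact (k + j) * (nesym l k / fact k * (nesym l' j / fact j))
        = esym l k / (d choose k) * (((d - j) choose k) * esym l' j)"
        unfolding E nesym_def assms by (simp add: field_simps)
      then show "of_real (esym l k) / of_nat (d choose k) *
            (of_nat ((d - j) choose k) * of_real (esym l' j)) * x ^ (d - k - j) =
         of_real (real (d choose (k + j)) * fact (k + j) *
        (nesym l k / fact k * (nesym l' j / fact j))) * x ^ (d - (k + j))"
        by simp
    qed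
    also have "\<dots> = (\<Sum>(k, j)\<in>{(k, j). k + j \<le> d}. of_real (real (d choose (k + j)) * fact (k + j) *
        (nesym l k / fact k * (nesym l' j / fact j))) * x ^ (d - (k + j)))"
      by (subst sum.Sigma) (auto intro!: sum.cong)
    also have "\<dots> = (\<Sum>i\<le>d. \<Sum>k\<le>i. of_real (real (d choose i) * fact i *
        (nesym l k / fact k * (nesym l' (i - k) / fact (i - k)))) * x ^ (d - i))"
      by (subst sum.triangle_reindex_eq) simp
    also have "\<dots> = (\<Sum>i\<le>d. of_real (c i) * x ^ (d - i))"
      by (simp add: c_def b_def sum_distrib_left sum_distrib_right algebra_simps)
    finally show ?thesis .
  qed
  \<comment> \<open>The pairing yields the reversed polynomial. Inversion exchanges the half-planes,
    so \<open>x\<close> is taken to be the conjugate of \<open>1 / z\<close>; the coefficients are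
    real, so the value is merely conjugated.\<close>
  have nz: "(\<Sum>k\<le>d. of_real (c k) * z ^ k) \<noteq> 0" if z: "0 < Im z" for z
  proof
    assume 0: "(\<Sum>k\<le>d. of_real (c k) * z ^ k) = 0"
    have z0: "z \<noteq> 0" using z by auto
    have "0 < Im (cnj (inverse z))" using z by (simp add: divide_pos_pos add_nonneg_pos)
    then have "(\<Sum>k\<le>d. of_real (c k) * cnj (inverse z) ^ (d - k)) \<noteq> 0" by (rule nz')
    also have "(\<Sum>k\<le>d. of_real (c k) * cnj (inverse z) ^ (d - k)) =
        cnj (\<Sum>k\<le>d. of_real (c k) * inverse z ^ (d - k))" by simp
    also have "(\<Sum>k\<le>d. of_real (c k) * inverse z ^ (d - k)) = inverse z ^ d * (\<Sum>k\<le>d. of_real (c k) * z ^ k)"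
      unfolding sum_distrib_left using z0
      by (intro sum.cong refl) (simp add: power_inverse field_simps flip: power_add)
    finally show False unfolding 0 by simp
  qed
  have "c 0 = 1" by (simp add: c_def b_def)
  moreover have "0 < c k" if "k \<le> d" for k
    unfolding c_def b_def using that assms
    by (intro mult_pos_pos sum_pos) (auto simp: nesym_pos)
  ultimately obtain m where m: "length m = d" "\<forall>a\<in>set m. 0 < a" "\<And>k. k \<le> d \<Longrightarrow> esym m k = c k"
    using list_with_esym nz by blast
  then show ?thesis
    by (intro that[of m]) (auto simp: c_def nesym_def b_def)
qed

section \<open>Newton's inequalities by induction on the list\<close>

text \<open>\<open>nesym\<close> averages the products over subsets of a given size, and a fraction
  \<open>(k + 1) / (n + 1)\<close> of the subsets of size \<open>k + 1\<close> contains the new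
  entry.\<close>

lemma nesym_Cons:
  fixes l :: "real list"
  assumes "length l = n" "k \<le> n"
  shows "real (Suc n) * nesym (a # l) (Suc k) = real (n - k) * nesym l (Suc k) + real (Suc k) * a * nesym l k"
proof -
  define C where "C = real (n choose k)"
  have C: "0 < C" using assms by (simp add: C_def)
  have 1: "real (Suc k) * real (Suc n choose Suc k) = real (Suc n) * C"
    unfolding C_def using Suc_times_binomial[of k n] by (metis of_nat_mult)
  have "0 < real (Suc n choose Suc k)" using assms by (simp del: binomial_Suc_Suc)
  with 1 C have A: "real (Suc n) / real (Suc n choose Suc k) = real (Suc k) / C"
    by (simp add: field_simps del: of_nat_Suc binomial_Suc_Suc)
  have B: "real (n - k) * nesym l (Suc k) = real (Suc k) * esym l (Suc k) / C"
  proof (cases "k = n")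
    case True
    then show ?thesis using assms by (simp add: esym_eq_0)
  next
    case False
    then have "0 < real (n choose Suc k)" using assms by simp
    moreover have "real (Suc k) * real (n choose Suc k) = real (n - k) * C"
    proof -
      have "Suc k * (n choose Suc k) = (n - k) * (n choose k)"
        unfolding binomial_absorb_comp binomial_absorption ..
      then show ?thesis unfolding C_def by (metis of_nat_mult)
    qed
    ultimately have "real (n - k) / real (n choose Suc k) = real (Suc k) / C"
      using C by (simp add: field_simps del: of_nat_Suc)
    then have "esym l (Suc k) * (real (n - k) / real (n choose Suc k)) = esym l (Suc k) * (real (Suc k) / C)"
      by simp
    then show ?thesis unfolding nesym_def assms(1) by (simp add: mult.commute)
  qed
  have "real (Suc n) * nesym (a # l) (Suc k) = (esym l (Suc k) + a * esym l k) * (real (Suc n) / real (Suc n choose Suc k))"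
    by (simp add: nesym_def esym_Cons_Suc assms del: binomial_Suc_Suc of_nat_Suc)
  also have "\<dots> = real (Suc k) * esym l (Suc k) / C + real (Suc k) * a * (esym l k / C)"
    unfolding A by (simp only: distrib_right times_divide_eq_right add_divide_distrib) (simp only: mult.commute mult.left_commute mult.assoc)
  also have "esym l k / C = nesym l k" by (simp add: nesym_def assms C_def)
  finally show ?thesis unfolding B .
qed

text \<open>Here \<open>a0\<close> to \<open>a3\<close> are four consecutive averages of the old
  list and \<open>t\<close> is the new entry. The difference of the two sides is
  \<open>(a2 - t * a1)\<^sup>2\<close> plus nonnegative multiples of the gaps in the three quadratic
  hypotheses.\<close>

lemma newton_step:
  fixes a0 a1 a2 a3 m p t :: real
  assumes "0 \<le> t" "1 \<le> m" "1 \<le> p" "a0 * a2 \<le> a1\<^sup>2" "a1 * a3 \<le> a2\<^sup>2" "a0 * a3 \<le> a1 * a2"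
  shows "((m + 1) * a1 + (p - 1) * t * a0) * ((m - 1) * a3 + (p + 1) * t * a2) \<le> (m * a2 + p * t * a1)\<^sup>2"
proof -
  have m: "1 \<le> m\<^sup>2" and p: "1 \<le> p\<^sup>2" using assms by (simp_all add: one_le_power)
  have 1: "(m\<^sup>2 - 1) * (a1 * a3) \<le> (m\<^sup>2 - 1) * a2\<^sup>2" using m assms by (intro mult_left_mono) auto
  have 2: "t\<^sup>2 * ((p\<^sup>2 - 1) * (a0 * a2)) \<le> t\<^sup>2 * ((p\<^sup>2 - 1) * a1\<^sup>2)" using p assms by (intro mult_left_mono) auto
  have 3: "t * ((p - 1) * (m - 1) * (a0 * a3)) \<le> t * ((p - 1) * (m - 1) * (a1 * a2))"
    using assms by (intro mult_left_mono mult_nonneg_nonneg) auto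
  have "(m * a2 + p * t * a1)\<^sup>2 - ((m + 1) * a1 + (p - 1) * t * a0) * ((m - 1) * a3 + (p + 1) * t * a2) =
    (a2 - t * a1)\<^sup>2 + ((m\<^sup>2 - 1) * a2\<^sup>2 - (m\<^sup>2 - 1) * (a1 * a3))
    + (t\<^sup>2 * ((p\<^sup>2 - 1) * a1\<^sup>2) - t\<^sup>2 * ((p\<^sup>2 - 1) * (a0 * a2)))
    + (t * ((p - 1) * (m - 1) * (a1 * a2)) - t * ((p - 1) * (m - 1) * (a0 * a3)))"
    by (simp add: power2_eq_square algebra_simps)
  moreover have "0 \<le> (a2 - t * a1)\<^sup>2" by simp
  ultimately show ?thesis using 1 2 3 by linarith
qed

theorem newton_inequality:
  fixes l :: "real list"
  assumes "\<forall>a\<in>set l. 0 < a"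
  shows "nesym l k * nesym l (Suc (Suc k)) \<le> (nesym l (Suc k))\<^sup>2"
  using assms
proof (induction l arbitrary: k)
  case (Cons a l)
  define n where "n = length l"
  define N where "N = real (Suc n)"
  have N: "0 < N" by (simp add: N_def)
  have step: "N * nesym (a # l) (Suc i) = real (n - i) * nesym l (Suc i) + real (Suc i) * a * nesym l i" if "i \<le> n" for i
    unfolding N_def using nesym_Cons[of l n i a] that by (simp add: n_def)
  have pos: "\<forall>a\<in>set l. 0 < a" "0 < a" using Cons.prems by auto
  note IH = Cons.IH[OF pos(1)]
  show ?case
  proof (cases "Suc k \<le> n")
    case False
    then have "nesym (a # l) (Suc (Suc k)) = 0" by (simp add: nesym_eq_0 n_def)
    then show ?thesis by simp
  next
    case True
    have "(N * nesym (a # l) k) * (N * nesym (a # l) (Suc (Suc k))) \<le> (N * nesym (a # l) (Suc k))\<^sup>2"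
    proof (cases k)
      case 0
      \<comment> \<open>At \<open>k = 0\<close> there is no average of index \<open>k - 1\<close>,
        so a decomposition into a square and a gap is given directly, without
        \<open>a0\<close>.\<close>
      have "(real n * nesym l 1 + a)\<^sup>2 - N * ((real n - 1) * nesym l 2 + 2 * a * nesym l 1)
         = (nesym l 1 - a)\<^sup>2 + (real n ^ 2 - 1) * ((nesym l 1)\<^sup>2 - nesym l 2)"
        by (simp add: N_def power2_eq_square algebra_simps)
      moreover have "0 \<le> (real n ^ 2 - 1) * ((nesym l 1)\<^sup>2 - nesym l 2)"
        using IH[of 0] True one_le_power[of "real n" 2]
        by (intro mult_nonneg_nonneg) (auto simp: numeral_2_eq_2 simp del: one_le_power)
      ultimately have "N * ((real n - 1) * nesym l 2 + 2 * a * nesym l 1) \<le> (real n * nesym l 1 + a)\<^sup>2"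
        by (smt (verit) zero_le_power2)
      then show ?thesis
        using True step[of 0] step[of 1] unfolding 0
        by (simp add: numeral_2_eq_2 of_nat_diff)
    next
      case (Suc j)
      define a0 a1 a2 a3 where defs: "a0 = nesym l j" "a1 = nesym l (Suc j)" "a2 = nesym l (Suc (Suc j))"
        "a3 = nesym l (Suc (Suc (Suc j)))"
      have p: "0 < a1" "0 < a2" using True Suc pos by (auto simp: defs n_def intro!: nesym_pos)
      have p': "0 \<le> a0" "0 \<le> a3"
        using True Suc nesym_pos[OF pos(1)] nesym_eq_0[of l] by (auto simp: defs n_def less_imp_le)
          (metis less_imp_le not_le order_refl)
      have i1: "a0 * a2 \<le> a1\<^sup>2" and i2: "a1 * a3 \<le> a2\<^sup>2" using IH[of j] IH[of "Suc j"] by (auto simp: defs)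
      \<comment> \<open>The product of the two known inequalities, divided by
        \<open>a1 * a2\<close>, gives the skewed one \<open>a0 * a3 \<le> a1 * a2\<close>.\<close>
      have "(a0 * a2) * (a1 * a3) \<le> a1\<^sup>2 * a2\<^sup>2" using i1 i2 p p' by (intro mult_mono) auto
      then have "(a0 * a3) * (a1 * a2) \<le> (a1 * a2) * (a1 * a2)" by (simp add: power2_eq_square algebra_simps)
      then have i3: "a0 * a3 \<le> a1 * a2" using p by (simp add: mult_le_cancel_right_pos del: mult_le_cancel_right)
      define m where "m = real n - real j - 1"
      define q where "q = real j + 2"
      have "1 \<le> m" "1 \<le> q" using True Suc by (auto simp: m_def q_def)
      from newton_step[OF less_imp_le[OF pos(2)] this i1 i2 i3]
      have "((m + 1) * a1 + (q - 1) * a * a0) * ((m - 1) * a3 + (q + 1) * a * a2) \<le> (m * a2 + q * a * a1)\<^sup>2" .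
      moreover have "N * nesym (a # l) k = (m + 1) * a1 + (q - 1) * a * a0"
        unfolding Suc using True Suc by (subst step) (auto simp: defs m_def q_def of_nat_diff algebra_simps)
      moreover have "N * nesym (a # l) (Suc k) = m * a2 + q * a * a1"
        unfolding Suc using True Suc by (subst step) (auto simp: defs m_def q_def of_nat_diff algebra_simps)
      moreover have "N * nesym (a # l) (Suc (Suc k)) = (m - 1) * a3 + (q + 1) * a * a2"
        unfolding Suc using True Suc by (subst step) (auto simp: defs m_def q_def of_nat_diff algebra_simps)
      ultimately show ?thesis by simp
    qed
    then have "N\<^sup>2 * (nesym (a # l) k * nesym (a # l) (Suc (Suc k))) \<le> N\<^sup>2 * (nesym (a # l) (Suc k))\<^sup>2"
      by (simp add: power2_eq_square algebra_simps)
    then show ?thesis using N by simp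
  qed
qed (simp add: nesym_def esym_Nil)

section \<open>Concentration of log-concave weights\<close>

locale log_concave_seq =
  fixes d :: nat and w :: "nat \<Rightarrow> real"
  assumes pos: "k \<le> d \<Longrightarrow> 0 < w k"
    and log_concave: "Suc (Suc k) \<le> d \<Longrightarrow> w k * w (Suc (Suc k)) \<le> (w (Suc k))\<^sup>2"
begin

lemma ratio_antimono: "j \<le> k \<Longrightarrow> k < d \<Longrightarrow> w (Suc k) / w k \<le> w (Suc j) / w j"
proof (induction k rule: dec_induct)
  case (step k)
  have "w (Suc (Suc k)) / w (Suc k) \<le> w (Suc k) / w k"
    using log_concave[of k] pos[of k] pos[of "Suc k"] step.prems
    by (simp add: field_simps power2_eq_square)
  with step show ?case by simp
qed simp

lemma geometric_above:
  assumes "k0 < d" "w (Suc k0) \<le> q * w k0" "k0 \<le> k" "k \<le> d" "0 \<le> q"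
  shows "w k \<le> q ^ (k - k0) * w k0"
  using assms(3,4)
proof (induction k rule: dec_induct)
  case (step k)
  have "w (Suc k) / w k \<le> w (Suc k0) / w k0" using step by (intro ratio_antimono) auto
  also have "\<dots> \<le> q" using assms pos[of k0] by (simp add: field_simps)
  finally have "w (Suc k) \<le> q * w k" using pos[of k] step by (simp add: field_simps)
  also have "\<dots> \<le> q * (q ^ (k - k0) * w k0)" using step assms(5) by (intro mult_left_mono) auto
  finally show ?case using step by (simp add: Suc_diff_le algebra_simps)
qed simp

lemma geometric_below:
  assumes "k0 < d" "Q * w k0 \<le> w (Suc k0)" "k \<le> k0" "0 \<le> Q"
  shows "Q ^ (k0 - k) * w k \<le> w k0"
  using assms(3)
proof (induction k rule: inc_induct)
  case (step k)
  have "Q \<le> w (Suc k0) / w k0" using assms pos[of k0] by (simp add: field_simps)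
  also have "\<dots> \<le> w (Suc k) / w k" using step assms by (intro ratio_antimono) auto
  finally have "Q * w k \<le> w (Suc k)" using pos[of k] step assms by (simp add: field_simps)
  then have "Q ^ (k0 - Suc k) * (Q * w k) \<le> Q ^ (k0 - Suc k) * w (Suc k)"
    using assms(4) by (intro mult_left_mono) auto
  also have "\<dots> \<le> w k0" by (rule step.IH)
  finally show ?case using step by (simp add: Suc_diff_Suc flip: power_Suc2 mult.assoc)
qed simp

lemma increasing_up_to:
  assumes "k < d" "w k \<le> w (Suc k)" "i \<le> j" "j \<le> Suc k"
  shows "w i \<le> w j"
proof -
  have "w i \<le> w (Suc i)" if "i \<le> k" for i
  proof -
    have "1 \<le> w (Suc k) / w k" using assms(2) pos[of k] assms(1) by (simp add: pos_le_divide_eq)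
    also have "\<dots> \<le> w (Suc i) / w i" using assms(1) that by (intro ratio_antimono)
    finally show ?thesis using pos[of i] assms(1) that by (simp add: pos_le_divide_eq)
  qed
  note inc = this
  show ?thesis using assms(3,4)
  proof (induction j rule: dec_induct)
    case (step j)
    then show ?case using inc[of j] by simp
  qed simp
qed

lemma decreasing_from:
  assumes "k < d" "w (Suc k) \<le> w k" "k \<le> i" "i \<le> j" "j \<le> d"
  shows "w j \<le> w i"
proof -
  have "w (Suc i) \<le> w i" if "k \<le> i" "i < d" for i
  proof -
    have "w (Suc i) / w i \<le> w (Suc k) / w k" using that by (intro ratio_antimono)
    also have "\<dots> \<le> 1" using assms(2) pos[of k] assms(1) by (simp add: pos_divide_le_eq)
    finally show ?thesis using pos[of i] that by (simp add: pos_divide_le_eq)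
  qed
  note dec = this
  show ?thesis using assms(4,5)
  proof (induction j rule: dec_induct)
    case (step j)
    then show ?case using dec[of j] assms(3) by simp
  qed simp
qed

text \<open>As the weights rise up to \<open>k\<close>, translating the window to the right by
  \<open>m\<close> does not lower them as long as the image ends at or below \<open>k\<close>. Since
  \<open>m > 2 h\<close>, the image is disjoint from the window, so the outside carries at least the
  mass of the window.\<close>

lemma window_mass_le_outside_above:
  fixes c h :: real
  assumes "k < d" "w k \<le> w (Suc k)" "2 * h < real m" "c + h + real m \<le> real k"
  shows "(\<Sum>j | j \<le> d \<and> \<bar>j - c\<bar> \<le> h. w j) \<le> (\<Sum>j | j \<le> d \<and> h < \<bar>j - c\<bar>. w j)"
proof -
  let ?A = "{j. j \<le> d \<and> \<bar>real j - c\<bar> \<le> h}"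
  have jm: "j + m \<le> k" if "j \<in> ?A" for j
  proof -
    have "real j \<le> c + h" using that by (simp add: abs_le_iff)
    then have "real (j + m) \<le> real k" using assms(4) by simp
    then show ?thesis by linarith
  qed
  have "sum w ?A \<le> (\<Sum>j\<in>?A. w (j + m))"
  proof (rule sum_mono)
    fix j assume "j \<in> ?A"
    from jm[OF this] show "w j \<le> w (j + m)" by (intro increasing_up_to[OF assms(1,2)]) auto
  qed
  also have "\<dots> = sum w ((\<lambda>j. j + m) ` ?A)"
    by (simp add: sum.reindex inj_on_def)
  also have "\<dots> \<le> (\<Sum>j | j \<le> d \<and> h < \<bar>j - c\<bar>. w j)"
  proof (rule sum_mono2)
    show "(\<lambda>j. j + m) ` ?A \<subseteq> {j. j \<le> d \<and> h < \<bar>real j - c\<bar>}"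
    proof safe
      fix j assume "j \<le> d" "\<bar>real j - c\<bar> \<le> h"
      with jm[of j] assms show "j + m \<le> d" "h < \<bar>real (j + m) - c\<bar>" by auto
    qed
  qed (use pos in \<open>auto simp: less_imp_le\<close>)
  finally show ?thesis .
qed

text \<open>Mirror image: to the right of \<open>k\<close> the weights fall, so the window is
  translated to the left. It lies at least \<open>m\<close> above \<open>k\<close>, hence the
  subtraction \<open>j - m\<close> is never truncated.\<close>

lemma window_mass_le_outside_below:
  fixes c h :: real
  assumes "k < d" "w (Suc k) \<le> w k" "2 * h < real m" "real k \<le> c - h - real m"
  shows "(\<Sum>j | j \<le> d \<and> \<bar>j - c\<bar> \<le> h. w j) \<le> (\<Sum>j | j \<le> d \<and> h < \<bar>j - c\<bar>. w j)"
proof -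
  let ?A = "{j. j \<le> d \<and> \<bar>real j - c\<bar> \<le> h}"
  have jm: "k + m \<le> j" if "j \<in> ?A" for j
  proof -
    have "c - h \<le> real j" using that by (auto simp: abs_le_iff)
    then have "real (k + m) \<le> real j" using assms(4) by simp
    then show ?thesis by linarith
  qed
  have "sum w ?A \<le> (\<Sum>j\<in>?A. w (j - m))"
  proof (rule sum_mono)
    fix j assume "j \<in> ?A"
    with jm[OF this] show "w j \<le> w (j - m)" by (intro decreasing_from[OF assms(1,2)]) auto
  qed
  also have "\<dots> = sum w ((\<lambda>j. j - m) ` ?A)"
  proof (rule sum.reindex[symmetric, unfolded o_def])
    show "inj_on (\<lambda>j. j - m) ?A"
    proof (rule inj_onI)
      fix i j assume "i \<in> ?A" "j \<in> ?A" "i - m = j - m"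
      with jm[of i] jm[of j] show "i = j" by linarith
    qed
  qed
  also have "\<dots> \<le> (\<Sum>j | j \<le> d \<and> h < \<bar>j - c\<bar>. w j)"
  proof (rule sum_mono2)
    show "(\<lambda>j. j - m) ` ?A \<subseteq> {j. j \<le> d \<and> h < \<bar>real j - c\<bar>}"
    proof safe
      fix j assume j: "j \<le> d" "\<bar>real j - c\<bar> \<le> h"
      then have "m \<le> j" using jm[of j] by simp
      with j assms show "j - m \<le> d" "h < \<bar>real (j - m) - c\<bar>" by (auto simp: of_nat_diff)
    qed
  qed (use pos in \<open>auto simp: less_imp_le\<close>)
  finally show ?thesis .
qed

end

lemma log_concave_seq_power:
  assumes "log_concave_seq d w" "0 < x"
  shows "log_concave_seq d (\<lambda>k. w k * x ^ k)"
proof -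
  interpret log_concave_seq d w by fact
  show ?thesis
  proof
    fix k assume "Suc (Suc k) \<le> d"
    from mult_right_mono[OF log_concave[OF this] zero_le_power2[of "x ^ Suc k"]]
    show "w k * x ^ k * (w (Suc (Suc k)) * x ^ Suc (Suc k)) \<le> (w (Suc k) * x ^ Suc k)\<^sup>2"
      by (simp add: power2_eq_square algebra_simps)
  qed (use pos assms in auto)
qed

section \<open>Concentration of tilted weights against ratios of neighbours\<close>

text \<open>A weak law of large numbers: for an index \<open>k\<close> drawn with probability
  proportional to \<open>u d k * x ^ k\<close>, the quotient \<open>k / d\<close> tends to
  \<open>t\<close> in probability.\<close>

definition concentrates :: "(nat \<Rightarrow> nat \<Rightarrow> real) \<Rightarrow> real \<Rightarrow> real \<Rightarrow> bool" where
  "concentrates u x t \<longleftrightarrow> (\<forall>e>0. (\<lambda>d. (\<Sum>k | k \<le> d \<and> e * real d < \<bar>real k - t * real d\<bar>. u d k * x ^ k) /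
     (\<Sum>k\<le>d. u d k * x ^ k)) \<longlonglongrightarrow> 0)"

lemma sum_split_window:
  fixes f :: "nat \<Rightarrow> real"
  shows "(\<Sum>k\<le>d. f k) = (\<Sum>k | k \<le> d \<and> \<bar>real k - c\<bar> \<le> h. f k) + (\<Sum>k | k \<le> d \<and> h < \<bar>real k - c\<bar>. f k)"
  by (subst sum.union_disjoint[symmetric]) (auto intro!: sum.cong)

lemma eventually_less_real_mult:
  assumes "0 < (e::real)"
  shows "\<forall>\<^sub>F d in sequentially. c < real d * e"
proof -
  obtain N where "c < real N * e" using reals_Archimedean3[OF assms] by blast
  moreover have "real N * e \<le> real d * e" if "N \<le> d" for d
    using that assms by (intro mult_right_mono) auto
  ultimately show ?thesis
    by (intro eventually_sequentiallyI[of N]) (meson less_le_trans)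
qed

text \<open>A ratio above \<open>1 / x\<close> would mean that the tilted weights still rise at
  \<open>t' d\<close>, well above the window around \<open>t d\<close>; then at least half of the
  mass would lie outside the window.\<close>

lemma concentrates_imp_ratio_le:
  assumes lc: "\<And>d. log_concave_seq d (u d)" and conc: "concentrates u x t" and x: "0 < x"
    and t: "t < t'" "0 < t'" "t' < 1"
  shows "\<forall>\<^sub>F d in sequentially. u d (Suc (nat \<lfloor>t' * real d\<rfloor>)) / u d (nat \<lfloor>t' * real d\<rfloor>) \<le> 1 / x"
proof -
  \<comment> \<open>The half-width \<open>e d\<close> of the window and a shift of slightly more
    than \<open>2 e d\<close> use up \<open>3 e d\<close> of the distance \<open>4 e d\<close>; the
    last \<open>e d\<close> absorbs the rounding of \<open>k\<close> and \<open>m\<close>, at most 3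
    in total.\<close>
  define e where "e = (t' - t) / 4"
  have e: "0 < e" using t by (simp add: e_def)
  have "\<forall>\<^sub>F d in sequentially. (\<Sum>k | k \<le> d \<and> e * real d < \<bar>real k - t * real d\<bar>. u d k * x ^ k) /
     (\<Sum>k\<le>d. u d k * x ^ k) < 1 / 2"
    using conc e unfolding concentrates_def by (intro order_tendstoD(2)[of _ 0]) auto
  moreover have "\<forall>\<^sub>F d in sequentially. 3 < real d * e"
    using e by (rule eventually_less_real_mult)
  moreover have "\<forall>\<^sub>F d in sequentially. 1 < real d * (1 - t')"
    using t by (intro eventually_less_real_mult) simp
  ultimately show ?thesis
  proof eventually_elim
    case (elim d)
    define k where "k = nat \<lfloor>t' * real d\<rfloor>"
    define w where "w j = u d j * x ^ j" for j
    interpret u: log_concave_seq d "u d" by (rule lc)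
    interpret w: log_concave_seq d w
      unfolding w_def by (rule log_concave_seq_power[OF lc x])
    have k: "real k \<le> t' * d" "t' * d - 1 < real k"
      using t by (simp_all add: k_def)
    then have "k < d" using elim(3) t by (simp add: algebra_simps)
    define m where "m = nat \<lceil>2 * (e * d)\<rceil> + 1"
    have m: "2 * (e * d) < real m" "real m < 2 * (e * d) + 2"
      using e by (simp_all add: m_def) linarith+
    have "\<not> w k \<le> w (Suc k)"
    proof
      assume "w k \<le> w (Suc k)"
      moreover have "t * d + e * d + real m \<le> real k"
        using k m elim(2) by (simp add: e_def field_simps)
      ultimately have "(\<Sum>j | j \<le> d \<and> \<bar>real j - t * real d\<bar> \<le> e * real d. w j) \<le> (\<Sum>j | j \<le> d \<and> e * real d < \<bar>real j - t * real d\<bar>. w j)"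
        using m \<open>k < d\<close> by (intro w.window_mass_le_outside_above[of k]) auto
      moreover have "0 < (\<Sum>k\<le>d. w k)" using w.pos by (intro sum_pos) auto
      moreover note elim(1)[folded w_def]
      ultimately show False
        using sum_split_window[of w d "t * real d" "e * real d"] by (simp add: pos_divide_less_eq)
    qed
    then have "x ^ k * (u d (Suc k) * x) < x ^ k * u d k" by (simp add: w_def mult_ac)
    then have "u d (Suc k) * x < u d k" using x by simp
    then show ?case
      unfolding k_def[symmetric] using u.pos[of k] \<open>k < d\<close> x
      by (simp add: pos_divide_le_eq pos_le_divide_eq less_imp_le)
  qed
qed

lemma concentrates_imp_ratio_ge:
  assumes lc: "\<And>d. log_concave_seq d (u d)" and conc: "concentrates u x t" and x: "0 < x"
    and t: "t' < t" "0 < t'" "t' < 1"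
  shows "\<forall>\<^sub>F d in sequentially. 1 / x \<le> u d (Suc (nat \<lfloor>t' * real d\<rfloor>)) / u d (nat \<lfloor>t' * real d\<rfloor>)"
proof -
  define e where "e = (t - t') / 4"
  have e: "0 < e" using t by (simp add: e_def)
  have "\<forall>\<^sub>F d in sequentially. (\<Sum>k | k \<le> d \<and> e * real d < \<bar>real k - t * real d\<bar>. u d k * x ^ k) /
     (\<Sum>k\<le>d. u d k * x ^ k) < 1 / 2"
    using conc e unfolding concentrates_def by (intro order_tendstoD(2)[of _ 0]) auto
  moreover have "\<forall>\<^sub>F d in sequentially. 3 < real d * e"
    using e by (rule eventually_less_real_mult)
  moreover have "\<forall>\<^sub>F d in sequentially. 1 < real d * (1 - t')"
    using t by (intro eventually_less_real_mult) simp
  ultimately show ?thesis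
  proof eventually_elim
    case (elim d)
    define k where "k = nat \<lfloor>t' * real d\<rfloor>"
    define w where "w j = u d j * x ^ j" for j
    interpret u: log_concave_seq d "u d" by (rule lc)
    interpret w: log_concave_seq d w
      unfolding w_def by (rule log_concave_seq_power[OF lc x])
    have k: "real k \<le> t' * d" "t' * d - 1 < real k"
      using t by (simp_all add: k_def)
    then have "k < d" using elim(3) t by (simp add: algebra_simps)
    define m where "m = nat \<lceil>2 * (e * d)\<rceil> + 1"
    have m: "2 * (e * d) < real m" "real m < 2 * (e * d) + 2"
      using e by (simp_all add: m_def) linarith+
    have "\<not> w (Suc k) \<le> w k"
    proof
      assume "w (Suc k) \<le> w k"
      moreover have "real k \<le> t * d - e * d - real m"
        using k m elim(2) by (simp add: e_def field_simps)
      ultimately have "(\<Sum>j | j \<le> d \<and> \<bar>real j - t * real d\<bar> \<le> e * real d. w j) \<le> (\<Sum>j | j \<le> d \<and> e * real d < \<bar>real j - t * real d\<bar>. w j)"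
        using m \<open>k < d\<close> by (intro w.window_mass_le_outside_below[of k]) auto
      moreover have "0 < (\<Sum>k\<le>d. w k)" using w.pos by (intro sum_pos) auto
      moreover note elim(1)[folded w_def]
      ultimately show False
        using sum_split_window[of w d "t * real d" "e * real d"] by (simp add: pos_divide_less_eq)
    qed
    then have "x ^ k * u d k < x ^ k * (u d (Suc k) * x)" by (simp add: w_def mult_ac)
    then have "u d k < u d (Suc k) * x" using x by simp
    then show ?case
      unfolding k_def[symmetric] using u.pos[of k] \<open>k < d\<close> x
      by (simp add: pos_divide_le_eq pos_le_divide_eq less_imp_le)
  qed
qed

text \<open>Nearby parameters squeeze the ratio: for \<open>q < p\<close> the peak
  \<open>\<alpha> q\<close> lies left of \<open>\<alpha> p\<close>, so the ratio at
  \<open>\<alpha> p\<close> is eventually at most \<open>1 / \<xi> q\<close>; for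
  \<open>q > p\<close> the inequality is reversed. Continuity of \<open>\<xi>\<close> closes the
  gap. The pair \<open>\<xi>\<close>, \<open>\<alpha>\<close> describes a curve of tilts and peaks,
  so that either coordinate may serve as the parameter.\<close>

theorem concentrates_imp_ratio_tendsto:
  fixes I :: "real set"
  assumes lc: "\<And>d. log_concave_seq d (u d)" and I: "open I" "p \<in> I"
    and conc: "\<And>q. q \<in> I \<Longrightarrow> concentrates u (\<xi> q) (\<alpha> q)"
    and \<xi>: "\<And>q. q \<in> I \<Longrightarrow> 0 < \<xi> q" "continuous_on I \<xi>"
    and \<alpha>: "strict_mono_on I \<alpha>" "0 < \<alpha> p" "\<alpha> p < 1"
  shows "(\<lambda>d. u d (Suc (nat \<lfloor>\<alpha> p * real d\<rfloor>)) / u d (nat \<lfloor>\<alpha> p * real d\<rfloor>)) \<longlonglongrightarrow> 1 / \<xi> p"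
proof -
  have cont: "((\<lambda>q. 1 / \<xi> q) \<longlongrightarrow> 1 / \<xi> p) (at p)"
    using \<xi>(1)[OF I(2)] \<xi>(2) I(2) continuous_on_eq_continuous_at[OF I(1), of \<xi>]
    by (intro tendsto_divide tendsto_const) (auto simp: isCont_def)
  have inI: "\<forall>\<^sub>F q in at p. q \<in> I" using I by (rule eventually_at_in_open')
  show ?thesis
  proof (rule order_tendstoI)
    fix c assume "1 / \<xi> p < c"
    from order_tendstoD(2)[OF cont this] inI have "\<forall>\<^sub>F q in at p. 1 / \<xi> q < c \<and> q \<in> I"
      by eventually_elim auto
    then have "\<forall>\<^sub>F q in at_left p. 1 / \<xi> q < c \<and> q \<in> I" by (simp add: eventually_at_split)
    moreover have "\<forall>\<^sub>F q in at_left p. q < p" by (simp add: eventually_at_filter)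
    ultimately have "\<forall>\<^sub>F q in at_left p. 1 / \<xi> q < c \<and> q \<in> I \<and> q < p" by eventually_elim auto
    then obtain q where q: "1 / \<xi> q < c" "q \<in> I" "q < p"
      using eventually_happens'[OF trivial_limit_at_left_real] by blast
    have "\<alpha> q < \<alpha> p" using \<alpha>(1) q I by (auto simp: strict_mono_on_def)
    with concentrates_imp_ratio_le[OF lc conc[OF q(2)] \<xi>(1)[OF q(2)] _ \<alpha>(2,3)]
    have "\<forall>\<^sub>F d in sequentially. u d (Suc (nat \<lfloor>\<alpha> p * real d\<rfloor>)) / u d (nat \<lfloor>\<alpha> p * real d\<rfloor>) \<le> 1 / \<xi> q" by simp
    then show "\<forall>\<^sub>F d in sequentially. u d (Suc (nat \<lfloor>\<alpha> p * real d\<rfloor>)) / u d (nat \<lfloor>\<alpha> p * real d\<rfloor>) < c"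
      by eventually_elim (use q in linarith)
  next
    fix c assume "c < 1 / \<xi> p"
    from order_tendstoD(1)[OF cont this] inI have "\<forall>\<^sub>F q in at p. c < 1 / \<xi> q \<and> q \<in> I"
      by eventually_elim auto
    then have "\<forall>\<^sub>F q in at_right p. c < 1 / \<xi> q \<and> q \<in> I" by (simp add: eventually_at_split)
    moreover have "\<forall>\<^sub>F q in at_right p. p < q" by (rule eventually_at_right_less)
    ultimately have "\<forall>\<^sub>F q in at_right p. c < 1 / \<xi> q \<and> q \<in> I \<and> p < q" by eventually_elim auto
    then obtain q where q: "c < 1 / \<xi> q" "q \<in> I" "p < q"
      using eventually_happens'[OF trivial_limit_at_right_real] by blast
    have "\<alpha> p < \<alpha> q" using \<alpha>(1) q I by (auto simp: strict_mono_on_def)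
    with concentrates_imp_ratio_ge[OF lc conc[OF q(2)] \<xi>(1)[OF q(2)] _ \<alpha>(2,3)]
    have "\<forall>\<^sub>F d in sequentially. 1 / \<xi> q \<le> u d (Suc (nat \<lfloor>\<alpha> p * real d\<rfloor>)) / u d (nat \<lfloor>\<alpha> p * real d\<rfloor>)" by simp
    then show "\<forall>\<^sub>F d in sequentially. c < u d (Suc (nat \<lfloor>\<alpha> p * real d\<rfloor>)) / u d (nat \<lfloor>\<alpha> p * real d\<rfloor>)"
      by eventually_elim (use q in linarith)
  qed
qed

lemma linear_times_exponential_decay:
  assumes "0 < q" "q < 1" "0 < c"
  shows "(\<lambda>d. (real d + 1) * q powr (c * real d)) \<longlonglongrightarrow> 0"
proof -
  define r where "r = q powr c"
  have r: "0 < r" "r < 1" using assms powr_less_mono2[of c q 1] by (auto simp: r_def)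
  have "(\<lambda>d. real d * r ^ d + r ^ d) \<longlonglongrightarrow> 0 + 0"
    using r by (intro tendsto_add powser_times_n_limit_0 LIMSEQ_realpow_zero) auto
  moreover have "(real d + 1) * q powr (c * real d) = real d * r ^ d + r ^ d" for d
    using r by (simp add: r_def algebra_simps powr_powr flip: powr_realpow)
  ultimately show ?thesis by simp
qed

text \<open>With \<open>q\<close> strictly between \<open>x / x'\<close> and 1, the tilted weights
  eventually shrink at least by the factor \<open>q\<close> at each step from \<open>t' d\<close>
  on, by log-concavity. Indices beyond \<open>(t + e) d\<close> are at least \<open>e d / 2\<close>
  steps away, and there are at most \<open>d + 1\<close> of them.\<close>

lemma log_concave_tail_above:
  assumes lc: "\<And>d. log_concave_seq d (u d)" and x: "0 < x" and e: "0 < e"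
    and t: "t < t'" "t' < t + e / 2" "0 < t'" "t' < 1"
    and lim: "(\<lambda>d. u d (Suc (nat \<lfloor>t' * real d\<rfloor>)) / u d (nat \<lfloor>t' * real d\<rfloor>)) \<longlonglongrightarrow> 1 / x'" and x': "x < x'"
  shows "(\<lambda>d. (\<Sum>k | k \<le> d \<and> (t + e) * real d < real k. u d k * x ^ k) / (\<Sum>k\<le>d. u d k * x ^ k)) \<longlonglongrightarrow> 0"
proof -
  have "x / x' < 1" using x x' by simp
  then obtain q where q: "x / x' < q" "q < 1" using dense by blast
  have q0: "0 < q" using q x x' by (meson divide_pos_pos less_trans)
  have "1 / x' < q / x" using q x x' by (simp add: field_simps)
  from order_tendstoD(2)[OF lim this]
  have ev: "\<forall>\<^sub>F d in sequentially. u d (Suc (nat \<lfloor>t' * real d\<rfloor>)) / u d (nat \<lfloor>t' * real d\<rfloor>) < q / x" .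
  have ev2: "\<forall>\<^sub>F d in sequentially. 1 < real d * (1 - t')"
    using t by (intro eventually_less_real_mult) simp
  show ?thesis
  proof (rule tendsto_sandwich[OF _ _ tendsto_const linear_times_exponential_decay[OF q0 q(2), of "e / 2"]])
    show "\<forall>\<^sub>F d in sequentially. 0 \<le> (\<Sum>k | k \<le> d \<and> (t + e) * real d < real k. u d k * x ^ k) / (\<Sum>k\<le>d. u d k * x ^ k)"
      using x log_concave_seq.pos[OF lc]
      by (intro always_eventually allI divide_nonneg_nonneg sum_nonneg mult_nonneg_nonneg) (auto simp: less_imp_le)
    show "\<forall>\<^sub>F d in sequentially. (\<Sum>k | k \<le> d \<and> (t + e) * real d < real k. u d k * x ^ k) / (\<Sum>k\<le>d. u d k * x ^ k)
        \<le> (real d + 1) * q powr (e / 2 * real d)"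
      using ev ev2
    proof eventually_elim
      case (elim d)
      define k0 where "k0 = nat \<lfloor>t' * real d\<rfloor>"
      define w where "w j = u d j * x ^ j" for j
      define W where "W = (\<Sum>k\<le>d. w k)"
      interpret u: log_concave_seq d "u d" by (rule lc)
      interpret w: log_concave_seq d w
        unfolding w_def by (rule log_concave_seq_power[OF lc x])
      have k: "real k0 \<le> t' * d" "t' * d - 1 < real k0"
        using t by (simp_all add: k0_def)
      then have kd: "k0 < d" using elim(2) t by (simp add: algebra_simps)
      have "u d (Suc k0) < q / x * u d k0"
        using elim(1) u.pos[of k0] kd unfolding k0_def[symmetric] by (simp add: pos_divide_less_eq)
      then have "u d (Suc k0) * x < q * u d k0" using x by (simp add: field_simps)
      then have "x ^ k0 * (u d (Suc k0) * x) \<le> x ^ k0 * (q * u d k0)"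
        using x by (intro mult_left_mono) auto
      then have step: "w (Suc k0) \<le> q * w k0" by (simp add: w_def mult_ac)
      have wW: "w k0 \<le> W"
        unfolding W_def using kd w.pos by (intro member_le_sum) (auto simp: less_imp_le)
      have W0: "0 < W" unfolding W_def using w.pos by (intro sum_pos) auto
      have "w k \<le> q powr (e / 2 * real d) * W" if "k \<le> d" "(t + e) * real d < real k" for k
      proof -
        have "t' * real d \<le> (t + e / 2) * real d" using t by (intro mult_right_mono) auto
        then have ge: "e / 2 * real d \<le> real k - real k0" using that k(1) by (simp add: algebra_simps)
        moreover have "0 \<le> e / 2 * real d" using e by simp
        ultimately have "k0 \<le> k" by linarith
        have "w k \<le> q ^ (k - k0) * w k0"
          using w.geometric_above[OF kd step \<open>k0 \<le> k\<close> that(1)] q0 by simp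
        also have "\<dots> = q powr (real k - real k0) * w k0"
          using q0 \<open>k0 \<le> k\<close> by (simp add: of_nat_diff flip: powr_realpow)
        also have "\<dots> \<le> q powr (e / 2 * real d) * W"
          using ge q0 q wW w.pos[of k0] kd by (intro mult_mono powr_mono') auto
        finally show ?thesis .
      qed
      then have "(\<Sum>k | k \<le> d \<and> (t + e) * real d < real k. w k) \<le>
         (\<Sum>k | k \<le> d \<and> (t + e) * real d < real k. q powr (e / 2 * real d) * W)"
        by (intro sum_mono) auto
      also have "\<dots> \<le> (\<Sum>k\<le>d. q powr (e / 2 * real d) * W)"
        using W0 by (intro sum_mono2) auto
      also have "\<dots> = (real d + 1) * q powr (e / 2 * real d) * W" by simp
      finally show ?case
        using W0 unfolding w_def[symmetric] W_def[symmetric] by (simp add: pos_divide_le_eq)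
    qed
  qed (use e in simp)
qed

lemma log_concave_tail_below:
  assumes lc: "\<And>d. log_concave_seq d (u d)" and x: "0 < x" and e: "0 < e"
    and t: "t' < t" "t - e / 2 < t'" "0 < t'" "t' < 1"
    and lim: "(\<lambda>d. u d (Suc (nat \<lfloor>t' * real d\<rfloor>)) / u d (nat \<lfloor>t' * real d\<rfloor>)) \<longlonglongrightarrow> 1 / x'" and x': "0 < x'" "x' < x"
  shows "(\<lambda>d. (\<Sum>k | k \<le> d \<and> real k < (t - e) * real d. u d k * x ^ k) / (\<Sum>k\<le>d. u d k * x ^ k)) \<longlonglongrightarrow> 0"
proof -
  have "1 < x / x'" using x x' by simp
  then obtain Q where Q: "1 < Q" "Q < x / x'" using dense by blast
  define q where "q = 1 / Q"
  have q: "0 < q" "q < 1" using Q by (auto simp: q_def)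
  have "Q / x < 1 / x'" using Q x x' by (simp add: field_simps)
  from order_tendstoD(1)[OF lim this]
  have ev: "\<forall>\<^sub>F d in sequentially. Q / x < u d (Suc (nat \<lfloor>t' * real d\<rfloor>)) / u d (nat \<lfloor>t' * real d\<rfloor>)" .
  have ev2: "\<forall>\<^sub>F d in sequentially. 1 < real d * (1 - t')"
    using t by (intro eventually_less_real_mult) simp
  \<comment> \<open>Compared with the upper tail, the additional factor \<open>Q\<close> pays for
    one step lost to the floor in \<open>k0\<close>.\<close>
  have dec: "(\<lambda>d. Q * ((real d + 1) * q powr (e / 2 * real d))) \<longlonglongrightarrow> Q * 0"
    using e by (intro tendsto_mult tendsto_const linear_times_exponential_decay q) auto
  show ?thesis
  proof (rule tendsto_sandwich[OF _ _ tendsto_const dec[simplified mult_zero_right]])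
    show "\<forall>\<^sub>F d in sequentially. 0 \<le> (\<Sum>k | k \<le> d \<and> real k < (t - e) * real d. u d k * x ^ k) / (\<Sum>k\<le>d. u d k * x ^ k)"
      using x log_concave_seq.pos[OF lc]
      by (intro always_eventually allI divide_nonneg_nonneg sum_nonneg mult_nonneg_nonneg) (auto simp: less_imp_le)
    show "\<forall>\<^sub>F d in sequentially. (\<Sum>k | k \<le> d \<and> real k < (t - e) * real d. u d k * x ^ k) / (\<Sum>k\<le>d. u d k * x ^ k)
        \<le> Q * ((real d + 1) * q powr (e / 2 * real d))"
      using ev ev2
    proof eventually_elim
      case (elim d)
      define k0 where "k0 = nat \<lfloor>t' * real d\<rfloor>"
      define w where "w j = u d j * x ^ j" for j
      define W where "W = (\<Sum>k\<le>d. w k)"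
      interpret u: log_concave_seq d "u d" by (rule lc)
      interpret w: log_concave_seq d w
        unfolding w_def by (rule log_concave_seq_power[OF lc x])
      have k: "real k0 \<le> t' * d" "t' * d - 1 < real k0"
        using t by (simp_all add: k0_def)
      then have kd: "k0 < d" using elim(2) t by (simp add: algebra_simps)
      have "Q / x * u d k0 < u d (Suc k0)"
        using elim(1) u.pos[of k0] kd unfolding k0_def[symmetric] by (simp add: pos_less_divide_eq)
      then have "Q * u d k0 < u d (Suc k0) * x" using x by (simp add: field_simps)
      then have "x ^ k0 * (Q * u d k0) \<le> x ^ k0 * (u d (Suc k0) * x)"
        using x by (intro mult_left_mono) auto
      then have step: "Q * w k0 \<le> w (Suc k0)" by (simp add: w_def mult_ac)
      have wW: "w k0 \<le> W"
        unfolding W_def using kd w.pos by (intro member_le_sum) (auto simp: less_imp_le)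
      have W0: "0 < W" unfolding W_def using w.pos by (intro sum_pos) auto
      have "w k \<le> Q * q powr (e / 2 * real d) * W" if "k \<le> d" "real k < (t - e) * real d" for k
      proof (cases "k \<le> k0")
        case True
        have "(t - e / 2) * real d \<le> t' * real d" using t by (intro mult_right_mono) auto
        then have ge: "e / 2 * real d - 1 \<le> real k0 - real k" using that k(2) by (simp add: algebra_simps)
        have "Q ^ (k0 - k) * w k \<le> w k0"
          using w.geometric_below[OF kd step True] Q by simp
        then have "w k \<le> q ^ (k0 - k) * w k0"
          using Q by (simp add: q_def power_divide field_simps)
        also have "\<dots> = q powr (real k0 - real k) * w k0"
          using q True by (simp add: of_nat_diff flip: powr_realpow)
        also have "\<dots> \<le> q powr (e / 2 * real d - 1) * W"
          using ge q wW w.pos[of k0] kd by (intro mult_mono powr_mono') auto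
        also have "q powr (e / 2 * real d - 1) = Q * q powr (e / 2 * real d)"
          using q Q by (simp add: powr_diff q_def)
        finally show ?thesis .
      next
        case False
        have "(t - e) * real d \<le> (t - e / 2) * real d" using e by (intro mult_right_mono) auto
        also have "\<dots> \<le> t' * real d" using t by (intro mult_right_mono) auto
        finally have "real k < real k0 + 1" using that k by linarith
        with False show ?thesis by linarith
      qed
      then have "(\<Sum>k | k \<le> d \<and> real k < (t - e) * real d. w k) \<le>
         (\<Sum>k | k \<le> d \<and> real k < (t - e) * real d. Q * q powr (e / 2 * real d) * W)"
        by (intro sum_mono) auto
      also have "\<dots> \<le> (\<Sum>k\<le>d. Q * q powr (e / 2 * real d) * W)"
        using W0 Q by (intro sum_mono2) auto
      also have "\<dots> = Q * ((real d + 1) * q powr (e / 2 * real d)) * W" by simp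
      finally show ?case
        using W0 unfolding w_def[symmetric] W_def[symmetric] by (simp add: pos_divide_le_eq)
    qed
  qed
qed

text \<open>Points \<open>q > p\<close> and \<open>r < p\<close>, so close to \<open>p\<close> that
  \<open>\<alpha>\<close> moves by less than \<open>e / 2\<close>, provide the starting indices for
  the two tails. Strict monotonicity of \<open>\<xi>\<close> puts the limiting ratios there strictly
  below and above \<open>1 / \<xi> p\<close>, which forces geometric decay on both sides.\<close>

theorem ratio_tendsto_imp_concentrates:
  fixes I :: "real set"
  assumes lc: "\<And>d. log_concave_seq d (u d)" and I: "open I" "p \<in> I"
    and lim: "\<And>q. q \<in> I \<Longrightarrow> (\<lambda>d. u d (Suc (nat \<lfloor>\<alpha> q * real d\<rfloor>)) / u d (nat \<lfloor>\<alpha> q * real d\<rfloor>)) \<longlonglongrightarrow> 1 / \<xi> q"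
    and \<xi>: "\<And>q. q \<in> I \<Longrightarrow> 0 < \<xi> q" "strict_mono_on I \<xi>"
    and \<alpha>: "continuous_on I \<alpha>" "strict_mono_on I \<alpha>" "\<And>q. q \<in> I \<Longrightarrow> 0 < \<alpha> q \<and> \<alpha> q < 1"
  shows "concentrates u (\<xi> p) (\<alpha> p)"
  unfolding concentrates_def
proof safe
  fix e :: real assume e: "0 < e"
  have cont: "(\<alpha> \<longlongrightarrow> \<alpha> p) (at p)"
    using \<alpha>(1) I(2) continuous_on_eq_continuous_at[OF I(1), of \<alpha>] by (auto simp: isCont_def)
  have inI: "\<forall>\<^sub>F q in at p. q \<in> I" using I by (rule eventually_at_in_open')
  have "\<alpha> p < \<alpha> p + e / 2" "\<alpha> p - e / 2 < \<alpha> p" using e by auto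
  from order_tendstoD(2)[OF cont this(1)] order_tendstoD(1)[OF cont this(2)] inI
  have ev: "\<forall>\<^sub>F q in at p. \<alpha> q < \<alpha> p + e / 2 \<and> \<alpha> p - e / 2 < \<alpha> q \<and> q \<in> I"
    by eventually_elim auto
  have lt: "\<forall>\<^sub>F q in at_right p. p < q" "\<forall>\<^sub>F q in at_left p. q < p"
    by (auto simp: eventually_at_filter)
  from ev have "\<forall>\<^sub>F q in at_right p. \<alpha> q < \<alpha> p + e / 2 \<and> \<alpha> p - e / 2 < \<alpha> q \<and> q \<in> I"
    unfolding eventually_at_split by blast
  then obtain q where q: "\<alpha> q < \<alpha> p + e / 2" "q \<in> I" "p < q"
    using eventually_happens'[OF trivial_limit_at_right_real eventually_conj[OF _ lt(1)]] by blast
  from ev have "\<forall>\<^sub>F q in at_left p. \<alpha> q < \<alpha> p + e / 2 \<and> \<alpha> p - e / 2 < \<alpha> q \<and> q \<in> I"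
    unfolding eventually_at_split by blast
  then obtain r where r: "\<alpha> p - e / 2 < \<alpha> r" "r \<in> I" "r < p"
    using eventually_happens'[OF trivial_limit_at_left_real eventually_conj[OF _ lt(2)]] by blast
  note sm = strict_mono_onD[OF \<xi>(2)] strict_mono_onD[OF \<alpha>(2)]
  let ?x = "\<xi> p" and ?t = "\<alpha> p"
  let ?W = "\<lambda>d. \<Sum>k\<le>d. u d k * ?x ^ k"
  have up: "(\<lambda>d. (\<Sum>k | k \<le> d \<and> (?t + e) * real d < real k. u d k * ?x ^ k) / ?W d) \<longlonglongrightarrow> 0"
    using \<xi>(1)[OF I(2)] \<alpha>(3)[OF q(2)] q sm I(2) e
    by (intro log_concave_tail_above[OF lc _ _ _ _ _ _ lim[OF q(2)]]) auto
  have dn: "(\<lambda>d. (\<Sum>k | k \<le> d \<and> real k < (?t - e) * real d. u d k * ?x ^ k) / ?W d) \<longlonglongrightarrow> 0"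
    using \<xi>(1)[OF I(2)] \<xi>(1)[OF r(2)] \<alpha>(3)[OF r(2)] r sm I(2) e
    by (intro log_concave_tail_below[OF lc _ _ _ _ _ _ lim[OF r(2)]]) auto
  have "(\<Sum>k | k \<le> d \<and> e * real d < \<bar>real k - ?t * real d\<bar>. u d k * ?x ^ k) =
      (\<Sum>k | k \<le> d \<and> (?t + e) * real d < real k. u d k * ?x ^ k)
      + (\<Sum>k | k \<le> d \<and> real k < (?t - e) * real d. u d k * ?x ^ k)" for d
  proof (subst sum.union_disjoint[symmetric])
    have *: "(e * real d < \<bar>real k - ?t * real d\<bar>) = ((?t + e) * real d < real k \<or> real k < (?t - e) * real d)" for k
      by (auto simp: algebra_simps abs_if)
    have "\<not> real k < (?t - e) * real d" if "(?t + e) * real d < real k" for k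
    proof -
      have "(?t - e) * real d \<le> (?t + e) * real d" using e by (intro mult_right_mono) auto
      then show ?thesis using that by linarith
    qed
    then show "{k. k \<le> d \<and> (?t + e) * real d < real k} \<inter> {k. k \<le> d \<and> real k < (?t - e) * real d} = {}"
      by auto
    show "(\<Sum>k | k \<le> d \<and> e * real d < \<bar>real k - ?t * real d\<bar>. u d k * ?x ^ k) =
      (\<Sum>k\<in>{k. k \<le> d \<and> (?t + e) * real d < real k} \<union> {k. k \<le> d \<and> real k < (?t - e) * real d}. u d k * ?x ^ k)"
      unfolding * by (rule sum.cong) auto
  qed auto
  then show "(\<lambda>d. (\<Sum>k | k \<le> d \<and> e * real d < \<bar>real k - ?t * real d\<bar>. u d k * ?x ^ k) / ?W d) \<longlonglongrightarrow> 0"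
    using tendsto_add[OF up dn] by (simp add: add_divide_distrib)
qed

text \<open>The normalized weights \<open>esym l k * x ^ k\<close> are the law of a sum of independent Bernoulli variables.\<close>

lemma esym_moments:
  fixes l :: "real list" and x :: real
  assumes "\<forall>a\<in>set l. 0 < a" "0 < x"
  defines "Z \<equiv> \<Prod>a\<leftarrow>l. 1 + a * x" and "M \<equiv> \<Sum>a\<leftarrow>l. a * x / (1 + a * x)"
  shows "(\<Sum>k\<le>length l. esym l k * x ^ k) = Z"
    "(\<Sum>k\<le>length l. esym l k * x ^ k * real k) = M * Z"
    "(\<Sum>k\<le>length l. esym l k * x ^ k * (real k - M)\<^sup>2) \<le> real (length l) * Z"
proof -
  \<comment> \<open>\<open>L l f\<close> is the unnormalized expectation of \<open>f\<close>.
    Splitting off one entry conditions on its Bernoulli variable, with weight 1 for failure and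
    \<open>a * x\<close> for success.\<close>
  define L where "L l f = (\<Sum>k\<le>length l. esym l k * x ^ k * f (real k))" for l :: "real list" and f
  have L_Cons: "L (a # l) f = L l f + a * x * L l (\<lambda>k. f (k + 1))" for a l f
  proof -
    have "L (a # l) f = f 0 + (\<Sum>k\<le>length l. esym (a # l) (Suc k) * x ^ Suc k * f (real (Suc k)))"
      unfolding L_def by (simp add: sum.atMost_Suc_shift del: sum.atMost_Suc of_nat_Suc)
    also have "\<dots> = f 0 + (\<Sum>k\<le>length l. esym l (Suc k) * x ^ Suc k * f (real (Suc k)))
        + a * x * (\<Sum>k\<le>length l. esym l k * x ^ k * f (real (Suc k)))"
      by (simp add: esym_Cons_Suc sum.distrib sum_distrib_left algebra_simps)
    also have "f 0 + (\<Sum>k\<le>length l. esym l (Suc k) * x ^ Suc k * f (real (Suc k)))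
        = (\<Sum>k\<le>Suc (length l). esym l k * x ^ k * f (real k))"
      by (simp add: sum.atMost_Suc_shift del: sum.atMost_Suc of_nat_Suc)
    also have "\<dots> = L l f" by (simp add: L_def esym_eq_0)
    finally show ?thesis by (simp add: L_def add.commute)
  qed
  have L_add: "L l (\<lambda>k. f k + g k) = L l f + L l g" for l f g
    by (simp add: L_def sum.distrib algebra_simps)
  have L_scale: "L l (\<lambda>k. c * f k) = c * L l f" for l f c
    by (simp add: L_def sum_distrib_left algebra_simps)
  have "L l (\<lambda>k. 1) = Z \<and> L l (\<lambda>k. k) = M * Z \<and> L l (\<lambda>k. (k - M)\<^sup>2) \<le> real (length l) * Z \<and> 0 < Z"
    using assms(1) unfolding Z_def M_def
  proof (induction l)
    case (Cons a l)
    define z where "z = (\<Prod>a\<leftarrow>l. 1 + a * x)"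
    define m where "m = (\<Sum>a\<leftarrow>l. a * x / (1 + a * x))"
    define p where "p = a * x / (1 + a * x)"
    have ax: "0 < a * x" using Cons.prems assms(2) by simp
    have IH: "L l (\<lambda>k. 1) = z" "L l (\<lambda>k. k) = m * z" "L l (\<lambda>k. (k - m)\<^sup>2) \<le> real (length l) * z" "0 < z"
      using Cons by (auto simp: z_def m_def)
    have ax_p: "a * x = (1 + a * x) * p" using ax by (simp add: p_def)
    have 1: "L (a # l) (\<lambda>k. 1) = (1 + a * x) * z"
      unfolding L_Cons using IH by (simp add: algebra_simps)
    have "L l (\<lambda>k. k + 1) = m * z + z"
      using L_add[of l "\<lambda>k. k" "\<lambda>k. 1"] IH by simp
    then have "L (a # l) (\<lambda>k. k) = m * z + a * x * (m * z + z)"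
      unfolding L_Cons using IH by simp
    also have "\<dots> = (m * (1 + a * x) + (1 + a * x) * p) * z" unfolding ax_p[symmetric] by (simp add: algebra_simps)
    finally have 2: "L (a # l) (\<lambda>k. k) = (p + m) * ((1 + a * x) * z)" by (simp add: algebra_simps)
    \<comment> \<open>The cross term drops out because \<open>m\<close> is the mean; this is why
      variances add. The new variable contributes at most 1.\<close>
    have sq: "L l (\<lambda>k. (k - m - c)\<^sup>2) = L l (\<lambda>k. (k - m)\<^sup>2) + c\<^sup>2 * z" for c
    proof -
      have "L l (\<lambda>k. (k - m - c)\<^sup>2) = L l (\<lambda>k. (k - m)\<^sup>2 + ((- 2 * c) * k + (2 * c * m + c\<^sup>2) * 1))"
        by (simp add: power2_eq_square algebra_simps)
      also have "\<dots> = L l (\<lambda>k. (k - m)\<^sup>2) + ((- 2 * c) * (m * z) + (2 * c * m + c\<^sup>2) * z)"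
        unfolding L_add L_scale IH(1,2) ..
      finally show ?thesis by (simp add: algebra_simps)
    qed
    have p: "0 < p" "p < 1" using ax by (auto simp: p_def)
    have "L (a # l) (\<lambda>k. (k - (p + m))\<^sup>2) = L l (\<lambda>k. (k - m - p)\<^sup>2) + a * x * L l (\<lambda>k. (k - m - (p - 1))\<^sup>2)"
      unfolding L_Cons by (simp add: algebra_simps)
    also have "\<dots> = (1 + a * x) * L l (\<lambda>k. (k - m)\<^sup>2) + (p\<^sup>2 + (a * x) * (p - 1)\<^sup>2) * z"
      unfolding sq by (simp add: algebra_simps)
    also have "\<dots> \<le> (1 + a * x) * (real (length l) * z) + (1 + a * x) * z"
    proof (rule add_mono)
      show "(1 + a * x) * L l (\<lambda>k. (k - m)\<^sup>2) \<le> (1 + a * x) * (real (length l) * z)"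
        using ax IH(3) by (intro mult_left_mono) auto
      have "p\<^sup>2 \<le> 1" "(p - 1)\<^sup>2 \<le> 1" using p by (simp_all add: power_le_one abs_square_le_1)
      then have "p\<^sup>2 + (a * x) * (p - 1)\<^sup>2 \<le> 1 + a * x"
        using ax mult_left_mono[of "(p - 1)\<^sup>2" 1 "a * x"] by simp
      then show "(p\<^sup>2 + (a * x) * (p - 1)\<^sup>2) * z \<le> (1 + a * x) * z"
        using IH(4) by (intro mult_right_mono) auto
    qed
    finally have 3: "L (a # l) (\<lambda>k. (k - (p + m))\<^sup>2) \<le> real (length (a # l)) * ((1 + a * x) * z)"
      by (simp add: algebra_simps)
    show ?case
      using 1 2 3 IH(4) ax by (simp add: z_def[symmetric] m_def[symmetric] p_def[symmetric] add_pos_pos)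
  qed (auto simp: L_def esym_Nil)
  then show "(\<Sum>k\<le>length l. esym l k * x ^ k) = Z"
    "(\<Sum>k\<le>length l. esym l k * x ^ k * real k) = M * Z"
    "(\<Sum>k\<le>length l. esym l k * x ^ k * (real k - M)\<^sup>2) \<le> real (length l) * Z"
    by (auto simp: L_def)
qed

text \<open>The mean success probability of the Bernoulli variables behind \<open>esym\<close>; for
  nonempty lists it is also \<open>npsi\<close> of the empirical measure of the entries.\<close>

definition emp_mean :: "real list \<Rightarrow> real \<Rightarrow> real" where
  "emp_mean l x = (\<Sum>a\<leftarrow>l. a * x / (1 + a * x)) / real (length l)"

text \<open>Chebyshev's inequality: the index has mean \<open>d * emp_mean (l d) x\<close> and
  variance at most \<open>d\<close>. Half of the window absorbs the distance of the mean from
  \<open>t d\<close> and the other half is the deviation, whence the bound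
  \<open>4 / (e\<^sup>2 * d)\<close>.\<close>

lemma emp_mean_tendsto_imp_concentrates:
  assumes l: "\<And>d. length (l d) = d" "\<And>d. \<forall>a\<in>set (l d). 0 < a" and x: "0 < x"
    and lim: "(\<lambda>d. emp_mean (l d) x) \<longlonglongrightarrow> t"
  shows "concentrates (\<lambda>d. esym (l d)) x t"
  unfolding concentrates_def
proof safe
  fix e :: real assume e: "0 < e"
  have "\<forall>\<^sub>F d in sequentially. \<bar>emp_mean (l d) x - t\<bar> < e / 2"
    using lim e unfolding tendsto_iff dist_real_def by (auto elim: allE[of _ "e / 2"])
  moreover have "\<forall>\<^sub>F d in sequentially. 0 < real d"
    using eventually_gt_at_top[of 0] by eventually_elim simp
  ultimately have ub: "\<forall>\<^sub>F d in sequentially.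
      (\<Sum>k | k \<le> d \<and> e * real d < \<bar>real k - t * real d\<bar>. esym (l d) k * x ^ k) /
        (\<Sum>k\<le>d. esym (l d) k * x ^ k) \<le> 4 / e\<^sup>2 * (1 / real d)"
  proof eventually_elim
    case (elim d)
    define M where "M = (\<Sum>a\<leftarrow>l d. a * x / (1 + a * x))"
    have ME: "M = emp_mean (l d) x * real d" using elim(2) by (simp add: emp_mean_def M_def l)
    define Z where "Z = (\<Prod>a\<leftarrow>l d. 1 + a * x)"
    note mom = esym_moments[OF l(2) x, of d, folded M_def Z_def, unfolded l]
    have pos: "0 < esym (l d) k * x ^ k" if "k \<le> d" for k
      using esym_pos[OF l(2)] that x by (simp add: l)
    have Z: "0 < Z" unfolding mom(1)[symmetric] using pos by (intro sum_pos) auto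
    have Mt: "\<bar>M - t * real d\<bar> < e / 2 * real d"
    proof -
      have "\<bar>M - t * real d\<bar> = \<bar>emp_mean (l d) x - t\<bar> * real d"
        unfolding ME by (simp add: abs_mult flip: left_diff_distrib)
      also have "\<dots> < e / 2 * real d" using elim by (intro mult_strict_right_mono) auto
      finally show ?thesis .
    qed
    have "(e / 2 * real d)\<^sup>2 * (\<Sum>k | k \<le> d \<and> e * real d < \<bar>real k - t * real d\<bar>. esym (l d) k * x ^ k)
      \<le> (\<Sum>k | k \<le> d \<and> e * real d < \<bar>real k - t * real d\<bar>. esym (l d) k * x ^ k * (real k - M)\<^sup>2)"
      unfolding sum_distrib_left
    proof (rule sum_mono)
      fix k assume "k \<in> {k. k \<le> d \<and> e * real d < \<bar>real k - t * real d\<bar>}"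
      then have k: "k \<le> d" "e / 2 * real d \<le> \<bar>real k - M\<bar>"
        using Mt abs_triangle_ineq[of "real k - M" "M - t * real d"] by auto
      have "(e / 2 * real d)\<^sup>2 \<le> \<bar>real k - M\<bar>\<^sup>2" using k e by (intro power_mono) auto
      then have "(e / 2 * real d)\<^sup>2 \<le> (real k - M)\<^sup>2" by simp
      from mult_right_mono[OF this less_imp_le[OF pos[OF k(1)]]]
      show "(e / 2 * real d)\<^sup>2 * (esym (l d) k * x ^ k) \<le> esym (l d) k * x ^ k * (real k - M)\<^sup>2"
        by (simp only: mult.commute[of _ "esym (l d) k * x ^ k"])
    qed
    also have "\<dots> \<le> (\<Sum>k\<le>d. esym (l d) k * x ^ k * (real k - M)\<^sup>2)"
    proof (rule sum_mono2)
      fix k assume "k \<in> {..d} - {k. k \<le> d \<and> e * real d < \<bar>real k - t * real d\<bar>}"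
      then show "0 \<le> esym (l d) k * x ^ k * (real k - M)\<^sup>2"
        by (intro mult_nonneg_nonneg[OF less_imp_le[OF pos]]) auto
    qed auto
    also have "\<dots> \<le> real d * Z" by (rule mom(3))
    finally have "(\<Sum>k | k \<le> d \<and> e * real d < \<bar>real k - t * real d\<bar>. esym (l d) k * x ^ k) \<le> 
        real d * Z / (e / 2 * real d)\<^sup>2"
      using e elim(2) by (subst pos_le_divide_eq) (auto simp: mult.commute)
    then have "(\<Sum>k | k \<le> d \<and> e * real d < \<bar>real k - t * real d\<bar>. esym (l d) k * x ^ k) / Z \<le> 
        real d / (e / 2 * real d)\<^sup>2"
      using Z by (simp add: pos_divide_le_eq)
    also have "\<dots> = 4 / e\<^sup>2 * (1 / real d)"
      using e elim(2) by (simp add: power2_eq_square)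
    finally show ?case unfolding mom(1) .
  qed
  have lim0: "(\<lambda>d. 4 / e\<^sup>2 * (1 / real d)) \<longlonglongrightarrow> 4 / e\<^sup>2 * 0"
    by (intro tendsto_mult tendsto_const lim_1_over_n)
  have nn: "\<forall>\<^sub>F d in sequentially. 0 \<le> (\<Sum>k | k \<le> d \<and> e * real d < \<bar>real k - t * real d\<bar>. esym (l d) k * x ^ k) /
        (\<Sum>k\<le>d. esym (l d) k * x ^ k)"
    using esym_pos[OF l(2)] x l(1)
    by (intro always_eventually allI divide_nonneg_nonneg sum_nonneg mult_nonneg_nonneg) (auto simp: less_imp_le)
  show "(\<lambda>d. (\<Sum>k | k \<le> d \<and> e * real d < \<bar>real k - t * real d\<bar>. esym (l d) k * x ^ k) /
        (\<Sum>k\<le>d. esym (l d) k * x ^ k)) \<longlonglongrightarrow> 0"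
    by (rule tendsto_sandwich[OF nn ub tendsto_const lim0[unfolded mult_zero_right]])
qed

text \<open>\<open>emp_mean (l d) x\<close> is the mean of the bounded quantity
  \<open>k / d\<close>, so convergence in probability implies convergence of the means. The constant
  \<open>c\<close> bounds the distance of \<open>k / d\<close> from \<open>t\<close>.\<close>

lemma concentrates_imp_emp_mean_tendsto:
  assumes l: "\<And>d. length (l d) = d" "\<And>d. \<forall>a\<in>set (l d). 0 < a" and x: "0 < x"
    and conc: "concentrates (\<lambda>d. esym (l d)) x t"
  shows "(\<lambda>d. emp_mean (l d) x) \<longlonglongrightarrow> t"
proof (rule LIMSEQ_I)
  fix r :: real assume r: "0 < r"
  define e where "e = r / 2"
  have e: "0 < e" using r by (simp add: e_def)
  define c where "c = (1 + \<bar>t\<bar>)"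
  let ?B = "\<lambda>d. (\<Sum>k | k \<le> d \<and> e * real d < \<bar>real k - t * real d\<bar>. esym (l d) k * x ^ k)"
  let ?Z = "\<lambda>d. (\<Sum>k\<le>d. esym (l d) k * x ^ k)"
  have c: "0 < c" by (simp add: c_def add_pos_nonneg)
  have "(\<lambda>d. ?B d / ?Z d) \<longlonglongrightarrow> 0" using conc e by (simp add: concentrates_def)
  then have "\<forall>\<^sub>F d in sequentially. ?B d / ?Z d < e / c"
    using e c by (intro order_tendstoD(2)[of _ 0]) auto
  moreover have "\<forall>\<^sub>F d in sequentially. 0 < real d"
    using eventually_gt_at_top[of 0] by eventually_elim simp
  ultimately have "\<forall>\<^sub>F d in sequentially. norm (emp_mean (l d) x - t) < r"
  proof eventually_elim
    case (elim d)
    define M where "M = (\<Sum>a\<leftarrow>l d. a * x / (1 + a * x))"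
    have ME: "M = emp_mean (l d) x * real d" using elim(2) by (simp add: emp_mean_def M_def l)
    define w where "w k = esym (l d) k * x ^ k" for k
    define Z where "Z = (\<Sum>k\<le>d. w k)"
    define B where "B = (\<Sum>k | k \<le> d \<and> e * real d < \<bar>real k - t * real d\<bar>. w k)"
    have mom: "(\<Sum>k\<le>d. w k * real k) = M * Z"
      using esym_moments(1,2)[OF l(2) x, of d] by (simp add: M_def w_def Z_def l)
    have pos: "0 < w k" if "k \<le> d" for k
      using esym_pos[OF l(2)] that x by (simp add: l w_def)
    have Z: "0 < Z" unfolding Z_def using pos by (intro sum_pos) auto
    have BZ: "c * B < e * Z" using elim(1) Z c unfolding w_def[symmetric] B_def[symmetric] Z_def[symmetric]
      by (simp add: field_simps)
    have "(M - t * real d) * Z = (\<Sum>k\<le>d. w k * (real k - t * real d))"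
      using mom by (simp add: Z_def algebra_simps sum_subtractf sum_distrib_left sum_distrib_right)
    then have "\<bar>M - t * real d\<bar> * Z = \<bar>\<Sum>k\<le>d. w k * (real k - t * real d)\<bar>"
      using Z by (metis abs_mult abs_of_pos)
    also have "\<dots> \<le> (\<Sum>k\<le>d. w k * \<bar>real k - t * real d\<bar>)"
      using pos by (intro order_trans[OF sum_abs] sum_mono) (simp add: abs_mult abs_of_pos)
    also have "\<dots> = (\<Sum>k | k \<le> d \<and> \<bar>real k - t * real d\<bar> \<le> e * real d. w k * \<bar>real k - t * real d\<bar>)
        + (\<Sum>k | k \<le> d \<and> e * real d < \<bar>real k - t * real d\<bar>. w k * \<bar>real k - t * real d\<bar>)"
      by (rule sum_split_window)
    also have "\<dots> \<le> (\<Sum>k | k \<le> d \<and> \<bar>real k - t * real d\<bar> \<le> e * real d. w k * (e * real d))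
        + (\<Sum>k | k \<le> d \<and> e * real d < \<bar>real k - t * real d\<bar>. w k * (c * real d))"
    proof (intro add_mono sum_mono mult_left_mono)
      fix k assume k: "k \<in> {k. k \<le> d \<and> e * real d < \<bar>real k - t * real d\<bar>}"
      have "\<bar>real k - t * real d\<bar> \<le> \<bar>real k\<bar> + \<bar>t * real d\<bar>" by (rule abs_triangle_ineq4)
      also have "\<dots> \<le> real d + \<bar>t\<bar> * real d" using k by (auto simp: abs_mult)
      finally show "\<bar>real k - t * real d\<bar> \<le> c * real d" by (simp add: c_def algebra_simps)
    qed (use pos in \<open>auto simp: less_imp_le\<close>)
    also have "\<dots> = (\<Sum>k | k \<le> d \<and> \<bar>real k - t * real d\<bar> \<le> e * real d. w k) * (e * real d) + B * (c * real d)"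
      by (simp add: B_def sum_distrib_right)
    also have "\<dots> \<le> Z * (e * real d) + B * (c * real d)"
      using pos e unfolding Z_def by (intro add_right_mono mult_right_mono sum_mono2) (auto simp: less_imp_le)
    also have "\<dots> < Z * (e * real d) + (e * Z) * real d"
    proof -
      have "(c * B) * real d < (e * Z) * real d" using BZ elim(2) by (rule mult_strict_right_mono)
      then show ?thesis by (simp add: mult_ac)
    qed
    also have "\<dots> = (r * real d) * Z" by (simp add: e_def algebra_simps)
    finally have "\<bar>M - t * real d\<bar> < r * real d" using Z by simp
    moreover have "\<bar>M - t * real d\<bar> = \<bar>emp_mean (l d) x - t\<bar> * real d"
      unfolding ME by (simp add: abs_mult flip: left_diff_distrib)
    ultimately show ?case using elim(2) by simp
  qed
  then show "\<exists>no. \<forall>n\<ge>no. norm (emp_mean (l n) x - t) < r"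
    by (simp add: eventually_sequentially)
qed

text \<open>A full Cauchy product is the law of a sum of two independent indices, whose limits add.
  Cutting it at \<open>k \<le> d\<close> costs a negligible part of the mass because
  \<open>s + t < 1\<close>.\<close>

lemma concentrates_convolution:
  assumes pos: "\<And>d k. k \<le> d \<Longrightarrow> 0 < u d k" "\<And>d k. k \<le> d \<Longrightarrow> 0 < v d k" and x: "0 < x"
    and u: "concentrates u x s" and v: "concentrates v x t" and st: "s + t < 1"
    and w: "\<And>d k. k \<le> d \<Longrightarrow> w d k = (\<Sum>j\<le>k. u d j * v d (k - j))"
  shows "concentrates w x (s + t)"
  unfolding concentrates_def
proof safe
  fix e :: real assume e: "0 < e"
  \<comment> \<open>Two indices within \<open>\<delta> d\<close> of \<open>s d\<close> and
    \<open>t d\<close> have sum at most \<open>(s + t + 2 * \<delta>) d = d\<close>, so the product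
    of the two windows survives the truncation.\<close>
  define \<delta> where "\<delta> = (1 - (s + t)) / 2"
  have \<delta>: "0 < \<delta>" using st by (simp add: \<delta>_def)
  define f where "f d k = u d k * x ^ k" for d k
  define g where "g d k = v d k * x ^ k" for d k
  define U where "U d = (\<Sum>k\<le>d. f d k)" for d
  define V where "V d = (\<Sum>k\<le>d. g d k)" for d
  define bu where "bu e d = (\<Sum>k | k \<le> d \<and> e * real d < \<bar>real k - s * real d\<bar>. f d k)" for e d
  define bv where "bv e d = (\<Sum>k | k \<le> d \<and> e * real d < \<bar>real k - t * real d\<bar>. g d k)" for e d
  have fpos: "0 < f d k" "0 < g d k" if "k \<le> d" for d k using pos x that by (auto simp: f_def g_def)
  have UV: "0 < U d" "0 < V d" for d unfolding U_def V_def using fpos by (auto intro!: sum_pos)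
  have lu: "(\<lambda>d. bu r d / U d) \<longlonglongrightarrow> 0" and lv: "(\<lambda>d. bv r d / V d) \<longlonglongrightarrow> 0" if "0 < r" for r
    using u v that by (auto simp: concentrates_def bu_def bv_def U_def V_def f_def g_def)
  have wx: "w d k * x ^ k = (\<Sum>j\<le>k. f d j * g d (k - j))" if "k \<le> d" for d k
    unfolding w[OF that] sum_distrib_right
    by (rule sum.cong) (auto simp: f_def g_def mult_ac simp flip: power_add)
  have conv: "(\<Sum>k | k \<le> d \<and> P k. w d k * x ^ k) = (\<Sum>(i, j)\<in>{(i, j). i + j \<le> d \<and> P (i + j)}. f d i * g d j)" for d P
  proof -
    have "(\<Sum>k | k \<le> d \<and> P k. w d k * x ^ k) = (\<Sum>k\<le>d. if P k then w d k * x ^ k else 0)"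
      by (subst sum.inter_filter[symmetric]) auto
    also have "\<dots> = (\<Sum>k\<le>d. \<Sum>i\<le>k. if P (i + (k - i)) then f d i * g d (k - i) else 0)"
      by (rule sum.cong) (auto simp: wx intro!: sum.cong)
    also have "\<dots> = (\<Sum>(i, j)\<in>{(i, j). i + j \<le> d}. if P (i + j) then f d i * g d j else 0)"
      by (rule sum.triangle_reindex_eq[symmetric])
    also have "\<dots> = (\<Sum>z\<in>{(i, j). i + j \<le> d}. if P (fst z + snd z) then f d (fst z) * g d (snd z) else 0)"
      by (simp add: case_prod_unfold)
    also have "\<dots> = (\<Sum>z\<in>{z\<in>{(i, j). i + j \<le> d}. P (fst z + snd z)}. f d (fst z) * g d (snd z))"
    proof (rule sum.inter_filter[symmetric])
      have "{(i, j). i + j \<le> d} \<subseteq> {..d} \<times> {..d}" by auto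
      then show "finite {(i, j). i + j \<le> d}" by (rule finite_subset) auto
    qed
    also have "\<dots> = (\<Sum>(i, j)\<in>{(i, j). i + j \<le> d \<and> P (i + j)}. f d i * g d j)"
      by (intro sum.cong) auto
    finally show ?thesis .
  qed
  have fin: "finite {(i, j). i + j \<le> d \<and> P i j}" for d :: nat and P
  proof -
    have "{(i, j). i + j \<le> d \<and> P i j} \<subseteq> {..d} \<times> {..d}" by auto
    then show ?thesis by (rule finite_subset) auto
  qed
  let ?T = "\<lambda>d. \<Sum>k\<le>d. w d k * x ^ k"
  let ?B = "\<lambda>d. \<Sum>k | k \<le> d \<and> e * real d < \<bar>real k - (s + t) * real d\<bar>. w d k * x ^ k"
  \<comment> \<open>If the sum is off by more than \<open>e d\<close>, one of the summands is off by
    more than \<open>e d / 2\<close>; the union bound follows.\<close>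
  have B: "?B d \<le> bu (e/2) d * V d + U d * bv (e/2) d" for d
  proof -
    let ?P = "\<lambda>(i, j). f d i * g d j"
    let ?S1 = "{i. i \<le> d \<and> e / 2 * real d < \<bar>real i - s * real d\<bar>}"
    let ?S2 = "{i. i \<le> d \<and> e / 2 * real d < \<bar>real i - t * real d\<bar>}"
    have "?B d \<le> sum ?P (?S1 \<times> {..d} \<union> {..d} \<times> ?S2)"
      unfolding conv
    proof (rule sum_mono2)
      show "{(i, j). i + j \<le> d \<and> e * real d < \<bar>real (i + j) - (s + t) * real d\<bar>} \<subseteq> ?S1 \<times> {..d} \<union> {..d} \<times> ?S2"
      proof safe
        fix i j assume *: "i + j \<le> d" "e * real d < \<bar>real (i + j) - (s + t) * real d\<bar>"
          "\<not> e / 2 * real d < \<bar>real j - t * real d\<bar>"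
        have "real (i + j) - (s + t) * real d = (real i - s * real d) + (real j - t * real d)"
          by (simp add: algebra_simps)
        then have "e * real d < \<bar>real i - s * real d\<bar> + \<bar>real j - t * real d\<bar>"
          using *(2) abs_triangle_ineq[of "real i - s * real d" "real j - t * real d"] by linarith
        then show "e / 2 * real d < \<bar>real i - s * real d\<bar>" using *(3) by (simp add: field_simps)
      qed auto
      fix z assume "z \<in> (?S1 \<times> {..d} \<union> {..d} \<times> ?S2) - {(i, j). i + j \<le> d \<and> e * real d < \<bar>real (i + j) - (s + t) * real d\<bar>}"
      then have "fst z \<le> d" "snd z \<le> d" by auto
      from mult_pos_pos[OF fpos(1)[OF this(1)] fpos(2)[OF this(2)]]
      show "0 \<le> ?P z" by (simp add: case_prod_unfold)
    qed auto
    also have "\<dots> \<le> sum ?P (?S1 \<times> {..d}) + sum ?P ({..d} \<times> ?S2)"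
    proof -
      have "0 \<le> sum ?P ((?S1 \<times> {..d}) \<inter> ({..d} \<times> ?S2))"
      proof (rule sum_nonneg)
        fix z assume "z \<in> (?S1 \<times> {..d}) \<inter> ({..d} \<times> ?S2)"
        then have "fst z \<le> d" "snd z \<le> d" by auto
        from mult_pos_pos[OF fpos(1)[OF this(1)] fpos(2)[OF this(2)]]
        show "0 \<le> ?P z" by (simp add: case_prod_unfold)
      qed
      moreover have "sum ?P (?S1 \<times> {..d} \<union> {..d} \<times> ?S2) + sum ?P ((?S1 \<times> {..d}) \<inter> ({..d} \<times> ?S2))
        = sum ?P (?S1 \<times> {..d}) + sum ?P ({..d} \<times> ?S2)"
        by (rule sum.union_inter) auto
      ultimately show ?thesis by linarith
    qed
    also have "\<dots> = bu (e/2) d * V d + U d * bv (e/2) d"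
      unfolding bu_def bv_def U_def V_def sum_product by (simp add: sum.cartesian_product)
    finally show ?thesis .
  qed
  have T: "(U d - bu \<delta> d) * (V d - bv \<delta> d) \<le> ?T d" if "0 < d" for d
  proof -
    let ?S1 = "{i. i \<le> d \<and> \<bar>real i - s * real d\<bar> \<le> \<delta> * real d}"
    let ?S2 = "{i. i \<le> d \<and> \<bar>real i - t * real d\<bar> \<le> \<delta> * real d}"
    have 1: "U d - bu \<delta> d = sum (f d) ?S1" "V d - bv \<delta> d = sum (g d) ?S2"
      unfolding U_def V_def bu_def bv_def
      using sum_split_window[of "f d" d "s * real d" "\<delta> * real d"] sum_split_window[of "g d" d "t * real d" "\<delta> * real d"]
      by auto
    have "(U d - bu \<delta> d) * (V d - bv \<delta> d) = (\<Sum>(i, j)\<in>?S1 \<times> ?S2. f d i * g d j)"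
      unfolding 1 sum_product by (simp add: sum.cartesian_product)
    also have "\<dots> \<le> (\<Sum>(i, j)\<in>{(i, j). i + j \<le> d \<and> True}. f d i * g d j)"
    proof (rule sum_mono2)
      show "?S1 \<times> ?S2 \<subseteq> {(i, j). i + j \<le> d \<and> True}"
      proof safe
        fix i j assume "\<bar>real i - s * real d\<bar> \<le> \<delta> * real d" "\<bar>real j - t * real d\<bar> \<le> \<delta> * real d"
        then have "real i + real j \<le> s * real d + \<delta> * real d + (t * real d + \<delta> * real d)" by (simp add: abs_le_iff)
        also have "\<dots> = real d" by (simp add: \<delta>_def field_simps)
        finally show "i + j \<le> d" by linarith
      qed
      show "finite {(i, j). i + j \<le> d \<and> True}" by (rule fin)
      fix z assume "z \<in> {(i, j). i + j \<le> d \<and> True} - ?S1 \<times> ?S2"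
      then have "fst z \<le> d" "snd z \<le> d" by auto
      from mult_pos_pos[OF fpos(1)[OF this(1)] fpos(2)[OF this(2)]]
      show "0 \<le> (case z of (i, j) \<Rightarrow> f d i * g d j)" by (simp add: case_prod_unfold)
    qed
    also have "\<dots> = ?T d" using conv[of d "\<lambda>_. True"] by (simp add: atMost_def)
    finally show ?thesis .
  qed
  let ?h = "\<lambda>d. (bu (e/2) d / U d + bv (e/2) d / V d) / ((1 - bu \<delta> d / U d) * (1 - bv \<delta> d / V d))"
  have lim: "?h \<longlonglongrightarrow> 0"
  proof -
    have "?h \<longlonglongrightarrow> (0 + 0) / ((1 - 0) * (1 - 0))"
      using e \<delta> by (intro tendsto_intros lu lv) auto
    then show ?thesis by simp
  qed
  have "\<forall>\<^sub>F d in sequentially. bu \<delta> d / U d < 1" "\<forall>\<^sub>F d in sequentially. bv \<delta> d / V d < 1"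
    using \<delta> order_tendstoD(2)[OF lu] order_tendstoD(2)[OF lv] by auto
  moreover have "\<forall>\<^sub>F d in sequentially. 0 < (d::nat)" by (rule eventually_gt_at_top)
  ultimately have ub: "\<forall>\<^sub>F d in sequentially. ?B d / ?T d \<le> ?h d"
  proof eventually_elim
    case (elim d)
    have p: "0 < U d - bu \<delta> d" "0 < V d - bv \<delta> d" using elim UV[of d] by (auto simp: field_simps)
    have B0: "0 \<le> bu (e/2) d * V d + U d * bv (e/2) d"
      unfolding bu_def bv_def using UV[of d] fpos
      by (intro add_nonneg_nonneg mult_nonneg_nonneg sum_nonneg) (auto simp: less_imp_le)
    have "?B d / ?T d \<le> (bu (e/2) d * V d + U d * bv (e/2) d) / ((U d - bu \<delta> d) * (V d - bv \<delta> d))"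
      using B[of d] T[OF elim(3)] p B0 by (intro frac_le) auto
    also have "\<dots> = ((bu (e/2) d * V d + U d * bv (e/2) d) / (U d * V d)) / (((U d - bu \<delta> d) * (V d - bv \<delta> d)) / (U d * V d))"
      using UV[of d] by simp
    also have "\<dots> = ?h d"
      using UV[of d] by (simp add: add_divide_distrib diff_divide_distrib flip: times_divide_times_eq)
    finally show ?case .
  qed
  have nn: "\<forall>\<^sub>F d in sequentially. 0 \<le> ?B d / ?T d"
  proof (intro always_eventually allI divide_nonneg_nonneg sum_nonneg)
    fix d k :: nat assume "k \<in> {k. k \<le> d \<and> e * real d < \<bar>real k - (s + t) * real d\<bar>}"
    then have "k \<le> d" by simp
    then show "0 \<le> w d k * x ^ k"
      unfolding wx[OF \<open>k \<le> d\<close>] using fpos by (intro sum_nonneg mult_nonneg_nonneg) (auto intro!: less_imp_le)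
  next
    fix d k :: nat assume "k \<in> {..d}"
    then have "k \<le> d" by simp
    then show "0 \<le> w d k * x ^ k"
      unfolding wx[OF \<open>k \<le> d\<close>] using fpos by (intro sum_nonneg mult_nonneg_nonneg) (auto intro!: less_imp_le)
  qed
  show "(\<lambda>d. ?B d / ?T d) \<longlonglongrightarrow> 0"
    by (rule tendsto_sandwich[OF nn ub tendsto_const lim])
qed

section \<open>Transforms of measures on the half-line\<close>

text \<open>The two conditions pin \<open>f y\<close> between \<open>f x\<close> and
  \<open>f x * (y / x)\<close>, which merge as \<open>y\<close> tends to \<open>x\<close>. They hold
  for \<open>npsi\<close>, for \<open>ncau\<close> and for the continued R-transform
  \<open>tau\<close>.\<close>

lemma continuous_on_if_mono_and_quotient_antimono:
  fixes f :: "real \<Rightarrow> real"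
  assumes mono: "\<And>x y. 0 < x \<Longrightarrow> x \<le> y \<Longrightarrow> f x \<le> f y"
    and anti: "\<And>x y. 0 < x \<Longrightarrow> x \<le> y \<Longrightarrow> f y \<le> f x * (y / x)"
  shows "continuous_on {0<..} f"
proof (rule continuous_at_imp_continuous_on, rule ballI)
  fix x :: real assume "x \<in> {0<..}"
  then have x: "0 < x" by simp
  have lo: "\<forall>\<^sub>F y in at x. min (f x) (f x * (y / x)) \<le> f y"
    and hi: "\<forall>\<^sub>F y in at x. f y \<le> max (f x) (f x * (y / x))"
  proof -
    have pos: "\<forall>\<^sub>F y in at x. 0 < y"
      using x by (intro order_tendstoD[OF tendsto_ident_at])
    show "\<forall>\<^sub>F y in at x. min (f x) (f x * (y / x)) \<le> f y"
      using pos
    proof eventually_elim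
      case (elim y)
      show ?case
      proof (cases "x \<le> y")
        case False
        then have "f x \<le> f y * (x / y)" using elim by (intro anti) auto
        then have "f x * (y / x) \<le> f y * (x / y) * (y / x)"
          using elim x by (intro mult_right_mono) auto
        then show ?thesis using elim x by simp
      qed (intro min.coboundedI1 mono x)
    qed
    show "\<forall>\<^sub>F y in at x. f y \<le> max (f x) (f x * (y / x))"
      using pos
    proof eventually_elim
      case (elim y)
      show ?case using mono[of y x] anti[of x y] elim x by (cases "x \<le> y") auto
    qed
  qed
  have "((\<lambda>y. f x * (y / x)) \<longlongrightarrow> f x * (x / x)) (at x)"
    using x by (intro tendsto_intros) auto
  then have "((\<lambda>y. min (f x) (f x * (y / x))) \<longlongrightarrow> min (f x) (f x * (x / x))) (at x)"
    "((\<lambda>y. max (f x) (f x * (y / x))) \<longlongrightarrow> max (f x) (f x * (x / x))) (at x)"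
    by (intro tendsto_min tendsto_max tendsto_const; assumption)+
  then have "(f \<longlongrightarrow> f x) (at x)"
    using x by (intro tendsto_sandwich[OF lo hi]) auto
  then show "isCont f x" by (simp add: isCont_def)
qed

lemma filterlim_times_Suc_at_top: "filterlim (\<lambda>n. real (Suc n)) at_top sequentially"
  using filterlim_real_sequentially filterlim_sequentially_Suc by blast

lemma one_plus_mult_pos: "0 \<le> u \<Longrightarrow> 0 < x \<Longrightarrow> 0 < 1 + u * (x::real)"
  by (intro add_pos_nonneg mult_nonneg_nonneg) auto

lemma mult_div_one_plus_bounds:
  fixes u x :: real
  assumes "0 \<le> u" "0 < x"
  shows "0 \<le> u * x / (1 + u * x)" "u * x / (1 + u * x) \<le> 1" "\<bar>u * x / (1 + u * x)\<bar> \<le> 1"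
    "0 \<le> 1 / (1 + u * x)" "1 / (1 + u * x) \<le> 1" "\<bar>1 / (1 + u * x)\<bar> \<le> 1"
    "0 < x / (1 + u * x)" "x / (1 + u * x) \<le> x"
proof -
  have p: "0 < 1 + u * x" "0 \<le> u * x" using assms by (auto intro: one_plus_mult_pos)
  then show a: "0 \<le> u * x / (1 + u * x)" "u * x / (1 + u * x) \<le> 1"
    "0 \<le> 1 / (1 + u * x)" "1 / (1 + u * x) \<le> 1" by (simp_all add: pos_divide_le_eq)
  then show "\<bar>u * x / (1 + u * x)\<bar> \<le> 1" "\<bar>1 / (1 + u * x)\<bar> \<le> 1" by (simp_all only: abs_of_nonneg)
  show "0 < x / (1 + u * x)" by (rule divide_pos_pos[OF assms(2) p(1)])
  show "x / (1 + u * x) \<le> x" using a(4) assms mult_left_mono[OF a(4), of x] by simp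
qed

lemma div_one_plus_mult_strict_mono:
  fixes u x y :: real
  assumes "0 \<le> u" "0 < x" "x < y"
  shows "x / (1 + u * x) < y / (1 + u * y)"
proof -
  have "0 < 1 + u * x" "0 < 1 + u * y" using assms by (auto intro: one_plus_mult_pos)
  then show ?thesis using assms by (simp add: divide_less_eq less_divide_eq mult_ac algebra_simps)
qed

section \<open>Laws on the half-line and their transforms\<close>

locale Rplus_distribution = real_distribution M for M +
  assumes negligible_neg: "emeasure M {..<0} = 0"

lemma prob_Rplus_iff: "M \<in> prob_Rplus \<longleftrightarrow> Rplus_distribution M"
  by (simp add: prob_Rplus_def Rplus_distribution_def Rplus_distribution_axioms_def)

lemma Rplus_distribution_return: "0 \<le> a \<Longrightarrow> Rplus_distribution (return borel (a::real))"
  unfolding Rplus_distribution_def Rplus_distribution_axioms_def real_distribution_def real_distribution_axioms_def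
  by (auto intro: prob_space_return simp: indicator_def)

text \<open>With \<open>x > 0\<close>: \<open>npsi M x = -\<psi>(-x)\<close> and \<open>ncau M x = -G(-1/x)\<close>.\<close>

definition npsi :: "real measure \<Rightarrow> real \<Rightarrow> real" where
  "npsi M x = (\<integral>u. u * x / (1 + u * x) \<partial>M)"

definition ncau :: "real measure \<Rightarrow> real \<Rightarrow> real" where
  "ncau M x = (\<integral>u. x / (1 + u * x) \<partial>M)"

lemma npsi_return_0: "npsi (return borel 0) x = 0"
  by (simp add: npsi_def integral_return)

lemma ncau_return_0: "ncau (return borel 0) x = x"
  by (simp add: ncau_def integral_return)

context Rplus_distribution
begin

lemma emeasure_UNIV_1 [simp]: "emeasure M UNIV = 1"
  using emeasure_space_1 by simp

lemma AE_nonneg: "AE u in M. 0 \<le> u"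
  by (rule AE_I[of _ _ "{..<0}"]) (auto simp: negligible_neg)

lemma integrable_npsi: "0 < x \<Longrightarrow> integrable M (\<lambda>u. u * x / (1 + u * x))"
  by (rule integrable_const_bound[of _ 1])
     (use AE_nonneg mult_div_one_plus_bounds in \<open>auto elim!: eventually_mono\<close>)

lemma integrable_inverse_linear: "0 < x \<Longrightarrow> integrable M (\<lambda>u. 1 / (1 + u * x))"
  by (rule integrable_const_bound[of _ 1])
     (use AE_nonneg mult_div_one_plus_bounds in \<open>auto elim!: eventually_mono\<close>)

lemma integrable_ncau: "0 < x \<Longrightarrow> integrable M (\<lambda>u. x / (1 + u * x))"
  using integrable_mult_right[OF integrable_inverse_linear, of x x] by simp

lemma npsi_eq: assumes x: "0 < x" shows "npsi M x = 1 - ncau M x / x"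
proof -
  have "npsi M x = (\<integral>u. 1 - (x / (1 + u * x)) / x \<partial>M)"
    unfolding npsi_def
  proof (rule integral_cong_AE)
    show "AE u in M. u * x / (1 + u * x) = 1 - (x / (1 + u * x)) / x"
      using AE_nonneg
    proof eventually_elim
      case (elim u)
      then have "0 < 1 + u * x" using x by (rule one_plus_mult_pos)
      moreover have "x / (1 + u * x) / x = 1 / (1 + u * x)" using x by simp
      ultimately show ?case by (simp add: field_simps)
    qed
  qed auto
  also have "\<dots> = 1 - ncau M x / x"
  proof -
    define c where "c u = x / (1 + u * x)" for u
    have "integrable M c" unfolding c_def by (rule integrable_ncau[OF x])
    then have "(\<integral>u. 1 - c u / x \<partial>M) = (\<integral>u. 1 \<partial>M) - (\<integral>u. c u / x \<partial>M)"
      by (intro Bochner_Integration.integral_diff) auto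
    also have "\<dots> = 1 - (\<integral>u. c u \<partial>M) / x"
      using prob_space by simp
    finally show ?thesis unfolding c_def ncau_def .
  qed
  finally show ?thesis .
qed

lemma ncau_eq: "0 < x \<Longrightarrow> ncau M x = x * (1 - npsi M x)"
  by (simp add: npsi_eq)

lemma ncau_pos: assumes x: "0 < x" shows "0 < ncau M x"
proof -
  have "(\<integral>u. 0 \<partial>M) < (\<integral>u. x / (1 + u * x) \<partial>M)"
    using x AE_nonneg integrable_ncau[OF x]
    by (intro integral_less_AE_space) (auto elim!: eventually_mono simp: one_plus_mult_pos)
  then show ?thesis by (simp add: ncau_def)
qed

lemma ncau_le: assumes x: "0 < x" shows "ncau M x \<le> x"
proof -
  have "(\<integral>u. x / (1 + u * x) \<partial>M) \<le> (\<integral>u. x \<partial>M)"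
    using x AE_nonneg integrable_ncau[OF x]
    by (intro integral_mono_AE) (auto elim!: eventually_mono simp: divide_le_eq add_pos_nonneg)
  then show ?thesis using prob_space by (simp add: ncau_def)
qed

lemma npsi_nonneg: "0 < x \<Longrightarrow> 0 \<le> npsi M x"
  using ncau_le[of x] by (simp add: npsi_eq)

lemma npsi_less_1: "0 < x \<Longrightarrow> npsi M x < 1"
  using ncau_pos[of x] by (simp add: npsi_eq)

lemma ncau_strict_mono: assumes "0 < x" "x < y" shows "ncau M x < ncau M y"
  unfolding ncau_def
proof (rule integral_less_AE_space)
  show "AE u in M. x / (1 + u * x) < y / (1 + u * y)"
    using AE_nonneg by eventually_elim (use assms in \<open>auto intro: div_one_plus_mult_strict_mono\<close>)
qed (use assms integrable_ncau in \<open>auto\<close>)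

lemma ncau_mono: "0 < x \<Longrightarrow> x \<le> y \<Longrightarrow> ncau M x \<le> ncau M y"
  using ncau_strict_mono[of x y] by (cases "x = y") auto

lemma ncau_less_iff: "0 < x \<Longrightarrow> 0 < y \<Longrightarrow> ncau M x < ncau M y \<longleftrightarrow> x < y"
  using ncau_strict_mono[of x y] ncau_mono[of y x] by (cases "x < y") auto

lemma ncau_le_iff: "0 < x \<Longrightarrow> 0 < y \<Longrightarrow> ncau M x \<le> ncau M y \<longleftrightarrow> x \<le> y"
  using ncau_less_iff[of y x] by (simp flip: not_less)

lemma npsi_mono: assumes "0 < x" "x \<le> y" shows "npsi M x \<le> npsi M y"
  unfolding npsi_def
proof (rule integral_mono_AE)
  show "AE u in M. u * x / (1 + u * x) \<le> u * y / (1 + u * y)"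
    using AE_nonneg
  proof eventually_elim
    case (elim u)
    then have p: "0 < 1 + u * x" "0 < 1 + u * y" using assms by (auto intro: one_plus_mult_pos)
    have "u * x \<le> u * y" using elim assms by (intro mult_left_mono) auto
    then show ?case using p by (simp add: divide_le_eq le_divide_eq mult_ac algebra_simps)
  qed
qed (use assms integrable_npsi in auto)

lemma ncau_div_antimono:
  assumes "0 < x" "x \<le> y" shows "ncau M y \<le> ncau M x * (y / x)"
proof -
  have "npsi M x \<le> npsi M y" by (rule npsi_mono[OF assms])
  then show ?thesis using assms by (simp add: npsi_eq divide_le_eq field_simps)
qed

lemma npsi_div_antimono:
  assumes "0 < x" "x \<le> y" shows "npsi M y \<le> npsi M x * (y / x)"
proof -
  have "npsi M y \<le> (\<integral>u. u * x / (1 + u * x) * (y / x) \<partial>M)"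
    unfolding npsi_def
  proof (rule integral_mono_AE)
    show "AE u in M. u * y / (1 + u * y) \<le> u * x / (1 + u * x) * (y / x)"
      using AE_nonneg
    proof eventually_elim
      case (elim u)
      have "0 < 1 + u * x" "0 < 1 + u * y" using elim assms by (auto intro: one_plus_mult_pos)
      then have "u * y / (1 + u * y) \<le> u * y / (1 + u * x)"
        using elim assms by (intro divide_left_mono add_left_mono mult_left_mono) auto
      then show ?case using assms by simp
    qed
    show "integrable M (\<lambda>u. u * x / (1 + u * x) * (y / x))"
      using assms integrable_npsi[of x] by (intro integrable_mult_left) auto
  qed (use assms integrable_npsi in auto)
  also have "\<dots> = npsi M x * (y / x)"
    unfolding npsi_def by (rule integral_mult_left_zero)
  finally show ?thesis .
qed

lemma continuous_npsi: "continuous_on {0<..} (npsi M)"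
  by (rule continuous_on_if_mono_and_quotient_antimono[OF npsi_mono npsi_div_antimono])

lemma continuous_ncau: "continuous_on {0<..} (ncau M)"
  by (rule continuous_on_if_mono_and_quotient_antimono[OF ncau_mono ncau_div_antimono])

lemma AE_zero_imp_eq_return:
  assumes "AE u in M. u = 0" shows "M = return borel 0"
proof (rule measure_eqI)
  fix A assume A: "A \<in> sets M"
  show "emeasure M A = emeasure (return borel 0) A"
  proof (cases "0 \<in> A")
    case True
    then have "emeasure M A = emeasure M (space M)"
      using A assms by (intro emeasure_eq_AE) (auto elim!: eventually_mono)
    then show ?thesis using True A by simp
  next
    case False
    then have "emeasure M A = emeasure M {}"
      using A assms by (intro emeasure_eq_AE) (auto elim!: eventually_mono)
    then show ?thesis using False A by simp
  qed
qed simp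

lemma npsi_pos:
  assumes "M \<noteq> return borel 0" "0 < x" shows "0 < npsi M x"
proof (rule ccontr)
  assume "\<not> 0 < npsi M x"
  then have "npsi M x = 0" using npsi_nonneg[OF assms(2)] by simp
  then have "AE u in M. u * x / (1 + u * x) = 0"
    using integrable_npsi[OF assms(2)] AE_nonneg assms(2) unfolding npsi_def
    by (subst (asm) integral_nonneg_eq_0_iff_AE) (auto elim!: eventually_mono)
  with AE_nonneg have "AE u in M. u = 0"
  proof eventually_elim
    case (elim u)
    then show ?case using assms(2) one_plus_mult_pos[of u x] by auto
  qed
  with AE_zero_imp_eq_return assms show False by simp
qed

lemma npsi_strict_mono:
  assumes "M \<noteq> return borel 0" "0 < x" "x < y" shows "npsi M x < npsi M y"
proof (rule ccontr)
  assume "\<not> npsi M x < npsi M y"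
  then have eq: "npsi M y = npsi M x" using npsi_mono[of x y] assms by simp
  have "(\<integral>u. u * y / (1 + u * y) - u * x / (1 + u * x) \<partial>M) = 0"
    using eq assms integrable_npsi unfolding npsi_def by (subst Bochner_Integration.integral_diff) auto
  moreover have nn: "AE u in M. 0 \<le> u * y / (1 + u * y) - u * x / (1 + u * x) \<and>
     (u * y / (1 + u * y) - u * x / (1 + u * x) = 0 \<longrightarrow> u = 0)"
    using AE_nonneg
  proof eventually_elim
    case (elim u)
    then have p: "0 < 1 + u * x" "0 < 1 + u * y" using assms by (auto intro: one_plus_mult_pos)
    then have "u * y / (1 + u * y) - u * x / (1 + u * x) = u * (y - x) / ((1 + u * x) * (1 + u * y))"
      by (simp add: field_simps)
    then show ?case using p elim assms by (auto intro!: divide_nonneg_pos)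
  qed
  ultimately have "AE u in M. u * y / (1 + u * y) - u * x / (1 + u * x) = 0"
    using integrable_npsi[of x] integrable_npsi[of y] assms
    by (subst (asm) integral_nonneg_eq_0_iff_AE) (auto elim!: eventually_mono)
  with nn have "AE u in M. u = 0" by eventually_elim auto
  with AE_zero_imp_eq_return assms show False by simp
qed

lemma npsi_less_iff: "M \<noteq> return borel 0 \<Longrightarrow> 0 < x \<Longrightarrow> 0 < y \<Longrightarrow> npsi M x < npsi M y \<longleftrightarrow> x < y"
  using npsi_strict_mono[of x y] npsi_mono[of y x] by (cases "x < y") auto

lemma npsi_tendsto_0: "(\<lambda>n. npsi M (1 / real (Suc n))) \<longlonglongrightarrow> 0"
proof -
  have "(\<lambda>n. \<integral>u. u * (1 / real (Suc n)) / (1 + u * (1 / real (Suc n))) \<partial>M) \<longlonglongrightarrow> (\<integral>u. 0 \<partial>M)"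
  proof (rule integral_dominated_convergence[where w = "\<lambda>_. 1"])
    show "AE u in M. (\<lambda>n. u * (1 / real (Suc n)) / (1 + u * (1 / real (Suc n)))) \<longlonglongrightarrow> 0"
    proof (rule AE_I2)
      fix u
      have "(\<lambda>n. u * (1 / real (Suc n)) / (1 + u * (1 / real (Suc n)))) \<longlonglongrightarrow> u * 0 / (1 + u * 0)"
        using LIMSEQ_Suc[OF lim_1_over_n] by (intro tendsto_intros) auto
      then show "(\<lambda>n. u * (1 / real (Suc n)) / (1 + u * (1 / real (Suc n)))) \<longlonglongrightarrow> 0" by simp
    qed
    show "AE u in M. norm (u * (1 / real (Suc n)) / (1 + u * (1 / real (Suc n)))) \<le> 1" for n
      using AE_nonneg
      by eventually_elim (simp only: real_norm_def, rule mult_div_one_plus_bounds, auto)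
  qed auto
  then show ?thesis by (simp add: npsi_def del: of_nat_Suc)
qed

lemma npsi_tendsto_top: "(\<lambda>n. npsi M (real (Suc n))) \<longlonglongrightarrow> 1 - measure M {0}"
proof -
  have "(\<lambda>n. \<integral>u. u * real (Suc n) / (1 + u * real (Suc n)) \<partial>M) \<longlonglongrightarrow> (\<integral>u. indicator (- {0}) u \<partial>M)"
  proof (rule integral_dominated_convergence[where w = "\<lambda>_. 1"])
    show "AE u in M. (\<lambda>n. u * real (Suc n) / (1 + u * real (Suc n))) \<longlonglongrightarrow> indicator (- {0}) u"
      using AE_nonneg
    proof eventually_elim
      case (elim u)
      show ?case
      proof (cases "u = 0")
        case False
        with elim have u: "0 < u" by simp
        have e: "u * real (Suc n) / (1 + u * real (Suc n)) = u / (1 / real (Suc n) + u)" for n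
          by (simp add: field_simps del: of_nat_Suc)
        have "(\<lambda>n. u / (1 / real (Suc n) + u)) \<longlonglongrightarrow> u / (0 + u)"
          using LIMSEQ_Suc[OF lim_1_over_n] u by (intro tendsto_intros) auto
        then show ?thesis unfolding e using u by simp
      qed simp
    qed
    show "AE u in M. norm (u * real (Suc n) / (1 + u * real (Suc n))) \<le> 1" for n
      using AE_nonneg
      by eventually_elim (simp only: real_norm_def, rule mult_div_one_plus_bounds, auto)
  qed auto
  moreover have "(\<integral>u. indicator (- {0}) u \<partial>M) = 1 - measure M {0}"
    using prob_compl[of "{0}"] by (simp add: Compl_eq_Diff_UNIV)
  ultimately show ?thesis by (simp add: npsi_def del: of_nat_Suc)
qed

lemma npsi_le: assumes "0 < x" shows "npsi M x \<le> 1 - measure M {0}"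
proof -
  obtain N where "x \<le> real N" using real_arch_simple by blast
  then have "npsi M x \<le> npsi M (real (Suc n))" if "N \<le> n" for n
    using that assms by (intro npsi_mono) auto
  then show ?thesis
    by (intro LIMSEQ_le_const[OF npsi_tendsto_top]) auto
qed

lemma npsi_less: "M \<noteq> return borel 0 \<Longrightarrow> 0 < x \<Longrightarrow> npsi M x < 1 - measure M {0}"
  using npsi_strict_mono[of x "x + 1"] npsi_le[of "x + 1"] by simp

lemma ex_npsi_less: "0 < e \<Longrightarrow> \<exists>x>0. npsi M x < e"
  using order_tendstoD(2)[OF npsi_tendsto_0, of e] eventually_happens'[OF sequentially_bot]
  by (metis (no_types, lifting) of_nat_0_less_iff zero_less_Suc zero_less_divide_1_iff)

lemma ex_npsi_greater: "c < 1 - measure M {0} \<Longrightarrow> \<exists>x>0. c < npsi M x"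
  using order_tendstoD(1)[OF npsi_tendsto_top, of c] eventually_happens'[OF sequentially_bot]
  by (metis (no_types, lifting) of_nat_0_less_iff zero_less_Suc)

lemma mass_zero_less_1: "M \<noteq> return borel 0 \<Longrightarrow> measure M {0} < 1"
  using npsi_less[of 1] npsi_nonneg[of 1] by simp

lemma ex_npsi_eq: assumes "0 < t" "t < 1 - measure M {0}" shows "\<exists>x>0. npsi M x = t"
proof -
  obtain a b where ab: "0 < a" "npsi M a < t" "0 < b" "t < npsi M b"
    using ex_npsi_less ex_npsi_greater assms by blast
  have "a \<le> b" using ab npsi_mono[of b a] by linarith
  have "continuous_on {a..b} (npsi M)"
    using ab by (intro continuous_on_subset[OF continuous_npsi]) auto
  from IVT'[of "npsi M" a t b, OF less_imp_le[OF ab(2)] less_imp_le[OF ab(4)] \<open>a \<le> b\<close> this]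
  obtain x where "a \<le> x" "npsi M x = t" by blast
  with ab show ?thesis by (intro exI[of _ x]) auto
qed

text \<open>\<open>ncau M x\<close> is the integral of \<open>1 / (1 / x + u)\<close>, which
  increases to \<open>1 / u\<close> as \<open>x\<close> grows. By monotone convergence
  \<open>kappa\<close> is the upper end of the range of \<open>ncau\<close>.\<close>

lemma kappa_eq_SUP: "kappa M = (SUP n. ennreal (ncau M (real (Suc n))))"
proof -
  \<comment> \<open>The maximum with 0 makes the sequence increasing at every point, not just almost
    everywhere. For \<open>u \<le> 0\<close> it tends to infinity, which is also the value of
    \<open>inverse (ennreal u)\<close>.\<close>
  define f where "f n u = ennreal (real (Suc n) / (1 + max 0 u * real (Suc n)))" for n :: nat and u :: real
  have [measurable]: "f n \<in> borel_measurable borel" for n unfolding f_def by measurable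
  have f: "(\<integral>\<^sup>+u. f n u \<partial>M) = ennreal (ncau M (real (Suc n)))" for n
  proof -
    have "(\<integral>\<^sup>+u. f n u \<partial>M) = (\<integral>\<^sup>+u. ennreal (real (Suc n) / (1 + u * real (Suc n))) \<partial>M)"
      by (rule nn_integral_cong_AE) (use AE_nonneg in \<open>auto elim!: eventually_mono simp: f_def\<close>)
    also have "\<dots> = ennreal (ncau M (real (Suc n)))"
      unfolding ncau_def using AE_nonneg integrable_ncau[of "real (Suc n)"]
      by (intro nn_integral_eq_integral) (auto elim!: eventually_mono simp del: of_nat_Suc)
    finally show ?thesis .
  qed
  have mono: "incseq f"
  proof (rule incseq_SucI, rule le_funI)
    fix n u
    have "real (Suc n) / (1 + max 0 u * real (Suc n)) \<le> real (Suc (Suc n)) / (1 + max 0 u * real (Suc (Suc n)))"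
      by (rule less_imp_le, rule div_one_plus_mult_strict_mono) auto
    then show "f n u \<le> f (Suc n) u" unfolding f_def by (rule ennreal_leI)
  qed
  have lim: "(\<lambda>n. f n u) \<longlonglongrightarrow> inverse (ennreal u)" for u
  proof (cases "0 < u")
    case True
    have e: "real (Suc n) / (1 + max 0 u * real (Suc n)) = 1 / (1 / real (Suc n) + u)" for n
      using True by (simp add: field_simps max_def del: of_nat_Suc)
    have "(\<lambda>n. 1 / (1 / real (Suc n) + u)) \<longlonglongrightarrow> 1 / (0 + u)"
      using LIMSEQ_Suc[OF lim_1_over_n] True by (intro tendsto_intros) auto
    then have "(\<lambda>n. ennreal (1 / (1 / real (Suc n) + u))) \<longlonglongrightarrow> ennreal (1 / (0 + u))"
      by (rule tendsto_ennrealI)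
    then show ?thesis unfolding f_def e using True by (simp add: inverse_ennreal divide_inverse)
  next
    case False
    then have "f n u = ennreal (real (Suc n))" for n by (simp add: f_def max_def)
    moreover have "(\<lambda>n. ennreal (real (Suc n))) \<longlonglongrightarrow> \<infinity>"
      using ennreal_tendsto_top_eq_at_top[of "\<lambda>n. real (Suc n)" sequentially] filterlim_times_Suc_at_top
      by (simp add: infinity_ennreal_def)
    ultimately show ?thesis using False by (simp add: ennreal_neg)
  qed
  have "(SUP n. f n u) = inverse (ennreal u)" for u
    using LIMSEQ_unique[OF lim LIMSEQ_SUP[of "\<lambda>n. f n u"]] mono by (auto simp: incseq_def le_fun_def)
  then have "kappa M = (\<integral>\<^sup>+u. (SUP n. f n u) \<partial>M)" by (simp add: kappa_def)
  also have "\<dots> = (SUP n. \<integral>\<^sup>+u. f n u \<partial>M)"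
    using mono by (intro nn_integral_monotone_convergence_SUP) auto
  finally show ?thesis unfolding f .
qed

lemma ncau_less_kappa: assumes x: "0 < x" shows "ennreal (ncau M x) < kappa M"
proof -
  obtain N where N: "x < real N" using reals_Archimedean2 by blast
  have "ennreal (ncau M x) < ennreal (ncau M (real (Suc N)))"
    using N x ncau_strict_mono[of x "real (Suc N)"] ncau_pos[of x] ncau_pos[of "real (Suc N)"] by (simp add: ennreal_less_iff)
  also have "\<dots> \<le> kappa M" unfolding kappa_eq_SUP by (rule SUP_upper) simp
  finally show ?thesis .
qed

lemma ex_ncau_greater: assumes "ennreal c < kappa M" "0 \<le> c" shows "\<exists>x>0. c < ncau M x"
proof -
  obtain n where "ennreal c < ennreal (ncau M (real (Suc n)))"
    using assms(1) unfolding kappa_eq_SUP less_SUP_iff by auto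
  then show ?thesis using assms(2) by (intro exI[of _ "real (Suc n)"]) (auto simp: ennreal_less_iff)
qed

lemma ex_ncau_eq: assumes "0 < c" "ennreal c < kappa M" shows "\<exists>x>0. ncau M x = c"
proof -
  obtain b where b: "0 < b" "c < ncau M b" using ex_ncau_greater assms by force
  define a where "a = min b c"
  have a: "0 < a" "a \<le> b" "ncau M a \<le> c" using b assms ncau_le[of a] by (auto simp: a_def)
  have "continuous_on {a..b} (ncau M)"
    using a by (intro continuous_on_subset[OF continuous_ncau]) auto
  from IVT'[of "ncau M" a c b, OF a(3) less_imp_le[OF b(2)] \<open>a \<le> b\<close> this]
  obtain x where "a \<le> x" "ncau M x = c" by blast
  with a show ?thesis by (intro exI[of _ x]) auto
qed

lemma G_transform_eq: assumes "0 < x" shows "G_transform M (- 1 / x) = - ncau M x"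
proof -
  have "1 / (- 1 / x - u) = - (x / (1 + u * x))" for u
  proof -
    have "- 1 / x - u = - ((1 + u * x) / x)" using assms by (simp add: field_simps)
    then show ?thesis by simp
  qed
  then show ?thesis by (simp add: G_transform_def ncau_def)
qed

lemma inj_G_transform: "inj_on (G_transform M) {..<0}"
proof (rule inj_onI)
  fix s t :: real assume st: "s \<in> {..<0}" "t \<in> {..<0}" "G_transform M s = G_transform M t"
  have *: "G_transform M r = - ncau M (- 1 / r)" if "r < 0" for r
    using G_transform_eq[of "- 1 / r"] that by (simp add: divide_neg_neg)
  have "ncau M (- 1 / s) = ncau M (- 1 / t)" using st * by simp
  moreover have "0 < - 1 / s" "0 < - 1 / t" using st by (auto simp: divide_neg_neg)
  ultimately have "- 1 / s = - 1 / t" using ncau_less_iff by (metis less_irrefl linorder_neqE)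
  then show "s = t" using st by (simp add: field_simps)
qed

lemma R_transform_eq: assumes "0 < x" shows "R_transform M (- ncau M x) = - npsi M x"
proof -
  have "the_inv_into {..<0} (G_transform M) (- ncau M x) = - 1 / x"
    unfolding G_transform_eq[OF assms, symmetric]
    using assms by (intro the_inv_into_f_f inj_G_transform) auto
  then show ?thesis using assms by (simp add: R_transform_def npsi_eq)
qed

lemma psi_transform_eq: "psi_transform M (- x) = - npsi M x"
proof -
  have "- x * u / (1 - - x * u) = - (u * x / (1 + u * x))" for u by (simp add: mult.commute)
  then show ?thesis by (simp add: psi_transform_def npsi_def)
qed

lemma S_transform_eq:
  assumes "M \<noteq> return borel 0" "0 < x" shows "S_transform M (- npsi M x) = ncau M x / npsi M x"
proof -
  have "inj_on (psi_transform M) {..<0}"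
  proof (rule inj_onI)
    fix s t :: real assume st: "s \<in> {..<0}" "t \<in> {..<0}" "psi_transform M s = psi_transform M t"
    then have "npsi M (- s) = npsi M (- t)" using psi_transform_eq[of "- s"] psi_transform_eq[of "- t"] by simp
    with st npsi_less_iff[OF assms(1), of "- s" "- t"] npsi_less_iff[OF assms(1), of "- t" "- s"] show "s = t"
      by (metis add.inverse_inverse less_irrefl lessThan_iff linorder_neqE neg_0_less_iff_less)
  qed
  then have "the_inv_into {..<0} (psi_transform M) (- npsi M x) = - x"
    unfolding psi_transform_eq[symmetric] using assms by (intro the_inv_into_f_f) auto
  then show ?thesis using assms by (simp add: S_transform_def ncau_eq)
qed

end

section \<open>The transform near 0 determines the measure\<close>

lemma (in real_distribution) char_moment_approx:
  assumes [measurable]: "f \<in> borel_measurable borel" and b: "AE u in M. \<bar>f u\<bar> \<le> B"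
  shows "cmod (char (distr M borel f) t - (\<Sum>k\<le>n. ((\<i> * t) ^ k / fact k) * complex_of_real (\<integral>u. f u ^ k \<partial>M)))
    \<le> 2 * ((\<bar>t\<bar> * B) ^ n / fact n)"
proof -
  have int: "integrable M (\<lambda>u. f u ^ n)" for n
    using b by (intro integrable_const_bound[of _ "B ^ n"])
      (auto elim!: eventually_mono simp: power_abs power_mono)
  have "expectation (\<lambda>u. \<bar>f u\<bar> ^ n) \<le> expectation (\<lambda>u. B ^ n)"
    using b integrable_abs[OF int[of n]]
    by (intro integral_mono_AE) (auto elim!: eventually_mono simp: power_abs power_mono)
  then have B: "expectation (\<lambda>u. \<bar>f u\<bar> ^ n) \<le> B ^ n" using prob_space by simp
  have "cmod (char (distr M borel f) t - (\<Sum>k\<le>n. ((\<i> * t) ^ k / fact k) * complex_of_real (\<integral>u. f u ^ k \<partial>M)))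
      \<le> 2 * \<bar>t\<bar> ^ n / fact n * expectation (\<lambda>u. \<bar>f u\<bar> ^ n)"
    by (rule char_approx1'[OF int _ refl]) simp
  also have "\<dots> \<le> 2 * \<bar>t\<bar> ^ n / fact n * B ^ n" by (intro mult_left_mono B) auto
  finally show ?thesis by (simp add: power_mult_distrib)
qed

text \<open>Equal moments give both characteristic functions the same Taylor polynomials, and
  boundedness makes the remainders tend to 0 for every \<open>t\<close>, since exponential series
  converge everywhere.\<close>

lemma moments_determine_bounded:
  fixes M N :: "real measure" and f :: "real \<Rightarrow> real"
  assumes M: "real_distribution M" and N: "real_distribution N"
    and f [measurable]: "f \<in> borel_measurable borel"
    and b: "AE u in M. \<bar>f u\<bar> \<le> B" "AE u in N. \<bar>f u\<bar> \<le> B"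
    and mom: "\<And>n. (\<integral>u. f u ^ n \<partial>M) = (\<integral>u. f u ^ n \<partial>N)"
  shows "distr M borel f = distr N borel f"
proof -
  interpret M: real_distribution M by fact
  interpret N: real_distribution N by fact
  interpret DM: real_distribution "distr M borel f" by (rule M.real_distribution_distr) simp
  interpret DN: real_distribution "distr N borel f" by (rule N.real_distribution_distr) simp
  have "char (distr M borel f) t = char (distr N borel f) t" for t
  proof -
    let ?P = "\<lambda>n. \<Sum>k\<le>n. ((\<i> * t) ^ k / fact k) * complex_of_real (\<integral>u. f u ^ k \<partial>M)"
    have "cmod (char (distr M borel f) t - char (distr N borel f) t) \<le> 4 * ((\<bar>t\<bar> * B) ^ n / fact n)" for n
    proof -
      have "cmod (char (distr M borel f) t - char (distr N borel f) t)
          \<le> cmod (char (distr M borel f) t - ?P n) + cmod (char (distr N borel f) t - ?P n)"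
        using norm_triangle_ineq4[of "char (distr M borel f) t - ?P n" "char (distr N borel f) t - ?P n"]
        by (simp only: diff_diff_eq2 diff_add_cancel)
      also have "\<dots> \<le> 2 * ((\<bar>t\<bar> * B) ^ n / fact n) + 2 * ((\<bar>t\<bar> * B) ^ n / fact n)"
        using M.char_moment_approx[OF f b(1), of t n] N.char_moment_approx[OF f b(2), of t n]
        unfolding mom by (rule add_mono)
      finally show ?thesis by simp
    qed
    moreover have "(\<lambda>n. 4 * ((\<bar>t\<bar> * B) ^ n / fact n)) \<longlonglongrightarrow> 4 * 0"
      proof (intro tendsto_mult tendsto_const)
      show "(\<lambda>n. (\<bar>t\<bar> * B) ^ n / fact n) \<longlonglongrightarrow> 0"
        using summable_LIMSEQ_zero[OF summable_exp[of "\<bar>t\<bar> * B"]] by (simp add: divide_inverse mult.commute)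
    qed
    ultimately have "cmod (char (distr M borel f) t - char (distr N borel f) t) \<le> 4 * 0"
      by (intro LIMSEQ_le_const) auto
    then show ?thesis by simp
  qed
  then have "char (distr M borel f) = char (distr N borel f)" by (rule ext)
  then show ?thesis
    by (intro Levy_uniqueness DM.real_distribution_axioms DN.real_distribution_axioms)
qed

text \<open>Letting \<open>z\<close> tend to \<open>0\<close> in \<open>v\<^sup>n / (1 + z v)\<close>, where \<open>v = 1 / (s + u)\<close>, recovers all the moments of \<open>v\<close>.\<close>

theorem npsi_unique:
  assumes "Rplus_distribution M" "Rplus_distribution N" and x0: "0 < x0"
    and eq: "\<And>x. 0 < x \<Longrightarrow> x < x0 \<Longrightarrow> npsi M x = npsi N x"
  shows "M = N"
proof -
  interpret M: Rplus_distribution M by fact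
  interpret N: Rplus_distribution N by fact
  \<comment> \<open>For \<open>z > 0\<close> the points \<open>1 / (s + z)\<close> run through the
    interval from 0 to \<open>x0\<close>, and at such a point the integrand of \<open>ncau\<close>
    is \<open>1 / (s + z + u) = v u / (1 + z * v u)\<close>. The shift by \<open>s\<close> also
    makes \<open>v\<close> bounded.\<close>
  define s where "s = 1 / x0"
  have s: "0 < s" using x0 by (simp add: s_def)
  define v where "v u = 1 / (s + max 0 u)" for u :: real
  have v: "0 < v u" "v u \<le> 1 / s" for u
    using s by (auto simp: v_def intro!: divide_left_mono mult_pos_pos add_pos_nonneg)
  have [measurable]: "v \<in> borel_measurable borel" unfolding v_def by measurable
  have vb: "\<bar>v u\<bar> \<le> 1 / s" for u using v[of u] by simp
  have int: "integrable L (\<lambda>u. v u ^ n / (1 + z * v u))" if "Rplus_distribution L" "0 \<le> z" for L n z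
  proof -
    interpret L: Rplus_distribution L by fact
    have [measurable_cong]: "sets L = sets borel" by simp
    show ?thesis
    proof (rule L.integrable_const_bound[of _ "(1 / s) ^ n"])
      show "AE u in L. norm (v u ^ n / (1 + z * v u)) \<le> (1 / s) ^ n"
      proof (rule AE_I2)
        fix u
        have "v u ^ n / (1 + z * v u) \<le> v u ^ n / 1"
          using v[of u] that by (intro divide_left_mono) (auto simp: add_pos_nonneg)
        also have "\<dots> \<le> (1 / s) ^ n" using v[of u] by (simp add: power_mono)
        finally show "norm (v u ^ n / (1 + z * v u)) \<le> (1 / s) ^ n"
          using v[of u] that by (simp add: add_nonneg_nonneg)
      qed
    qed measurable
  qed
  have lim: "(\<lambda>k. \<integral>u. v u ^ n / (1 + 1 / real (Suc k) * v u) \<partial>L) \<longlonglongrightarrow> (\<integral>u. v u ^ n \<partial>L)"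
    if "Rplus_distribution L" for L n
  proof (rule integral_dominated_convergence[where w = "\<lambda>_. (1 / s) ^ n"])
    interpret L: Rplus_distribution L by fact
    have [measurable_cong]: "sets L = sets borel" by simp
    show "integrable L (\<lambda>_. (1 / s) ^ n)" by simp
    show "AE u in L. (\<lambda>k. v u ^ n / (1 + 1 / real (Suc k) * v u)) \<longlonglongrightarrow> v u ^ n"
    proof (rule AE_I2)
      fix u
      have "(\<lambda>k. v u ^ n / (1 + 1 / real (Suc k) * v u)) \<longlonglongrightarrow> v u ^ n / (1 + 0 * v u)"
        using LIMSEQ_Suc[OF lim_1_over_n] by (intro tendsto_intros) auto
      then show "(\<lambda>k. v u ^ n / (1 + 1 / real (Suc k) * v u)) \<longlonglongrightarrow> v u ^ n" by simp
    qed
    show "AE u in L. norm (v u ^ n / (1 + 1 / real (Suc k) * v u)) \<le> (1 / s) ^ n" for k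
    proof (rule AE_I2)
      fix u
      have "v u ^ n / (1 + 1 / real (Suc k) * v u) \<le> v u ^ n / 1"
        using v[of u] by (intro divide_left_mono) (auto simp: add_pos_nonneg)
      also have "\<dots> \<le> (1 / s) ^ n" using v[of u] by (simp add: power_mono)
      finally show "norm (v u ^ n / (1 + 1 / real (Suc k) * v u)) \<le> (1 / s) ^ n"
        using v[of u] by (simp add: add_nonneg_nonneg)
    qed
    show "(\<lambda>u. v u ^ n) \<in> borel_measurable L" by measurable
    show "(\<lambda>u. v u ^ n / (1 + 1 / real (Suc k) * v u)) \<in> borel_measurable L" for k by measurable
  qed
  have ncau_v: "ncau L (1 / (s + z)) = (\<integral>u. v u / (1 + z * v u) \<partial>L)" if "Rplus_distribution L" "0 < z" for L z
  proof -
    interpret L: Rplus_distribution L by fact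
    have [measurable_cong]: "sets L = sets borel" by simp
    show ?thesis unfolding ncau_def
    proof (rule integral_cong_AE)
      show "AE u in L. 1 / (s + z) / (1 + u * (1 / (s + z))) = v u / (1 + z * v u)"
        using L.AE_nonneg
      proof eventually_elim
        case (elim u)
        then have "0 < s + u" "0 < s + z" "0 < s + z + u" using s that by auto
        then show ?case using elim by (simp add: v_def field_simps)
      qed
    qed measurable
  qed
  have base: "(\<integral>u. v u / (1 + z * v u) \<partial>M) = (\<integral>u. v u / (1 + z * v u) \<partial>N)" if z: "0 < z" for z
  proof -
    have "0 < 1 / (s + z)" "1 / (s + z) < x0" using s z x0 by (auto simp: s_def field_simps add_pos_pos)
    then have "ncau M (1 / (s + z)) = ncau N (1 / (s + z))" by (simp add: M.ncau_eq N.ncau_eq eq)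
    then show ?thesis
      using ncau_v[OF assms(1) z] ncau_v[OF assms(2) z] by simp
  qed
  \<comment> \<open>The limit of the case \<open>n\<close> as \<open>z\<close> tends to 0 is the
    moment of order \<open>n\<close>, and
    \<open>z * v ^ Suc n / (1 + z * v) = v ^ n - v ^ n / (1 + z * v)\<close> carries the identity to
    \<open>Suc n\<close>.\<close>
  have all: "(\<integral>u. v u ^ n / (1 + z * v u) \<partial>M) = (\<integral>u. v u ^ n / (1 + z * v u) \<partial>N)" if z: "0 < z" for n z
    using z
  proof (induction n arbitrary: z)
    case 0
    have "(\<integral>u. v u ^ 0 / (1 + z * v u) \<partial>L) = 1 - z * (\<integral>u. v u / (1 + z * v u) \<partial>L)" if L: "Rplus_distribution L" for L
    proof -
      interpret L: Rplus_distribution L by fact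
      have "v u ^ 0 / (1 + z * v u) = 1 - z * (v u / (1 + z * v u))" for u
        using v[of u] 0 by (simp add: field_simps add_pos_pos less_imp_neq[THEN not_sym])
      then have "(\<integral>u. v u ^ 0 / (1 + z * v u) \<partial>L) = (\<integral>u. 1 - z * (v u / (1 + z * v u)) \<partial>L)" by simp
      also have "\<dots> = 1 - z * (\<integral>u. v u / (1 + z * v u) \<partial>L)"
      proof -
        define c where "c u = v u / (1 + z * v u)" for u
        have "integrable L c" unfolding c_def using int[OF L, of z 1] 0 by simp
        then have "(\<integral>u. 1 - z * c u \<partial>L) = (\<integral>u. 1 \<partial>L) - (\<integral>u. z * c u \<partial>L)"
          by (intro Bochner_Integration.integral_diff) auto
        also have "(\<integral>u. z * c u \<partial>L) = z * (\<integral>u. c u \<partial>L)" by (rule integral_mult_right_zero)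
        finally show ?thesis using L.prob_space unfolding c_def by simp
      qed
      finally show ?thesis .
    qed
    then show ?case using base[OF 0] assms by simp
  next
    case (Suc n)
    have "(\<lambda>k. \<integral>u. v u ^ n / (1 + 1 / real (Suc k) * v u) \<partial>M) = (\<lambda>k. \<integral>u. v u ^ n / (1 + 1 / real (Suc k) * v u) \<partial>N)"
      by (rule ext, rule Suc.IH) simp
    then have m: "(\<integral>u. v u ^ n \<partial>M) = (\<integral>u. v u ^ n \<partial>N)"
      using LIMSEQ_unique[OF lim[OF assms(1)]] lim[OF assms(2), of n] by simp
    have "z * (\<integral>u. v u ^ Suc n / (1 + z * v u) \<partial>L) = (\<integral>u. v u ^ n \<partial>L) - (\<integral>u. v u ^ n / (1 + z * v u) \<partial>L)"
      if L: "Rplus_distribution L" for L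
    proof -
      have "z * (v u ^ Suc n / (1 + z * v u)) = v u ^ n - v u ^ n / (1 + z * v u)" for u
        using v[of u] Suc.prems by (simp add: field_simps add_pos_pos less_imp_neq[THEN not_sym])
      then have "z * (\<integral>u. v u ^ Suc n / (1 + z * v u) \<partial>L) = (\<integral>u. v u ^ n - v u ^ n / (1 + z * v u) \<partial>L)"
        by (subst integral_mult_right_zero[symmetric]) simp
      also have "\<dots> = (\<integral>u. v u ^ n \<partial>L) - (\<integral>u. v u ^ n / (1 + z * v u) \<partial>L)"
        using int[OF L, of 0 n] int[OF L, of z n] Suc.prems by (intro Bochner_Integration.integral_diff) auto
      finally show ?thesis .
    qed
    from this[OF assms(1)] this[OF assms(2)] m Suc.IH[OF Suc.prems]
    have "z * (\<integral>u. v u ^ Suc n / (1 + z * v u) \<partial>M) = z * (\<integral>u. v u ^ Suc n / (1 + z * v u) \<partial>N)" by simp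
    then show ?case using Suc.prems by simp
  qed
  have mom: "(\<integral>u. v u ^ n \<partial>M) = (\<integral>u. v u ^ n \<partial>N)" for n
  proof -
    have "(\<lambda>k. \<integral>u. v u ^ n / (1 + 1 / real (Suc k) * v u) \<partial>M) = (\<lambda>k. \<integral>u. v u ^ n / (1 + 1 / real (Suc k) * v u) \<partial>N)"
      by (rule ext, rule all) simp
    then show ?thesis
      using LIMSEQ_unique[OF lim[OF assms(1)]] lim[OF assms(2), of n] by simp
  qed
  have "distr M borel v = distr N borel v"
    using mom vb by (intro moments_determine_bounded[of _ _ _ "1 / s"]) (auto simp: M.real_distribution_axioms N.real_distribution_axioms)
  \<comment> \<open>On the half-line \<open>v\<close> is inverted by \<open>1 / y - s\<close>, so
    the measures can be recovered from their images.\<close>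
  then have "distr (distr M borel v) borel (\<lambda>y. 1 / y - s) = distr (distr N borel v) borel (\<lambda>y. 1 / y - s)"
    by simp
  moreover have "distr (distr L borel v) borel (\<lambda>y. 1 / y - s) = L" if L: "Rplus_distribution L" for L
  proof -
    interpret L: Rplus_distribution L by fact
    have [measurable_cong]: "sets L = sets borel" by simp
    have "distr (distr L borel v) borel (\<lambda>y. 1 / y - s) = distr L borel (\<lambda>u. 1 / v u - s)"
      by (subst distr_distr) (auto simp: o_def)
    also have "\<dots> = distr L borel (\<lambda>u. u)"
      by (rule distr_cong_AE) (use L.AE_nonneg s in \<open>auto elim!: eventually_mono simp: v_def\<close>)
    also have "\<dots> = L" by (rule distr_id2) simp
    finally show ?thesis .
  qed
  ultimately show ?thesis using assms by metis
qed

section \<open>Empirical measures: approximation and compactness\<close>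

text \<open>Drawing an index instead of a value counts repeated entries with multiplicity.\<close>

definition emp_measure :: "real list \<Rightarrow> real measure" where
  "emp_measure l = distr (measure_pmf (pmf_of_set {..<length l})) borel (\<lambda>i. l ! i)"

lemma AE_emp_measure: "l \<noteq> [] \<Longrightarrow> AE u in emp_measure l. u \<in> set l"
  unfolding emp_measure_def
  by (subst AE_distr_iff) (auto simp: AE_measure_pmf_iff set_pmf_of_set lessThan_empty_iff intro: borel_closed finite_imp_closed)

lemma Rplus_distribution_emp_measure:
  assumes "l \<noteq> []" "\<forall>a\<in>set l. 0 \<le> a"
  shows "Rplus_distribution (emp_measure l)"
proof -
  interpret real_distribution "emp_measure l"
    unfolding emp_measure_def by (rule prob_space.real_distribution_distr[OF measure_pmf.prob_space_axioms]) simp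
  have "AE u in emp_measure l. u \<notin> {..<0}"
    using AE_emp_measure[OF assms(1)] by eventually_elim (use assms(2) in force)
  then have "emeasure (emp_measure l) {..<0} = 0"
    by (subst (asm) AE_iff_measurable[of "{..<0}"]) auto
  then show ?thesis by unfold_locales
qed

lemma integral_emp_measure:
  fixes f :: "real \<Rightarrow> real"
  assumes "l \<noteq> []" "f \<in> borel_measurable borel"
  shows "(\<integral>u. f u \<partial>emp_measure l) = (\<Sum>a\<leftarrow>l. f a) / real (length l)"
proof -
  have "(\<integral>u. f u \<partial>emp_measure l) = (\<integral>i. f (l ! i) \<partial>measure_pmf (pmf_of_set {..<length l}))"
    unfolding emp_measure_def using assms by (intro integral_distr) auto
  also have "\<dots> = (\<Sum>i<length l. f (l ! i)) / real (length l)"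
    using assms by (subst integral_pmf_of_set) (auto simp: lessThan_empty_iff)
  also have "(\<Sum>i<length l. f (l ! i)) = (\<Sum>a\<leftarrow>l. f a)"
    by (simp add: sum_list_sum_nth atLeast0LessThan)
  finally show ?thesis .
qed

lemma npsi_emp_measure: "l \<noteq> [] \<Longrightarrow> npsi (emp_measure l) x = emp_mean l x"
  unfolding npsi_def emp_mean_def by (rule integral_emp_measure) auto

lemma npsi_tendsto_weak_conv:
  assumes M: "\<And>n. Rplus_distribution (M n)" and N: "Rplus_distribution N"
    and wc: "weak_conv_m M N" and x: "0 < x"
  shows "(\<lambda>n. npsi (M n) x) \<longlonglongrightarrow> npsi N x"
proof -
  \<comment> \<open>Replacing \<open>u\<close> by \<open>max 0 u\<close> changes the integrand on a
    null set only and makes it bounded and continuous on the whole line, as the test functions for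
    weak convergence have to be.\<close>
  define f where "f u = max 0 u * x / (1 + max 0 u * x)" for u
  have ne: "1 + max 0 u * x \<noteq> 0" for u using one_plus_mult_pos[of "max 0 u" x] x by auto
  have "(\<lambda>n. \<integral>u. f u \<partial>M n) \<longlonglongrightarrow> (\<integral>u. f u \<partial>N)"
  proof (rule weak_conv_imp_integral_bdd_continuous_conv[OF _ _ wc])
    show "isCont f u" for u unfolding f_def using ne by (intro continuous_intros) auto
    show "norm (f u) \<le> 1" for u unfolding f_def real_norm_def by (rule mult_div_one_plus_bounds) (use x in auto)
  qed (use M N in \<open>auto simp: Rplus_distribution_def\<close>)
  moreover have "(\<integral>u. f u \<partial>L) = npsi L x" if "Rplus_distribution L" for L
  proof -
    interpret L: Rplus_distribution L by fact
    have [measurable_cong]: "sets L = sets borel" by simp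
    show ?thesis
      unfolding npsi_def f_def by (rule integral_cong_AE) (use L.AE_nonneg in \<open>auto elim!: eventually_mono\<close>)
  qed
  ultimately show ?thesis using M N by simp
qed

lemma card_nat_le_real:
  assumes "0 \<le> c" "c \<le> real d + 1"
  shows "c - 1 \<le> real (card {i. i < d \<and> real i + 1 \<le> c})" "real (card {i. i < d \<and> real i + 1 \<le> c}) \<le> c"
proof -
  have "{i. i < d \<and> real i + 1 \<le> c} = {..<min d (nat \<lfloor>c\<rfloor>)}"
    by (auto simp: le_nat_floor nat_less_iff less_floor_iff le_floor_iff Suc_le_eq[symmetric] nat_le_iff) linarith+
  moreover define n where "n = nat \<lfloor>c\<rfloor>"
  ultimately have "card {i. i < d \<and> real i + 1 \<le> c} = min d n" by simp
  moreover have "real n \<le> c" "c - 1 \<le> real n" using assms by (auto simp: n_def)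
  ultimately show "c - 1 \<le> real (card {i. i < d \<and> real i + 1 \<le> c})" "real (card {i. i < d \<and> real i + 1 \<le> c}) \<le> c"
    using assms by (auto simp: min_def)
qed

text \<open>The entries are quantiles, so the empirical distribution function of \<open>d\<close> of
  them differs from that of \<open>M\<close> by at most \<open>1 / d\<close>. Adding
  \<open>1 / d\<close> makes them strictly positive, as the results on polynomials demand, and moves
  the means by at most \<open>x / d\<close>.\<close>

theorem (in Rplus_distribution) empirical_approximation:
  obtains l :: "nat \<Rightarrow> real list" where "\<And>d. length (l d) = d" "\<And>d. \<forall>a\<in>set (l d). 0 < a"
    "\<And>x. 0 < x \<Longrightarrow> (\<lambda>d. emp_mean (l d) x) \<longlonglongrightarrow> npsi M x"
proof -
  interpret C: cdf_distribution M by unfold_locales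
  \<comment> \<open>The levels \<open>(i + 1) / (d + 1)\<close> lie strictly between 0 and 1, where
    the pseudoinverse of the distribution function is characterized.\<close>
  define q where "q d i = C.I ((real i + 1) / (real d + 1))" for d i :: nat
  have q_iff: "q d i \<le> y \<longleftrightarrow> real i + 1 \<le> (real d + 1) * cdf M y" if "i < d" for d i y
  proof -
    have "0 < (real i + 1) / (real d + 1)" "(real i + 1) / (real d + 1) < 1" using that by auto
    from C.pseudoinverse[OF this, of y] show ?thesis unfolding q_def by (simp add: pos_divide_le_eq mult.commute)
  qed
  have cdf_neg: "cdf M y = 0" if "y < 0" for y
  proof -
    have "emeasure M {..y} \<le> emeasure M {..<0}" using that by (intro emeasure_mono) auto
    then show ?thesis by (simp add: negligible_neg cdf_def measure_def)
  qed
  have q_nonneg: "0 \<le> q d i" if "i < d" for d i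
  proof (rule ccontr)
    assume "\<not> 0 \<le> q d i"
    then have "cdf M (q d i) = 0" by (simp add: cdf_neg)
    with q_iff[OF that, of "q d i"] show False by simp
  qed
  define l0 where "l0 d = map (q d) [0..<d]" for d
  define l where "l d = map (\<lambda>a. a + 1 / real d) (l0 d)" for d
  have wc: "weak_conv_m (\<lambda>d. emp_measure (l0 (Suc d))) M"
    unfolding weak_conv_m_def weak_conv_def
  proof (intro allI impI)
    fix y
    have b: "norm (cdf (emp_measure (l0 (Suc d))) y - cdf M y) \<le> 1 / real (Suc d)" for d
    proof -
      let ?d = "Suc d"
      define F where "F = cdf M y"
      have F: "0 \<le> F" "F \<le> 1" by (auto simp: F_def cdf_nonneg cdf_bounded_prob)
      interpret E: Rplus_distribution "emp_measure (l0 ?d)"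
        by (rule Rplus_distribution_emp_measure) (auto simp: l0_def q_nonneg)
      have "cdf (emp_measure (l0 ?d)) y = (\<integral>u. indicator {..y} u \<partial>emp_measure (l0 ?d))"
        by (simp add: cdf_def)
      also have "\<dots> = (\<Sum>a\<leftarrow>l0 ?d. indicator {..y} a) / real ?d"
        by (subst integral_emp_measure) (auto simp: l0_def simp del: upt_Suc)
      also have "(\<Sum>a\<leftarrow>l0 ?d. indicator {..y} a) = (\<Sum>i<?d. indicator {..y} (q ?d i) :: real)"
        unfolding l0_def map_map o_def interv_sum_list_conv_sum_set_nat by (simp only: set_upt atLeast0LessThan)
      also have "\<dots> = (\<Sum>i<?d. if real i + 1 \<le> (real ?d + 1) * F then 1 else (0::real))"
        by (rule sum.cong) (auto simp: q_iff F_def indicator_def)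
      also have "\<dots> = real (card {i. i < ?d \<and> real i + 1 \<le> (real ?d + 1) * F})"
        by (subst sum.inter_filter[symmetric]) (auto intro!: arg_cong[where f = card])
      finally have c: "cdf (emp_measure (l0 ?d)) y = real (card {i. i < ?d \<and> real i + 1 \<le> (real ?d + 1) * F}) / real ?d" .
      have "0 \<le> (real ?d + 1) * F" "(real ?d + 1) * F \<le> real ?d + 1" using F by (auto simp: mult_left_le)
      note cc = card_nat_le_real[OF this]
      have "real ?d * F - 1 \<le> real (card {i. i < ?d \<and> real i + 1 \<le> (real ?d + 1) * F})"
        "real (card {i. i < ?d \<and> real i + 1 \<le> (real ?d + 1) * F}) \<le> real ?d * F + 1"
        using cc F by (auto simp: algebra_simps)
      then have "\<bar>real (card {i. i < ?d \<and> real i + 1 \<le> (real ?d + 1) * F}) - F * real ?d\<bar> \<le> 1" by (simp add: abs_le_iff mult.commute)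
      then have "\<bar>(real (card {i. i < ?d \<and> real i + 1 \<le> (real ?d + 1) * F}) - F * real ?d) / real ?d\<bar> \<le> 1 / real ?d"
        by (simp only: abs_divide abs_of_nat) (intro divide_right_mono, auto)
      then show ?thesis
        unfolding c F_def[symmetric] real_norm_def by (simp add: diff_divide_distrib del: of_nat_Suc)
    qed
    have "(\<lambda>d. cdf (emp_measure (l0 (Suc d))) y - cdf M y) \<longlonglongrightarrow> 0"
      by (rule Lim_null_comparison[OF always_eventually[OF allI[OF b]] LIMSEQ_Suc[OF lim_1_over_n]])
    then show "(\<lambda>d. cdf (emp_measure (l0 (Suc d))) y) \<longlonglongrightarrow> cdf M y"
      by (simp add: LIM_zero_iff)
  qed
  have len: "length (l d) = d" "length (l0 d) = d" for d by (auto simp: l_def l0_def)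
  have nn: "\<forall>a\<in>set (l0 d). 0 \<le> a" for d by (auto simp: l0_def q_nonneg)
  have pos: "\<forall>a\<in>set (l d). 0 < a" for d
    using nn[of d] len(2)[of d] by (cases "d = 0") (auto simp: l_def intro!: add_nonneg_pos)
  have "(\<lambda>d. emp_mean (l d) x) \<longlonglongrightarrow> npsi M x" if x: "0 < x" for x
  proof -
    have "l0 (Suc d) \<noteq> []" for d using len(2)[of "Suc d"] by auto
    then have "(\<lambda>d. emp_mean (l0 (Suc d)) x) \<longlonglongrightarrow> npsi M x"
      using npsi_tendsto_weak_conv[OF _ _ wc x] Rplus_distribution_emp_measure nn Rplus_distribution_axioms
      by (simp add: npsi_emp_measure)
    then have 0: "(\<lambda>d. emp_mean (l0 d) x) \<longlonglongrightarrow> npsi M x" by (rule LIMSEQ_imp_Suc)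
    have d: "norm (emp_mean (l d) x - emp_mean (l0 d) x) \<le> 1 / real d * x" for d
    proof (cases "d = 0")
      case False
      define g where "g a = a * x / (1 + a * x)" for a
      have g: "\<bar>g (a + e) - g a\<bar> \<le> e * x" if "0 \<le> a" "0 \<le> e" for a e
      proof -
        have p: "1 \<le> 1 + a * x" "1 \<le> 1 + (a + e) * x" using that x by auto
        then have "g (a + e) - g a = e * x / ((1 + a * x) * (1 + (a + e) * x))"
          unfolding g_def by (subst diff_frac_eq) (auto simp: algebra_simps)
        moreover have "1 * 1 \<le> (1 + a * x) * (1 + (a + e) * x)" using p by (intro mult_mono) auto
        then have "e * x / ((1 + a * x) * (1 + (a + e) * x)) \<le> e * x / 1"
          using that x by (intro divide_left_mono) auto
        moreover have "0 \<le> e * x / ((1 + a * x) * (1 + (a + e) * x))" using that x p by (intro divide_nonneg_nonneg) auto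
        ultimately show ?thesis by (simp only: abs_of_nonneg div_by_1)
      qed
      have "\<bar>(\<Sum>a\<leftarrow>l d. g a) - (\<Sum>a\<leftarrow>l0 d. g a)\<bar> \<le> (\<Sum>a\<leftarrow>l0 d. 1 / real d * x)"
      proof -
        have "(\<Sum>a\<leftarrow>l d. g a) - (\<Sum>a\<leftarrow>l0 d. g a) = (\<Sum>a\<leftarrow>l0 d. g (a + 1 / real d) - g a)"
          by (simp add: l_def sum_list_subtractf o_def)
        moreover have "\<bar>\<Sum>a\<leftarrow>l0 d. g (a + 1 / real d) - g a\<bar> \<le> (\<Sum>a\<leftarrow>l0 d. \<bar>g (a + 1 / real d) - g a\<bar>)"
          using sum_list_abs[of "map (\<lambda>a. g (a + 1 / real d) - g a) (l0 d)"] by (simp add: o_def)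
        moreover have "\<dots> \<le> (\<Sum>a\<leftarrow>l0 d. 1 / real d * x)"
          using nn[of d] by (intro sum_list_mono g) auto
        ultimately show ?thesis by linarith
      qed
      also have "\<dots> = x" using False by (simp add: sum_list_triv len)
      finally have "\<bar>(\<Sum>a\<leftarrow>l d. g a) - (\<Sum>a\<leftarrow>l0 d. g a)\<bar> / real d \<le> x / real d"
        by (intro divide_right_mono) auto
      moreover have "emp_mean (l d) x - emp_mean (l0 d) x = ((\<Sum>a\<leftarrow>l d. g a) - (\<Sum>a\<leftarrow>l0 d. g a)) / real d"
        by (simp add: emp_mean_def g_def len diff_divide_distrib)
      ultimately show ?thesis by simp
    qed (simp add: emp_mean_def len)
    have "(\<lambda>d. 1 / real d * x) \<longlonglongrightarrow> 0 * x"
      by (intro tendsto_mult tendsto_const lim_1_over_n)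
    then have "(\<lambda>d. emp_mean (l d) x - emp_mean (l0 d) x) \<longlonglongrightarrow> 0"
      by (intro Lim_null_comparison[OF always_eventually[OF allI[OF d]]]) simp
    from tendsto_add[OF this 0] show ?thesis by simp
  qed
  with len pos that show ?thesis by blast
qed

text \<open>Weak convergence along a subsequence follows once no mass escapes to infinity. Small
  values of \<open>h\<close> ensure this, since mass far out keeps \<open>npsi\<close> away from 0
  at every fixed argument. The transform of a subsequential limit is forced on \<open>I\<close> by
  the convergence of the whole sequence.\<close>

theorem empirical_limit:
  assumes l: "\<And>d. length (l d) = d" "\<And>d. \<forall>a\<in>set (l d). 0 < a" and I: "I \<subseteq> {0<..}"
    and lim: "\<And>x. x \<in> I \<Longrightarrow> (\<lambda>d. emp_mean (l d) x) \<longlonglongrightarrow> h x"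
    and small: "\<And>e. 0 < e \<Longrightarrow> \<exists>x\<in>I. h x < e"
  obtains M where "Rplus_distribution M" "\<And>x. x \<in> I \<Longrightarrow> npsi M x = h x"
proof -
  define \<mu> where "\<mu> n = emp_measure (l (Suc n))" for n
  have ne: "l (Suc n) \<noteq> []" for n using l(1)[of "Suc n"] by auto
  have R: "Rplus_distribution (\<mu> n)" for n
    unfolding \<mu>_def using l(2) by (intro Rplus_distribution_emp_measure ne) (auto simp: less_imp_le)
  have np: "npsi (\<mu> n) x = emp_mean (l (Suc n)) x" for n x by (simp add: \<mu>_def npsi_emp_measure ne)
  have "tight \<mu>"
    unfolding tight_def
  proof safe
    show "real_distribution (\<mu> n)" for n using R[of n] by (simp add: Rplus_distribution_def)
    fix e :: real assume e: "0 < e"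
    \<comment> \<open>For \<open>u > 1 / x\<close> the integrand of \<open>npsi\<close> exceeds 1/2,
      so the mass beyond \<open>1 / x\<close> is at most twice \<open>npsi\<close> at
      \<open>x\<close>, which is below \<open>e\<close> from some index \<open>N\<close> on. The
      finitely many earlier measures are covered by the largest entry \<open>B\<close>.\<close>
    then obtain x where x: "x \<in> I" "h x < e / 2" using small[of "e / 2"] by auto
    then have x0: "0 < x" using I by auto
    have "(\<lambda>n. npsi (\<mu> n) x) \<longlonglongrightarrow> h x" unfolding np using LIMSEQ_Suc[OF lim[OF x(1)]] .
    from order_tendstoD(2)[OF this x(2)] obtain N where N: "\<And>n. N \<le> n \<Longrightarrow> npsi (\<mu> n) x < e / 2"
      by (auto simp: eventually_sequentially)
    define B where "B = Max (insert 0 (\<Union>n<N. set (l (Suc n))))"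
    have B: "a \<le> B" if "n < N" "a \<in> set (l (Suc n))" for n a
      unfolding B_def using that by (intro Max_ge) auto
    have B0: "0 \<le> B" unfolding B_def by (intro Max_ge) auto
    define b where "b = max B (1 / x)"
    have "1 - e < measure (\<mu> n) {-1<..b}" for n
    proof -
      interpret Rplus_distribution "\<mu> n" by (rule R)
      show ?thesis
      proof (cases "n < N")
        case True
        have "AE u in \<mu> n. u \<in> {-1<..b}"
          using AE_emp_measure[OF ne] unfolding \<mu>_def
          by eventually_elim (use True B[OF True] l(2)[of "Suc n"] in \<open>force simp: b_def\<close>)
        then have "measure (\<mu> n) {-1<..b} = 1" by (intro prob_eq_1[THEN iffD2]) auto
        then show ?thesis using e by simp
      next
        case False
        have "measure (\<mu> n) (- {-1<..b}) = (\<integral>u. indicator (- {-1<..b}) u \<partial>\<mu> n)" by simp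
        also have "\<dots> \<le> (\<integral>u. 2 * (u * x / (1 + u * x)) \<partial>\<mu> n)"
        proof (rule integral_mono_AE)
          show "AE u in \<mu> n. indicator (- {-1<..b}) u \<le> 2 * (u * x / (1 + u * x))"
            using AE_nonneg
          proof eventually_elim
            case (elim u)
            show ?case
            proof (cases "u \<le> b")
              case True
              then show ?thesis using elim mult_div_one_plus_bounds(1)[OF elim x0] by (auto simp: indicator_def)
            next
              case False
              then have "1 / x < u" by (simp add: b_def)
              then have "1 < u * x" using x0 by (simp add: pos_divide_less_eq)
              then have "1 \<le> 2 * (u * x / (1 + u * x))" by (simp add: field_simps)
              then show ?thesis by (auto simp: indicator_def)
            qed
          qed
          show "integrable (\<mu> n) (indicator (- {-1<..b}) :: real \<Rightarrow> real)" by (intro integrable_real_indicator) (auto simp: emeasure_finite less_top[symmetric])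
          show "integrable (\<mu> n) (\<lambda>u. 2 * (u * x / (1 + u * x)))"
            by (intro integrable_mult_right integrable_npsi x0)
        qed
        also have "\<dots> = 2 * npsi (\<mu> n) x" unfolding npsi_def by (rule integral_mult_right_zero)
        also have "\<dots> < e" using N[of n] False by simp
        finally show ?thesis using prob_compl[of "{-1<..b}"] by (simp add: Compl_eq_Diff_UNIV)
      qed
    qed
    moreover have "-1 < b" using B0 by (simp add: b_def)
    ultimately show "\<exists>a b. a < b \<and> (\<forall>n. 1 - e < measure (\<mu> n) {a<..b})" by blast
  qed
  from tight_imp_convergent_subsubsequence[OF this strict_mono_id]
  obtain r M where r: "strict_mono (r :: nat \<Rightarrow> nat)" "real_distribution M" "weak_conv_m (\<lambda>n. \<mu> (r n)) M"
    by (auto simp: o_def)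
  interpret M: real_distribution M by fact
  have RM: "Rplus_distribution M"
  proof -
    \<comment> \<open>A bounded continuous function that is positive exactly on the negative
      half-line: its integrals vanish along the sequence, hence also in the limit.\<close>
    define f where "f u = min 1 (max 0 (- u))" for u :: real
    have [measurable]: "f \<in> borel_measurable borel" unfolding f_def by measurable
    have "(\<lambda>n. \<integral>u. f u \<partial>\<mu> (r n)) \<longlonglongrightarrow> (\<integral>u. f u \<partial>M)"
    proof (rule weak_conv_imp_integral_bdd_continuous_conv[OF _ _ r(3)])
      show "isCont f u" for u unfolding f_def by (intro continuous_intros)
      show "norm (f u) \<le> 1" for u by (auto simp: f_def)
    qed (use R r in \<open>auto simp: Rplus_distribution_def\<close>)
    moreover have "(\<integral>u. f u \<partial>\<mu> n) = 0" for n
    proof -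
      interpret Rplus_distribution "\<mu> n" by (rule R)
      have "(\<integral>u. f u \<partial>\<mu> n) = (\<integral>u. 0 \<partial>\<mu> n)"
        by (rule integral_cong_AE) (use AE_nonneg in \<open>auto elim!: eventually_mono simp: f_def\<close>)
      then show ?thesis by simp
    qed
    ultimately have "(\<integral>u. f u \<partial>M) = 0" by (simp add: LIMSEQ_const_iff)
    moreover have "integrable M f" by (rule M.integrable_const_bound[of _ 1]) (auto simp: f_def)
    ultimately have "AE u in M. f u = 0"
      by (subst (asm) integral_nonneg_eq_0_iff_AE) (auto simp: f_def)
    then have "AE u in M. u \<notin> {..<0}" by eventually_elim (auto simp: f_def min_def max_def split: if_splits)
    then have "emeasure M {..<0} = 0" by (subst (asm) AE_iff_measurable[of "{..<0}"]) auto
    then show ?thesis by unfold_locales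
  qed
  have "npsi M x = h x" if "x \<in> I" for x
  proof -
    have "(\<lambda>n. npsi (\<mu> (r n)) x) \<longlonglongrightarrow> npsi M x"
      using that I by (intro npsi_tendsto_weak_conv[OF R RM r(3)]) auto
    moreover have "(\<lambda>n. npsi (\<mu> (r n)) x) \<longlonglongrightarrow> h x"
      using LIMSEQ_subseq_LIMSEQ[OF LIMSEQ_Suc[OF lim[OF that]] r(1)] unfolding np o_def .
    ultimately show ?thesis by (rule LIMSEQ_unique)
  qed
  with RM that show ?thesis by blast
qed

section \<open>Existence of the free convolutions\<close>

lemma esym_eq_nesym: "k \<le> length l \<Longrightarrow> esym l k = real (length l choose k) * nesym l k"
  by (simp add: nesym_def)

lemma esym_ratio:
  fixes l :: "real list"
  assumes "k < length l"
  shows "esym l (Suc k) / esym l k = nesym l (Suc k) / nesym l k * ((real (length l) - real k) / (real k + 1))"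
proof -
  let ?d = "length l"
  have "Suc k * (?d choose Suc k) = (?d - k) * (?d choose k)"
    unfolding binomial_absorb_comp binomial_absorption ..
  then have "real (Suc k * (?d choose Suc k)) = real ((?d - k) * (?d choose k))" by presburger
  then have "(real k + 1) * real (?d choose Suc k) = (real ?d - real k) * real (?d choose k)"
    using assms by (simp add: of_nat_diff algebra_simps)
  moreover have "0 < ?d choose k" using assms by simp
  ultimately have "real (?d choose Suc k) / real (?d choose k) = (real ?d - real k) / (real k + 1)"
    by (simp add: field_simps)
  moreover have "esym l (Suc k) / esym l k = nesym l (Suc k) / nesym l k * (real (?d choose Suc k) / real (?d choose k))"
    using assms by (simp only: esym_eq_nesym[of "Suc k" l] esym_eq_nesym[of k l] times_divide_times_eq mult.commute Suc_leI less_imp_le)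
  ultimately show ?thesis by simp
qed

lemma log_concave_seqI_ratio:
  assumes pos: "\<And>k. k \<le> d \<Longrightarrow> 0 < w k"
    and ratio: "\<And>k. Suc k < d \<Longrightarrow> w (Suc (Suc k)) / w (Suc k) \<le> w (Suc k) / w k"
  shows "log_concave_seq d w"
proof
  fix k assume "Suc (Suc k) \<le> d"
  then show "w k * w (Suc (Suc k)) \<le> (w (Suc k))\<^sup>2"
    using ratio[of k] pos[of k] pos[of "Suc k"] by (simp add: field_simps power2_eq_square)
qed (rule pos)

lemma log_concave_nesym:
  fixes l :: "real list"
  assumes "\<forall>a\<in>set l. 0 < a"
  shows "log_concave_seq (length l) (nesym l)"
  by unfold_locales (use assms nesym_pos newton_inequality in auto)

lemma log_concave_esym:
  fixes l :: "real list"
  assumes "\<forall>a\<in>set l. 0 < a"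
  shows "log_concave_seq (length l) (esym l)"
proof (rule log_concave_seqI_ratio)
  fix k assume k: "Suc k < length l"
  interpret n: log_concave_seq "length l" "nesym l" by (rule log_concave_nesym[OF assms])
  have "(real (length l) - real (Suc k)) / (real (Suc k) + 1) \<le> (real (length l) - real k) / (real k + 1)"
    using k by (intro frac_le) auto
  moreover have "nesym l (Suc (Suc k)) / nesym l (Suc k) \<le> nesym l (Suc k) / nesym l k"
    using k by (intro n.ratio_antimono) auto
  ultimately show "esym l (Suc (Suc k)) / esym l (Suc k) \<le> esym l (Suc k) / esym l k"
    using k n.pos[of k] n.pos[of "Suc k"] n.pos[of "Suc (Suc k)"]
    unfolding esym_ratio[OF k] esym_ratio[OF Suc_lessD[OF k]] by (intro mult_mono) auto
qed (use esym_pos assms in auto)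

text \<open>These are the coefficients that the finite free additive convolution turns into a Cauchy product.\<close>

definition csym :: "real list \<Rightarrow> nat \<Rightarrow> real" where
  "csym l k = real (length l) ^ k * (nesym l k / fact k)"

lemma csym_pos: "\<forall>a\<in>set l. 0 < a \<Longrightarrow> k \<le> length l \<Longrightarrow> 0 < csym l k"
  by (cases "length l = 0") (auto simp: csym_def nesym_pos)

text \<open>The power of the length in \<open>csym\<close> turns the factor
  \<open>1 / (k + 1)\<close>, due to the factorial, into \<open>d / (k + 1)\<close>, which has a
  finite limit along \<open>k = t d\<close>.\<close>

lemma csym_ratio:
  assumes "k < length l"
  shows "csym l (Suc k) / csym l k = nesym l (Suc k) / nesym l k * (real (length l) / (real k + 1))"
proof -
  define c where "c = real (length l) ^ k / fact k"
  have "c \<noteq> 0" using assms by (auto simp: c_def)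
  moreover have "csym l (Suc k) = c * (nesym l (Suc k) * (real (length l) / (real k + 1)))" "csym l k = c * nesym l k"
    by (simp_all add: csym_def c_def algebra_simps)
  ultimately show ?thesis by simp
qed

lemma log_concave_csym:
  assumes "\<forall>a\<in>set l. 0 < a"
  shows "log_concave_seq (length l) (csym l)"
proof (rule log_concave_seqI_ratio)
  fix k assume k: "Suc k < length l"
  interpret n: log_concave_seq "length l" "nesym l" by (rule log_concave_nesym[OF assms])
  have "real (length l) / (real (Suc k) + 1) \<le> real (length l) / (real k + 1)"
    using k by (intro frac_le) auto
  moreover have "nesym l (Suc (Suc k)) / nesym l (Suc k) \<le> nesym l (Suc k) / nesym l k"
    using k by (intro n.ratio_antimono) auto
  ultimately show "csym l (Suc (Suc k)) / csym l (Suc k) \<le> csym l (Suc k) / csym l k"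
    using k n.pos[of k] n.pos[of "Suc k"] n.pos[of "Suc (Suc k)"]
    unfolding csym_ratio[OF k] csym_ratio[OF Suc_lessD[OF k]] by (intro mult_mono) auto
qed (use csym_pos assms in auto)

text \<open>\<open>x\<close> is the tilt for which the weights \<open>u d k * x ^ k\<close> are
  asymptotically level at \<open>k = t d\<close>; for log-concave weights this marks the location of
  the peak.\<close>

definition has_profile :: "(nat \<Rightarrow> nat \<Rightarrow> real) \<Rightarrow> real \<Rightarrow> real \<Rightarrow> bool" where
  "has_profile u t x \<longleftrightarrow>
    (\<lambda>d. u d (Suc (nat \<lfloor>t * real d\<rfloor>)) / u d (nat \<lfloor>t * real d\<rfloor>)) \<longlonglongrightarrow> 1 / x"

lemma floor_fraction_tendsto:
  assumes "0 < t"
  shows "(\<lambda>d. real (nat \<lfloor>t * real d\<rfloor>) / real d) \<longlonglongrightarrow> t"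
proof (rule tendsto_sandwich)
  have ev: "\<forall>\<^sub>F d in sequentially. 0 < real d"
    using eventually_gt_at_top[of 0] by eventually_elim simp
  have f: "t * real d - 1 \<le> real (nat \<lfloor>t * real d\<rfloor>)" "real (nat \<lfloor>t * real d\<rfloor>) \<le> t * real d" for d
    using assms by auto
  show "\<forall>\<^sub>F d in sequentially. t - 1 / real d \<le> real (nat \<lfloor>t * real d\<rfloor>) / real d"
    using ev
  proof eventually_elim
    case (elim d)
    have "t - 1 / real d = (t * real d - 1) / real d" using elim by (simp add: diff_divide_distrib)
    also have "\<dots> \<le> real (nat \<lfloor>t * real d\<rfloor>) / real d" using elim f by (intro divide_right_mono) auto
    finally show ?case .
  qed
  show "\<forall>\<^sub>F d in sequentially. real (nat \<lfloor>t * real d\<rfloor>) / real d \<le> t"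
    using ev by eventually_elim (use f in \<open>simp add: pos_divide_le_eq\<close>)
  have "(\<lambda>d. t - 1 / real d) \<longlonglongrightarrow> t - 0" by (intro tendsto_diff tendsto_const lim_1_over_n)
  then show "(\<lambda>d. t - 1 / real d) \<longlonglongrightarrow> t" by simp
qed simp

lemma eventually_floor_less: assumes "0 < t" "t < 1" shows "\<forall>\<^sub>F d in sequentially. nat \<lfloor>t * real d\<rfloor> < d"
  using eventually_gt_at_top[of 0]
proof eventually_elim
  case (elim d)
  have "real (nat \<lfloor>t * real d\<rfloor>) \<le> t * real d" using assms by auto
  also have "\<dots> < 1 * real d" using elim assms by (intro mult_strict_right_mono) auto
  finally show ?case by simp
qed

lemma floor_odds_tendsto:
  assumes t: "0 < t" "t < 1"
  shows "(\<lambda>d. (real (nat \<lfloor>t * real d\<rfloor>) + 1) / (real d - real (nat \<lfloor>t * real d\<rfloor>))) \<longlonglongrightarrow> t / (1 - t)"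
    "(\<lambda>d. real d / (real d - real (nat \<lfloor>t * real d\<rfloor>))) \<longlonglongrightarrow> 1 / (1 - t)"
proof -
  let ?k = "\<lambda>d. real (nat \<lfloor>t * real d\<rfloor>)"
  have ev: "\<forall>\<^sub>F d in sequentially. 0 < real d"
    using eventually_gt_at_top[of 0] by eventually_elim simp
  have 1: "(\<lambda>d. (?k d / real d + 1 / real d) / (1 - ?k d / real d)) \<longlonglongrightarrow> (t + 0) / (1 - t)"
    using t by (intro tendsto_intros floor_fraction_tendsto lim_1_over_n) auto
  have 2: "(\<lambda>d. 1 / (1 - ?k d / real d)) \<longlonglongrightarrow> 1 / (1 - t)"
    using t by (intro tendsto_intros floor_fraction_tendsto) auto
  have "\<forall>\<^sub>F d in sequentially. (?k d / real d + 1 / real d) / (1 - ?k d / real d) = (?k d + 1) / (real d - ?k d)"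
    using ev by eventually_elim (simp add: add_divide_distrib[symmetric] diff_divide_distrib[symmetric] divide_simps)
  with 1 show "(\<lambda>d. (?k d + 1) / (real d - ?k d)) \<longlonglongrightarrow> t / (1 - t)" by (simp add: tendsto_cong)
  have "\<forall>\<^sub>F d in sequentially. 1 / (1 - ?k d / real d) = real d / (real d - ?k d)"
    using ev by eventually_elim (simp add: divide_simps)
  with 2 show "(\<lambda>d. real d / (real d - ?k d)) \<longlonglongrightarrow> 1 / (1 - t)" by (simp add: tendsto_cong)
qed

text \<open>The ratios of \<open>csym\<close> and \<open>esym\<close> differ by the factor
  \<open>d / (d - k)\<close>, with limit \<open>1 / (1 - t)\<close>. When
  \<open>t = npsi M x\<close>, the new tilt \<open>(1 - t) * x\<close> is \<open>ncau M x\<close>: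
  the variable of the \<psi>-transform is exchanged for that of the R-transform.\<close>

lemma has_profile_csym:
  assumes len: "\<And>d. length (l d) = d" and t: "0 < t" "t < 1" and p: "has_profile (\<lambda>d. esym (l d)) t x"
  shows "has_profile (\<lambda>d. csym (l d)) t ((1 - t) * x)"
  unfolding has_profile_def
proof -
  let ?k = "\<lambda>d. nat \<lfloor>t * real d\<rfloor>"
  have "(\<lambda>d. esym (l d) (Suc (?k d)) / esym (l d) (?k d) * (real d / (real d - real (?k d)))) \<longlonglongrightarrow> 1 / x * (1 / (1 - t))"
    using p floor_odds_tendsto(2)[OF t] unfolding has_profile_def by (rule tendsto_mult)
  moreover have "\<forall>\<^sub>F d in sequentially. esym (l d) (Suc (?k d)) / esym (l d) (?k d) * (real d / (real d - real (?k d)))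
      = csym (l d) (Suc (?k d)) / csym (l d) (?k d)"
    using eventually_floor_less[OF t]
  proof eventually_elim
    case (elim d)
    then have "0 < real d - real (?k d)" by simp
    then show ?case using elim by (simp add: esym_ratio csym_ratio len)
  qed
  ultimately have "(\<lambda>d. csym (l d) (Suc (?k d)) / csym (l d) (?k d)) \<longlonglongrightarrow> 1 / x * (1 / (1 - t))"
    by (rule Lim_transform_eventually)
  then show "(\<lambda>d. csym (l d) (Suc (?k d)) / csym (l d) (?k d)) \<longlonglongrightarrow> 1 / ((1 - t) * x)"
    by (simp add: mult.commute)
qed

lemma has_profile_esym:
  assumes len: "\<And>d. length (l d) = d" and t: "0 < t" "t < 1" and p: "has_profile (\<lambda>d. csym (l d)) t x"
  shows "has_profile (\<lambda>d. esym (l d)) t (x / (1 - t))"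
  unfolding has_profile_def
proof -
  let ?k = "\<lambda>d. nat \<lfloor>t * real d\<rfloor>"
  have "(\<lambda>d. csym (l d) (Suc (?k d)) / csym (l d) (?k d) / (real d / (real d - real (?k d)))) \<longlonglongrightarrow> 1 / x / (1 / (1 - t))"
    by (rule tendsto_divide[OF p[unfolded has_profile_def] floor_odds_tendsto(2)[OF t]]) (use t in simp)
  moreover have "\<forall>\<^sub>F d in sequentially. csym (l d) (Suc (?k d)) / csym (l d) (?k d) / (real d / (real d - real (?k d)))
      = esym (l d) (Suc (?k d)) / esym (l d) (?k d)"
    using eventually_floor_less[OF t]
  proof eventually_elim
    case (elim d)
    then have "0 < real d - real (?k d)" "0 < real d" by simp_all
    then show ?case using elim by (simp add: esym_ratio csym_ratio len)
  qed
  ultimately have "(\<lambda>d. esym (l d) (Suc (?k d)) / esym (l d) (?k d)) \<longlonglongrightarrow> 1 / x / (1 / (1 - t))"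
    by (rule Lim_transform_eventually)
  then show "(\<lambda>d. esym (l d) (Suc (?k d)) / esym (l d) (?k d)) \<longlonglongrightarrow> 1 / (x / (1 - t))"
    by simp
qed

text \<open>The ratios of \<open>nesym\<close> multiply. Each ratio of \<open>esym\<close> contains
  the factor \<open>(d - k) / (k + 1)\<close>, so a product of two contains one too many, with limit
  \<open>(1 - t) / t\<close>. As S(-t) is \<open>x * (1 - t) / t\<close>, this is multiplicativity
  of S.\<close>

lemma has_profile_mult:
  assumes len: "\<And>d. length (l d) = d" "\<And>d. length (l' d) = d" "\<And>d. length (m d) = d"
    and m: "\<And>d k. k \<le> d \<Longrightarrow> nesym (m d) k = nesym (l d) k * nesym (l' d) k"
    and t: "0 < t" "t < 1"
    and p: "has_profile (\<lambda>d. esym (l d)) t x" "has_profile (\<lambda>d. esym (l' d)) t y"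
  shows "has_profile (\<lambda>d. esym (m d)) t (x * (y * (1 - t) / t))"
  unfolding has_profile_def
proof -
  let ?k = "\<lambda>d. nat \<lfloor>t * real d\<rfloor>"
  let ?r = "\<lambda>l d. esym (l d) (Suc (?k d)) / esym (l d) (?k d)"
  have "(\<lambda>d. ?r l d * ?r l' d * ((real (?k d) + 1) / (real d - real (?k d)))) \<longlonglongrightarrow> 1 / x * (1 / y) * (t / (1 - t))"
    using p floor_odds_tendsto(1)[OF t] unfolding has_profile_def by (intro tendsto_mult)
  moreover have "\<forall>\<^sub>F d in sequentially. ?r l d * ?r l' d * ((real (?k d) + 1) / (real d - real (?k d))) = ?r m d"
    using eventually_floor_less[OF t]
  proof eventually_elim
    case (elim d)
    define k where "k = ?k d"
    have "0 < real d - real k" "0 < real k + 1" "k < d" using elim by (simp_all add: k_def)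
    then show ?case unfolding k_def[symmetric] by (simp add: esym_ratio len m)
  qed
  ultimately have "(\<lambda>d. ?r m d) \<longlonglongrightarrow> 1 / x * (1 / y) * (t / (1 - t))"
    by (rule Lim_transform_eventually)
  then show "(\<lambda>d. ?r m d) \<longlonglongrightarrow> 1 / (x * (y * (1 - t) / t))"
    by (simp add: mult_ac)
qed

context Rplus_distribution
begin

lemma has_profile_approximation:
  assumes ne: "M \<noteq> return borel 0"
    and l: "\<And>d. length (l d) = d" "\<And>d. \<forall>a\<in>set (l d). 0 < a"
    and lim: "\<And>x. 0 < x \<Longrightarrow> (\<lambda>d. emp_mean (l d) x) \<longlonglongrightarrow> npsi M x"
    and x: "0 < x"
  shows "has_profile (\<lambda>d. esym (l d)) (npsi M x) x"
  unfolding has_profile_def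
proof (rule concentrates_imp_ratio_tendsto[where I = "{0<..}" and \<xi> = "\<lambda>x. x"])
  show "log_concave_seq d (esym (l d))" for d
    using log_concave_esym[OF l(2)] by (simp add: l)
  show "concentrates (\<lambda>d. esym (l d)) q (npsi M q)" if "q \<in> {0<..}" for q
    using that by (intro emp_mean_tendsto_imp_concentrates l lim) auto
  show "strict_mono_on {0<..} (npsi M)"
    by (intro strict_mono_onI npsi_strict_mono ne) auto
qed (use x npsi_pos[OF ne x] npsi_less_1[OF x] in auto)

text \<open>Chebyshev's association inequality: both factors below change sign at the same point \<open>u0\<close>.\<close>

lemma ncau_mult_le:
  assumes x: "0 < x" "0 < y"
  shows "ncau M x * ncau M y \<le> (\<integral>u. x / (1 + u * x) * (y / (1 + u * y)) \<partial>M)"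
proof -
  define c where "c = ncau M x"
  define u0 where "u0 = 1 / c - 1 / x"
  \<comment> \<open>\<open>u0\<close> is the point where \<open>x / (1 + u * x)\<close> takes its
    mean value \<open>c\<close>, and \<open>c'\<close> is the value of the other factor at that
    point. The terms with \<open>c'\<close> cancel upon integration because \<open>c\<close> is the
    mean of the first factor.\<close>
  define c' where "c' = y / (1 + u0 * y)"
  have c: "0 < c" "c \<le> x" using ncau_pos[OF x(1)] ncau_le[OF x(1)] by (auto simp: c_def)
  have u0: "0 \<le> u0" using c by (simp add: u0_def frac_le)
  have cu0: "c = x / (1 + u0 * x)" using c x by (simp add: u0_def field_simps)
  define a where "a u = x / (1 + u * x)" for u
  define b where "b u = y / (1 + u * y)" for u
  have ia: "integrable M a" and ib: "integrable M b" unfolding a_def b_def using x by (auto intro: integrable_ncau)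
  have iab: "integrable M (\<lambda>u. a u * b u)"
  proof (rule integrable_const_bound[of _ "x * y"])
    show "AE u in M. norm (a u * b u) \<le> x * y"
      using AE_nonneg
    proof eventually_elim
      case (elim u)
      have "0 < a u" "a u \<le> x" "0 < b u" "b u \<le> y"
        unfolding a_def b_def using mult_div_one_plus_bounds[OF elim x(1)] mult_div_one_plus_bounds[OF elim x(2)] by auto
      then show ?case by (simp add: abs_mult mult_mono)
    qed
  qed (simp add: a_def b_def)
  have "0 \<le> (\<integral>u. (a u - c) * (b u - c') \<partial>M)"
  proof (rule integral_nonneg_AE)
    show "AE u in M. 0 \<le> (a u - c) * (b u - c')"
      using AE_nonneg
    proof eventually_elim
      case (elim u)
      have mono: "z / (1 + v * z) \<le> z / (1 + w * z)" if "0 \<le> w" "w \<le> v" "0 < z" for v w z :: real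
        using that one_plus_mult_pos[of w z] one_plus_mult_pos[of v z]
        by (intro divide_left_mono) (auto simp: mult_right_mono)
      show ?case
      proof (cases "u \<le> u0")
        case True
        then have "c \<le> a u" "c' \<le> b u" unfolding cu0 c'_def a_def b_def using elim x by (auto intro: mono)
        then show ?thesis by simp
      next
        case False
        then have "a u \<le> c" "b u \<le> c'" unfolding cu0 c'_def a_def b_def using u0 x by (auto intro: mono)
        then show ?thesis by (simp add: mult_nonpos_nonpos)
      qed
    qed
  qed
  also have "(\<lambda>u. (a u - c) * (b u - c')) = (\<lambda>u. (a u * b u - c * b u) - (c' * a u - c * c'))"
    by (simp add: algebra_simps fun_eq_iff)
  also have "(\<integral>u. (a u * b u - c * b u) - (c' * a u - c * c') \<partial>M)
      = (\<integral>u. a u * b u \<partial>M) - c * (\<integral>u. b u \<partial>M) - (c' * (\<integral>u. a u \<partial>M) - c * c')"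
    using ia ib iab prob_space by simp
  also have "(\<integral>u. a u \<partial>M) = c" by (simp add: c_def ncau_def a_def)
  also have "(\<integral>u. b u \<partial>M) = ncau M y" by (simp add: ncau_def b_def)
  finally show ?thesis unfolding c_def a_def b_def by simp
qed

text \<open>The difference of the integrands \<open>y / (1 + u * y)\<close> and
  \<open>x / (1 + u * x)\<close> is \<open>1 / x - 1 / y\<close> times their product, so the
  association inequality bounds \<open>ncau M y - ncau M x\<close> from below. The result says that
  S(-t) is nondecreasing in \<open>t\<close>, and it makes \<open>tau M s / s\<close> nonincreasing
  in \<open>s\<close>.\<close>

lemma ncau_div_npsi_mono:
  assumes "0 < x" "x \<le> y"
  shows "npsi M y * ncau M x \<le> npsi M x * ncau M y"
proof -
  have y: "0 < y" using assms by simp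
  have "ncau M y - ncau M x = (\<integral>u. y / (1 + u * y) - x / (1 + u * x) \<partial>M)"
    unfolding ncau_def using assms y integrable_ncau by (subst Bochner_Integration.integral_diff) auto
  also have "\<dots> = (\<integral>u. (1 / x - 1 / y) * (x / (1 + u * x) * (y / (1 + u * y))) \<partial>M)"
  proof (rule integral_cong_AE)
    show "AE u in M. y / (1 + u * y) - x / (1 + u * x) = (1 / x - 1 / y) * (x / (1 + u * x) * (y / (1 + u * y)))"
      using AE_nonneg
    proof eventually_elim
      case (elim u)
      then have "0 < 1 + u * x" "0 < 1 + u * y" using assms y by (auto intro: one_plus_mult_pos)
      then show ?case using assms y by (simp add: divide_simps) (simp add: algebra_simps)
    qed
  qed auto
  also have "\<dots> = (1 / x - 1 / y) * (\<integral>u. x / (1 + u * x) * (y / (1 + u * y)) \<partial>M)"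
    by (rule integral_mult_right_zero)
  finally have "(1 / x - 1 / y) * (ncau M x * ncau M y) \<le> ncau M y - ncau M x"
    using ncau_mult_le[OF assms(1) y] assms y by (auto intro!: mult_left_mono simp: frac_le)
  then show ?thesis using assms y by (simp add: npsi_eq algebra_simps)
qed

end

text \<open>The finite multiplicative convolutions of two approximating lists have profile
  \<open>\<zeta>\<close>. By concentration their empirical means at \<open>\<zeta> t\<close>
  converge to \<open>t\<close>, and a limit measure then satisfies
  \<open>npsi R (\<zeta> t) = t\<close>, which is the equation for S.\<close>

theorem free_mult_conv_exists:
  assumes "Rplus_distribution M" "M \<noteq> return borel 0" "Rplus_distribution N" "N \<noteq> return borel 0"
  defines "T \<equiv> 1 - max (measure M {0}) (measure N {0})"
  obtains R where "Rplus_distribution R" "R \<noteq> return borel 0" "measure R {0} \<le> 1 - T"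
    "\<And>t. 0 < t \<Longrightarrow> t < T \<Longrightarrow> S_transform R (- t) = S_transform M (- t) * S_transform N (- t)"
proof -
  interpret M: Rplus_distribution M by fact
  interpret N: Rplus_distribution N by fact
  have T: "0 < T" using M.mass_zero_less_1 N.mass_zero_less_1 assms by (simp add: T_def)
  have "\<forall>t\<in>{0<..<T}. \<exists>x>0. npsi M x = t" using M.ex_npsi_eq by (auto simp: T_def)
  then obtain \<xi> where \<xi>: "\<And>t. t \<in> {0<..<T} \<Longrightarrow> 0 < \<xi> t \<and> npsi M (\<xi> t) = t" by metis
  have "\<forall>t\<in>{0<..<T}. \<exists>x>0. npsi N x = t" using N.ex_npsi_eq by (auto simp: T_def)
  then obtain \<eta> where \<eta>: "\<And>t. t \<in> {0<..<T} \<Longrightarrow> 0 < \<eta> t \<and> npsi N (\<eta> t) = t" by metis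
  have t1: "t < 1" if "t \<in> {0<..<T}" for t
  proof -
    have "T \<le> 1" using measure_nonneg[of M "{0}"] by (simp add: T_def le_max_iff_disj)
    then show ?thesis using that by auto
  qed
  obtain l where l: "\<And>d. length (l d) = d" "\<And>d. \<forall>a\<in>set (l d). 0 < a"
    "\<And>x. 0 < x \<Longrightarrow> (\<lambda>d. emp_mean (l d) x) \<longlonglongrightarrow> npsi M x"
    using M.empirical_approximation by blast
  obtain l' where l': "\<And>d. length (l' d) = d" "\<And>d. \<forall>a\<in>set (l' d). 0 < a"
    "\<And>x. 0 < x \<Longrightarrow> (\<lambda>d. emp_mean (l' d) x) \<longlonglongrightarrow> npsi N x"
    using N.empirical_approximation by blast
  have "\<exists>m. length m = d \<and> (\<forall>a\<in>set m. 0 < a) \<and> (\<forall>k\<le>d. nesym m k = nesym (l d) k * nesym (l' d) k)" for d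
    by (rule finite_free_mult_conv[OF l(1) l'(1) l(2) l'(2), of d]) blast
  then obtain m where m: "\<And>d. length (m d) = d" "\<And>d. \<forall>a\<in>set (m d). 0 < a"
    "\<And>d k. k \<le> d \<Longrightarrow> nesym (m d) k = nesym (l d) k * nesym (l' d) k" by metis
  \<comment> \<open>Forced by multiplicativity: S(-t) is \<open>x * (1 - t) / t\<close>, where
    \<open>x\<close> is \<open>\<xi> t\<close>, \<open>\<eta> t\<close> and \<open>\<zeta> t\<close>
    for the two factors and the product.\<close>
  define \<zeta> where "\<zeta> t = \<xi> t * (\<eta> t * (1 - t) / t)" for t
  have \<zeta>pos: "0 < \<zeta> t" if "t \<in> {0<..<T}" for t
    using \<xi>[OF that] \<eta>[OF that] t1[OF that] that by (simp add: \<zeta>_def)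
  have \<eta>': "\<eta> t * (1 - t) / t = ncau N (\<eta> t) / t" if "t \<in> {0<..<T}" for t
    using \<eta>[OF that] by (simp add: N.ncau_eq)
  \<comment> \<open>\<open>\<zeta>\<close> is the strictly increasing \<open>\<xi>\<close> times
    S(-t) of \<open>N\<close>, which is nondecreasing (and constant for a point mass).\<close>
  have mono: "\<zeta> s < \<zeta> t" if st: "s \<in> {0<..<T}" "t \<in> {0<..<T}" "s < t" for s t
  proof -
    have "\<xi> s < \<xi> t" using \<xi>[OF st(1)] \<xi>[OF st(2)] st(3) M.npsi_less_iff[OF assms(2), of "\<xi> s" "\<xi> t"] by auto
    moreover have "\<eta> s < \<eta> t" using \<eta>[OF st(1)] \<eta>[OF st(2)] st(3) N.npsi_less_iff[OF assms(4), of "\<eta> s" "\<eta> t"] by auto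
    then have "t * ncau N (\<eta> s) \<le> s * ncau N (\<eta> t)"
      using N.ncau_div_npsi_mono[of "\<eta> s" "\<eta> t"] \<eta>[OF st(1)] \<eta>[OF st(2)] by auto
    then have "ncau N (\<eta> s) / s \<le> ncau N (\<eta> t) / t" using st by (simp add: field_simps)
    moreover have "0 < ncau N (\<eta> s) / s" using \<eta>[OF st(1)] st(1) N.ncau_pos by auto
    ultimately show ?thesis
      unfolding \<zeta>_def \<eta>'[OF st(1)] \<eta>'[OF st(2)] using \<xi>[OF st(1)] by (intro mult_less_le_imp_less) auto
  qed
  have prof: "has_profile (\<lambda>d. esym (m d)) t (\<zeta> t)" if t: "t \<in> {0<..<T}" for t
    unfolding \<zeta>_def
  proof (rule has_profile_mult[OF l(1) l'(1) m(1) m(3)])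
    show "has_profile (\<lambda>d. esym (l d)) t (\<xi> t)"
      using M.has_profile_approximation[OF assms(2) l, of "\<xi> t"] \<xi>[OF t] by auto
    show "has_profile (\<lambda>d. esym (l' d)) t (\<eta> t)"
      using N.has_profile_approximation[OF assms(4) l', of "\<eta> t"] \<eta>[OF t] by auto
  qed (use t t1 in auto)
  have lim: "(\<lambda>d. emp_mean (m d) (\<zeta> t)) \<longlonglongrightarrow> t" if t: "t \<in> {0<..<T}" for t
  proof (rule concentrates_imp_emp_mean_tendsto[OF m(1,2) \<zeta>pos[OF t]])
    show "concentrates (\<lambda>d. esym (m d)) (\<zeta> t) t"
    proof (rule ratio_tendsto_imp_concentrates[where I = "{0<..<T}" and \<alpha> = "\<lambda>t. t"])
      show "log_concave_seq d (esym (m d))" for d using log_concave_esym[OF m(2)] by (simp add: m)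
      show "strict_mono_on {0<..<T} \<zeta>" by (intro strict_mono_onI mono)
      show "(\<lambda>d. esym (m d) (Suc (nat \<lfloor>q * real d\<rfloor>)) / esym (m d) (nat \<lfloor>q * real d\<rfloor>)) \<longlonglongrightarrow> 1 / \<zeta> q"
        if "q \<in> {0<..<T}" for q using prof[OF that] by (simp add: has_profile_def)
    qed (use t t1 \<zeta>pos in \<open>auto simp: strict_mono_on_def\<close>)
  qed
  have inj: "inj_on \<zeta> {0<..<T}"
    using mono by (intro linorder_inj_onI) (auto simp: order_less_le dest: mono)
  define h where "h = the_inv_into {0<..<T} \<zeta>"
  have h: "h (\<zeta> t) = t" if "t \<in> {0<..<T}" for t unfolding h_def by (rule the_inv_into_f_f[OF inj that])
  obtain R where R: "Rplus_distribution R" "\<And>x. x \<in> \<zeta> ` {0<..<T} \<Longrightarrow> npsi R x = h x"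
  proof (rule empirical_limit[OF m(1,2), of "\<zeta> ` {0<..<T}" h])
    show "\<exists>x\<in>\<zeta> ` {0<..<T}. h x < e" if "0 < e" for e
      using that T h[of "min (e / 2) (T / 2)"]
      by (intro bexI[of _ "\<zeta> (min (e / 2) (T / 2))"]) auto
  qed (use \<zeta>pos lim h in auto)
  interpret R: Rplus_distribution R by fact
  have npsiR: "npsi R (\<zeta> t) = t" if "t \<in> {0<..<T}" for t using R(2) h that by auto
  have ne: "R \<noteq> return borel 0"
    using npsiR[of "T / 2"] T npsi_return_0[of "\<zeta> (T / 2)"] by auto
  have "T \<le> 1 - measure R {0}"
  proof (rule dense_le_bounded[OF T])
    fix t assume "0 < t" "t < T"
    then show "t \<le> 1 - measure R {0}" using npsiR[of t] R.npsi_le[OF \<zeta>pos, of t] by auto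
  qed
  moreover have "S_transform R (- t) = S_transform M (- t) * S_transform N (- t)" if "0 < t" "t < T" for t
  proof -
    have t: "t \<in> {0<..<T}" using that by auto
    have "S_transform R (- t) = ncau R (\<zeta> t) / t"
      using R.S_transform_eq[OF ne \<zeta>pos[OF t]] npsiR[OF t] by simp
    also have "ncau R (\<zeta> t) = \<zeta> t * (1 - t)" using R.ncau_eq[OF \<zeta>pos[OF t]] npsiR[OF t] by simp
    also have "\<zeta> t * (1 - t) / t = (\<xi> t * (1 - t) / t) * (\<eta> t * (1 - t) / t)" by (simp add: \<zeta>_def)
    also have "\<xi> t * (1 - t) / t = S_transform M (- t)"
      using M.S_transform_eq[OF assms(2), of "\<xi> t"] \<xi>[OF t] M.ncau_eq[of "\<xi> t"] by simp
    also have "\<eta> t * (1 - t) / t = S_transform N (- t)"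
      using N.S_transform_eq[OF assms(4), of "\<eta> t"] \<eta>[OF t] N.ncau_eq[of "\<eta> t"] by simp
    finally show ?thesis .
  qed
  ultimately show ?thesis using R(1) ne that by simp
qed

text \<open>The \<open>R\<close>-transform on the half-line: \<open>tau M s = -R(-s)\<close> for \<open>0 < s < \<kappa>\<close>, continued by \<open>tau M s = 1\<close>
  for \<open>s \<ge> \<kappa>\<close>, which keeps it continuous.\<close>

definition tau :: "real measure \<Rightarrow> real \<Rightarrow> real" where
  "tau M s = (SUP x\<in>{x. 0 < x \<and> ncau M x \<le> s}. npsi M x)"

context Rplus_distribution
begin

lemma npsi_le_tau: "0 < x \<Longrightarrow> ncau M x \<le> s \<Longrightarrow> npsi M x \<le> tau M s"
  unfolding tau_def by (rule cSUP_upper) (auto intro!: bdd_aboveI[of _ 1] less_imp_le npsi_less_1)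

lemma tau_le:
  assumes "0 < s" "\<And>x. 0 < x \<Longrightarrow> ncau M x \<le> s \<Longrightarrow> npsi M x \<le> c"
  shows "tau M s \<le> c"
  unfolding tau_def
proof (rule cSUP_least)
  show "{x. 0 < x \<and> ncau M x \<le> s} \<noteq> {}" using ncau_le[OF assms(1)] assms(1) by blast
qed (use assms in auto)

lemma tau_ncau: assumes "0 < x" shows "tau M (ncau M x) = npsi M x"
  using assms by (intro antisym tau_le npsi_le_tau ncau_pos npsi_mono) (auto simp: ncau_le_iff)

lemma tau_mono: assumes "0 < s" "s \<le> s'" shows "tau M s \<le> tau M s'"
  using assms by (intro tau_le npsi_le_tau) auto

lemma tau_nonneg: "0 < s \<Longrightarrow> 0 \<le> tau M s"
  using npsi_le_tau[of s s] ncau_le[of s] npsi_nonneg[of s] by simp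

text \<open>The quotient \<open>npsi / ncau\<close> does not increase along \<open>x\<close>, and
  the supremum passes this on to \<open>tau M s / s\<close>, also across \<open>kappa\<close>.
  Together with monotonicity it yields continuity of \<open>tau\<close>, with no separate
  computation of the limit at \<open>kappa\<close>.\<close>

lemma tau_div_antimono:
  assumes "0 < s" "s \<le> s'" shows "tau M s' \<le> tau M s * (s' / s)"
proof (rule tau_le)
  fix x assume x: "0 < x" "ncau M x \<le> s'"
  show "npsi M x \<le> tau M s * (s' / s)"
  proof (cases "ncau M x \<le> s")
    case True
    have "npsi M x * 1 \<le> tau M s * (s' / s)"
      using npsi_le_tau[OF x(1) True] tau_nonneg[OF assms(1)] assms by (intro mult_mono) auto
    then show ?thesis by simp
  next
    case False
    then have "ennreal s < ennreal (ncau M x)" using assms by (simp add: ennreal_less_iff)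
    also have "\<dots> < kappa M" by (rule ncau_less_kappa[OF x(1)])
    finally obtain x1 where x1: "0 < x1" "ncau M x1 = s" using ex_ncau_eq[OF assms(1)] by blast
    then have "x1 \<le> x" using False ncau_le_iff[of x1 x] x by simp
    from ncau_div_npsi_mono[OF x1(1) this] have "npsi M x * s \<le> tau M s * ncau M x"
      using tau_ncau[OF x1(1)] x1 by simp
    also have "\<dots> \<le> tau M s * s'" using x(2) tau_nonneg[OF assms(1)] by (intro mult_left_mono)
    finally show ?thesis using assms(1) by (simp add: pos_le_divide_eq)
  qed
qed (use assms in simp)

lemma continuous_tau: "continuous_on {0<..} (tau M)"
  by (rule continuous_on_if_mono_and_quotient_antimono[OF tau_mono tau_div_antimono])

lemma tau_eq_1:
  assumes "0 < s" "kappa M \<le> ennreal s" shows "tau M s = 1"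
proof (rule antisym)
  show "tau M s \<le> 1" using assms(1) by (intro tau_le) (auto intro: less_imp_le npsi_less_1)
  have all: "ncau M x \<le> s" if "0 < x" for x
  proof -
    have "ennreal (ncau M x) < ennreal s" using ncau_less_kappa[OF that] assms(2) by (rule less_le_trans)
    then show ?thesis using ncau_pos[OF that] by (simp add: ennreal_less_iff)
  qed
  show "1 \<le> tau M s"
  proof (rule field_le_epsilon)
    fix e :: real assume e: "0 < e"
    \<comment> \<open>At \<open>x = s / e\<close> the bound \<open>ncau M x \<le> s\<close> turns
      \<open>npsi M x = 1 - ncau M x / x\<close> into a value of at least
      \<open>1 - e\<close>.\<close>
    then have p: "0 < s / e" using assms(1) by simp
    have "ncau M (s / e) / (s / e) \<le> s / (s / e)" using all[OF p] p by (intro divide_right_mono) auto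
    then have "1 - e \<le> npsi M (s / e)" using assms(1) e by (simp add: npsi_eq[OF p])
    also have "\<dots> \<le> tau M s" using p all by (intro npsi_le_tau)
    finally show "1 \<le> tau M s + e" by simp
  qed
qed

lemma tau_less_1_imp: "0 < s \<Longrightarrow> tau M s < 1 \<Longrightarrow> ennreal s < kappa M"
  using tau_eq_1[of s] by (cases "kappa M \<le> ennreal s") auto

lemma R_transform_tau: "0 < s \<Longrightarrow> ennreal s < kappa M \<Longrightarrow> R_transform M (- s) = - tau M s"
  using ex_ncau_eq R_transform_eq tau_ncau by metis

lemma tau_strict_mono:
  assumes "M \<noteq> return borel 0" "0 < s" "s < s'" "ennreal s' < kappa M" shows "tau M s < tau M s'"
proof -
  obtain x' where x': "0 < x'" "ncau M x' = s'" using ex_ncau_eq[of s'] assms by auto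
  have "ennreal s < kappa M" using assms by (meson ennreal_leI le_less_trans less_imp_le)
  then obtain x where x: "0 < x" "ncau M x = s" using ex_ncau_eq[of s] assms by auto
  then have "x < x'" using x' assms ncau_less_iff[of x x'] by simp
  then show ?thesis using npsi_strict_mono[OF assms(1) x(1)] tau_ncau x x' by auto
qed

lemma ex_tau_less: "0 < e \<Longrightarrow> \<exists>s>0. tau M s < e"
  using ex_npsi_less ncau_pos tau_ncau by metis

text \<open>Under the tilt \<open>x\<close>, \<open>esym\<close> concentrates at
  \<open>npsi M x\<close>. Passing to \<open>csym\<close> keeps the location and turns the tilt into
  \<open>s = ncau M x\<close>, so the location is \<open>tau M s\<close>, minus the R-transform at
  \<open>- s\<close>. Cauchy products of \<open>csym\<close> add these locations.\<close>

lemma concentrates_csym_approximation: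
  assumes ne: "M \<noteq> return borel 0"
    and l: "\<And>d. length (l d) = d" "\<And>d. \<forall>a\<in>set (l d). 0 < a"
      "\<And>x. 0 < x \<Longrightarrow> (\<lambda>d. emp_mean (l d) x) \<longlonglongrightarrow> npsi M x"
    and I: "open I" "s \<in> I" "\<And>s. s \<in> I \<Longrightarrow> 0 < s" "\<And>s. s \<in> I \<Longrightarrow> ennreal s < kappa M"
  shows "concentrates (\<lambda>d. csym (l d)) s (tau M s)"
proof (rule ratio_tendsto_imp_concentrates[where I = I and \<xi> = "\<lambda>s. s", OF _ I(1,2)])
  show "log_concave_seq d (csym (l d))" for d using log_concave_csym[OF l(2)] by (simp add: l)
  have ex: "\<exists>x>0. ncau M x = s \<and> tau M s = npsi M x" if "s \<in> I" for s
    using ex_ncau_eq[OF I(3,4)[OF that]] tau_ncau by auto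
  show "(\<lambda>d. csym (l d) (Suc (nat \<lfloor>tau M s * real d\<rfloor>)) / csym (l d) (nat \<lfloor>tau M s * real d\<rfloor>))
      \<longlonglongrightarrow> 1 / s" if s: "s \<in> I" for s
  proof -
    obtain x where x: "0 < x" "ncau M x = s" "tau M s = npsi M x" using ex[OF s] by blast
    have "has_profile (\<lambda>d. csym (l d)) (npsi M x) ((1 - npsi M x) * x)"
      using has_profile_csym[OF l(1) npsi_pos[OF ne x(1)] npsi_less_1[OF x(1)]
          has_profile_approximation[OF ne l x(1)]] .
    moreover have "(1 - npsi M x) * x = s" using x ncau_eq[OF x(1)] by (simp add: mult.commute)
    ultimately show ?thesis using x by (simp add: has_profile_def)
  qed
  show "0 < tau M s \<and> tau M s < 1" if "s \<in> I" for s
    using ex[OF that] npsi_pos[OF ne] npsi_less_1 by auto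
  show "continuous_on I (tau M)" using I(3) by (intro continuous_on_subset[OF continuous_tau]) auto
  show "strict_mono_on I (tau M)" by (intro strict_mono_onI tau_strict_mono[OF ne] I)
  show "strict_mono_on I (\<lambda>s. s)" by (simp add: strict_mono_on_def)
qed (rule I)

end

text \<open>Here the chain runs through \<open>csym\<close>, where convolution adds the locations of
  concentration; \<open>esym\<close> is restored only at the end, to read off empirical means.
  Unlike in the multiplicative case the domain is not given in advance: \<open>kappa R\<close> has
  to be found from \<open>I\<close>.\<close>

theorem free_add_conv_exists:
  assumes "Rplus_distribution M" "M \<noteq> return borel 0" "Rplus_distribution N" "N \<noteq> return borel 0"
  obtains R where "Rplus_distribution R" "kappa R \<le> min (kappa M) (kappa N)"
    "\<And>s. 0 < s \<Longrightarrow> ennreal s < kappa R \<Longrightarrow> R_transform R (- s) = R_transform M (- s) + R_transform N (- s)"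
proof -
  interpret M: Rplus_distribution M by fact
  interpret N: Rplus_distribution N by fact
  define \<alpha> where "\<alpha> s = tau M s + tau N s" for s
  \<comment> \<open>The Cauchy product is cut at index \<open>d\<close>, so a limit is available
    only while the locations add up to less than 1. As \<open>tau\<close> equals 1 from
    \<open>kappa\<close> on, such \<open>s\<close> lie below \<open>kappa M\<close> and
    \<open>kappa N\<close>.\<close>
  define I where "I = {s. 0 < s \<and> \<alpha> s < 1}"
  have cont: "continuous_on {0<..} \<alpha>"
    unfolding \<alpha>_def by (intro continuous_intros M.continuous_tau N.continuous_tau)
  have oI: "open I"
  proof -
    have "I = {0<..} \<inter> \<alpha> -` {..<1}" by (auto simp: I_def)
    then show ?thesis using continuous_open_preimage[OF cont] by simp
  qed
  have kap: "ennreal s < kappa M" "ennreal s < kappa N" if "s \<in> I" for s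
    using that M.tau_nonneg[of s] N.tau_nonneg[of s]
    by (auto simp: I_def \<alpha>_def intro!: M.tau_less_1_imp N.tau_less_1_imp)
  have pos: "0 < tau M s" "0 < tau N s" if "s \<in> I" for s
  proof -
    have s: "0 < s" using that by (simp add: I_def)
    show "0 < tau M s" using M.ex_ncau_eq[OF s kap(1)[OF that]] M.npsi_pos[OF assms(2)] M.tau_ncau by metis
    show "0 < tau N s" using N.ex_ncau_eq[OF s kap(2)[OF that]] N.npsi_pos[OF assms(4)] N.tau_ncau by metis
  qed
  have I: "0 < s" "\<alpha> s < 1" if "s \<in> I" for s using that by (auto simp: I_def)
  have bnd: "tau M s < 1" "tau N s < 1" "0 < \<alpha> s" if "s \<in> I" for s
    using pos[OF that] I[OF that] by (auto simp: \<alpha>_def)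
  have smM: "tau M s < tau M t" and smN: "tau N s < tau N t" if "s \<in> I" "t \<in> I" "s < t" for s t
    using that kap[OF that(2)] I[OF that(1)] M.tau_strict_mono[OF assms(2)] N.tau_strict_mono[OF assms(4)] by auto
  have contI: "continuous_on I (tau M)" "continuous_on I (tau N)" "continuous_on I \<alpha>"
    using cont M.continuous_tau N.continuous_tau by (auto intro: continuous_on_subset simp: I_def)
  have down: "s \<in> I" if "t \<in> I" "0 < s" "s \<le> t" for s t
    using that M.tau_mono[of s t] N.tau_mono[of s t] by (auto simp: I_def \<alpha>_def)
  have small: "\<exists>s\<in>I. \<alpha> s < e" if e: "0 < e" for e
  proof -
    define e' where "e' = min e 1 / 2"
    have "0 < e'" using e by (simp add: e'_def)
    then obtain s t where st: "0 < s" "tau M s < e'" "0 < t" "tau N t < e'"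
      using M.ex_tau_less N.ex_tau_less by meson
    have "\<alpha> (min s t) < 2 * e'"
      using M.tau_mono[of "min s t" s] N.tau_mono[of "min s t" t] st by (simp add: \<alpha>_def)
    then show ?thesis using st by (intro bexI[of _ "min s t"]) (auto simp: I_def e'_def)
  qed
  obtain l where l: "\<And>d. length (l d) = d" "\<And>d. \<forall>a\<in>set (l d). 0 < a"
    "\<And>x. 0 < x \<Longrightarrow> (\<lambda>d. emp_mean (l d) x) \<longlonglongrightarrow> npsi M x"
    using M.empirical_approximation by blast
  obtain l' where l': "\<And>d. length (l' d) = d" "\<And>d. \<forall>a\<in>set (l' d). 0 < a"
    "\<And>x. 0 < x \<Longrightarrow> (\<lambda>d. emp_mean (l' d) x) \<longlonglongrightarrow> npsi N x"
    using N.empirical_approximation by blast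
  have "\<forall>d. \<exists>m. length m = d \<and> (\<forall>a\<in>set m. 0 < a) \<and>
      (\<forall>k\<le>d. nesym m k / fact k = (\<Sum>j\<le>k. nesym (l d) j / fact j * (nesym (l' d) (k - j) / fact (k - j))))"
  proof
    fix d
    show "\<exists>m. length m = d \<and> (\<forall>a\<in>set m. 0 < a) \<and>
      (\<forall>k\<le>d. nesym m k / fact k = (\<Sum>j\<le>k. nesym (l d) j / fact j * (nesym (l' d) (k - j) / fact (k - j))))"
      by (rule finite_free_add_conv[OF l(1) l'(1) l(2) l'(2), of d]) blast
  qed
  from choice[OF this] obtain m where m': "\<And>d. length (m d) = d \<and> (\<forall>a\<in>set (m d). 0 < a) \<and>
      (\<forall>k\<le>d. nesym (m d) k / fact k = (\<Sum>j\<le>k. nesym (l d) j / fact j * (nesym (l' d) (k - j) / fact (k - j))))"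
    by blast
  have m: "\<And>d. length (m d) = d" "\<And>d. \<forall>a\<in>set (m d). 0 < a"
    "\<And>d k. k \<le> d \<Longrightarrow> nesym (m d) k / fact k =
      (\<Sum>j\<le>k. nesym (l d) j / fact j * (nesym (l' d) (k - j) / fact (k - j)))"
    using m' by blast+
  have csym_m: "csym (m d) k = (\<Sum>j\<le>k. csym (l d) j * csym (l' d) (k - j))" if "k \<le> d" for d k
    unfolding csym_def m(3)[OF that] sum_distrib_left
  proof (rule sum.cong[OF refl])
    fix j assume "j \<in> {..k}"
    then have "real d ^ k = real d ^ j * real d ^ (k - j)" by (simp flip: power_add)
    then show "real (length (m d)) ^ k * (nesym (l d) j / fact j * (nesym (l' d) (k - j) / fact (k - j)))
      = real (length (l d)) ^ j * (nesym (l d) j / fact j) *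
        (real (length (l' d)) ^ (k - j) * (nesym (l' d) (k - j) / fact (k - j)))"
      by (simp add: l l' m)
  qed
  have concM: "concentrates (\<lambda>d. csym (l d)) s (tau M s)" if "s \<in> I" for s
    by (rule M.concentrates_csym_approximation[OF assms(2) l oI that I(1) kap(1)])
  have concN: "concentrates (\<lambda>d. csym (l' d)) s (tau N s)" if "s \<in> I" for s
    by (rule N.concentrates_csym_approximation[OF assms(4) l' oI that I(1) kap(2)])
  have conc: "concentrates (\<lambda>d. csym (m d)) s (\<alpha> s)" if s: "s \<in> I" for s
    unfolding \<alpha>_def
    using csym_pos[OF l(2)] csym_pos[OF l'(2)] I[OF s]
    by (intro concentrates_convolution[OF _ _ _ concM[OF s] concN[OF s]]) (auto simp: l l' csym_m \<alpha>_def)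
  have sm\<alpha>: "strict_mono_on I \<alpha>"
    by (rule strict_mono_onI) (auto simp: \<alpha>_def intro!: add_strict_mono smM smN)
  have profc: "has_profile (\<lambda>d. csym (m d)) (\<alpha> s) s" if s: "s \<in> I" for s
    unfolding has_profile_def
  proof (rule concentrates_imp_ratio_tendsto[where I = I and \<xi> = "\<lambda>s. s", OF _ oI s conc])
    show "log_concave_seq d (csym (m d))" for d using log_concave_csym[OF m(2)] by (simp add: m)
  qed (use s I bnd sm\<alpha> in auto)
  \<comment> \<open>Solves \<open>s = x * (1 - npsi R x)\<close> for \<open>x\<close> with
    \<open>npsi R x = \<alpha> s\<close>, so that \<open>ncau R (X s) = s\<close>.\<close>
  define X where "X s = s / (1 - \<alpha> s)" for s
  have Xpos: "0 < X s" if "s \<in> I" for s using I[OF that] by (simp add: X_def)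
  have Xmono: "X s < X t" if "s \<in> I" "t \<in> I" "s < t" for s t
    unfolding X_def using that I[OF that(1)] I[OF that(2)] strict_mono_onD[OF sm\<alpha> that]
    by (intro frac_less2) auto
  have profe: "has_profile (\<lambda>d. esym (m d)) (\<alpha> s) (X s)" if s: "s \<in> I" for s
    unfolding X_def by (rule has_profile_esym[OF m(1) bnd(3)[OF s] I(2)[OF s] profc[OF s]])
  have lim: "(\<lambda>d. emp_mean (m d) (X s)) \<longlonglongrightarrow> \<alpha> s" if s: "s \<in> I" for s
  proof (rule concentrates_imp_emp_mean_tendsto[OF m(1,2) Xpos[OF s]])
    show "concentrates (\<lambda>d. esym (m d)) (X s) (\<alpha> s)"
    proof (rule ratio_tendsto_imp_concentrates[where I = I, OF _ oI s])
      show "log_concave_seq d (esym (m d))" for d using log_concave_esym[OF m(2)] by (simp add: m)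
      show "(\<lambda>d. esym (m d) (Suc (nat \<lfloor>\<alpha> q * real d\<rfloor>)) / esym (m d) (nat \<lfloor>\<alpha> q * real d\<rfloor>)) \<longlonglongrightarrow> 1 / X q"
        if "q \<in> I" for q using profe[OF that] by (simp add: has_profile_def)
    qed (use contI sm\<alpha> bnd I Xpos Xmono in \<open>auto intro!: strict_mono_onI\<close>)
  qed
  have inj: "inj_on X I" by (intro linorder_inj_onI) (auto simp: order_less_le dest: Xmono)
  define h where "h x = \<alpha> (the_inv_into I X x)" for x
  have h: "h (X s) = \<alpha> s" if "s \<in> I" for s unfolding h_def using the_inv_into_f_f[OF inj that] by simp
  obtain R where R: "Rplus_distribution R" "\<And>x. x \<in> X ` I \<Longrightarrow> npsi R x = h x"
  proof (rule empirical_limit[OF m(1,2), of "X ` I" h])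
    show "\<exists>x\<in>X ` I. h x < e" if "0 < e" for e using small[OF that] h by auto
  qed (use Xpos lim h in auto)
  interpret R: Rplus_distribution R by fact
  have npsiR: "npsi R (X s) = \<alpha> s" if "s \<in> I" for s using R(2) h that by auto
  have ncauR: "ncau R (X s) = s" if "s \<in> I" for s
    using R.ncau_eq[OF Xpos[OF that]] npsiR[OF that] I[OF that] by (simp add: X_def)
  \<comment> \<open>Otherwise some \<open>x1\<close> has \<open>ncau R x1 = s1\<close> outside
    \<open>I\<close>. Then \<open>X\<close> maps all of \<open>I\<close> below \<open>x1\<close>,
    which means \<open>\<alpha> s + s / x1 < 1\<close> on \<open>I\<close>. By continuity this
    expression takes the value 1 at some \<open>s \<le> s1\<close>; there \<open>\<alpha> s\<close>
    is still below 1, so the point belongs to \<open>I\<close> after all.\<close>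
  have inI: "s1 \<in> I" if s1: "0 < s1" "ennreal s1 < kappa R" for s1
  proof (rule ccontr)
    assume n: "s1 \<notin> I"
    obtain x1 where x1: "0 < x1" "ncau R x1 = s1" using R.ex_ncau_eq[OF s1] by blast
    have less: "s < s1" if "s \<in> I" for s using down[OF that s1(1)] n by (cases "s1 \<le> s") auto
    have less2: "\<alpha> s + s / x1 < 1" if "s \<in> I" for s
    proof -
      have "X s < x1" using R.ncau_less_iff[OF Xpos[OF that] x1(1)] ncauR[OF that] x1 less[OF that] by simp
      then have "s / x1 < 1 - \<alpha> s" using I[OF that] x1(1) by (simp add: X_def pos_divide_less_eq mult.commute)
      then show ?thesis by simp
    qed
    obtain s0 where s0: "s0 \<in> I" using small[of 1] by auto
    have "continuous_on {s0..s1} (\<lambda>s. \<alpha> s + s / x1)"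
      using I(1)[OF s0] x1 by (intro continuous_intros continuous_on_subset[OF cont]) auto
    moreover have "\<alpha> s0 + s0 / x1 \<le> 1" using less2[OF s0] by simp
    moreover have "1 \<le> \<alpha> s1 + s1 / x1"
      using n s1 x1 by (auto simp: I_def not_less intro: add_increasing2)
    ultimately obtain s where s: "s0 \<le> s" "s \<le> s1" "\<alpha> s + s / x1 = 1"
      using IVT'[of "\<lambda>s. \<alpha> s + s / x1" s0 1 s1] less[OF s0] by auto
    have sp: "0 < s" using s(1) I(1)[OF s0] by simp
    then have "0 < s / x1" using x1 by simp
    then have "s \<in> I" using s(3) sp by (auto simp: I_def)
    from less2[OF this] s(3) show False by simp
  qed
  have kR: "kappa R \<le> k" if k: "\<And>s. s \<in> I \<Longrightarrow> ennreal s < k" for k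
  proof (rule ccontr)
    assume "\<not> kappa R \<le> k"
    then obtain e where e: "k < e" "e < kappa R" using dense by (metis not_le)
    define s where "s = enn2real e"
    have es: "e = ennreal s" using e(2) by (simp add: s_def less_top[symmetric]) (metis ennreal_enn2real less_top top.extremum_strict)
    have "0 < s" using e(1) es by (metis ennreal_eq_0_iff not_less_zero not_le)
    then have "s \<in> I" using inI e(2) es by simp
    from k[OF this] e(1) es show False by simp
  qed
  show ?thesis
  proof (rule that[OF R(1)])
    show "kappa R \<le> min (kappa M) (kappa N)" using kR kap by simp
    fix s assume s: "0 < s" "ennreal s < kappa R"
    have sI: "s \<in> I" by (rule inI[OF s])
    have "R_transform R (- s) = - \<alpha> s"
      using R.R_transform_eq[OF Xpos[OF sI]] npsiR[OF sI] ncauR[OF sI] by simp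
    then show "R_transform R (- s) = R_transform M (- s) + R_transform N (- s)"
      using M.R_transform_tau[OF s(1) kap(1)[OF sI]] N.R_transform_tau[OF s(1) kap(2)[OF sI]]
      by (simp add: \<alpha>_def)
  qed
qed

text \<open>The characterization leaves \<open>kappa\<close> of the convolution open, so two
  candidates are compared on the smaller interval. For the measure with the smaller
  \<open>kappa\<close> every \<open>s = ncau R x\<close> falls into it, and
  \<open>x = s / (1 - npsi R x)\<close> recovers the argument from \<open>s\<close> and the value of
  R; hence \<open>npsi\<close> agrees everywhere.\<close>

lemma free_add_conv_unique:
  assumes "Rplus_distribution R" "Rplus_distribution R'"
    and "\<And>s. 0 < s \<Longrightarrow> ennreal s < kappa R \<Longrightarrow> R_transform R (- s) = f s"
    and "\<And>s. 0 < s \<Longrightarrow> ennreal s < kappa R' \<Longrightarrow> R_transform R' (- s) = f s"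
  shows "R = R'"
proof -
  have "R = R'" if RR: "Rplus_distribution R" "Rplus_distribution R'" "kappa R \<le> kappa R'"
    "\<And>s. 0 < s \<Longrightarrow> ennreal s < kappa R \<Longrightarrow> R_transform R (- s) = f s"
    "\<And>s. 0 < s \<Longrightarrow> ennreal s < kappa R' \<Longrightarrow> R_transform R' (- s) = f s" for R R'
  proof (rule npsi_unique[OF RR(1,2) zero_less_one])
    interpret R: Rplus_distribution R by fact
    interpret R': Rplus_distribution R' by fact
    fix x :: real assume x: "0 < x"
    define s where "s = ncau R x"
    have s: "0 < s" "ennreal s < kappa R" using R.ncau_pos[OF x] R.ncau_less_kappa[OF x] by (auto simp: s_def)
    then have s': "ennreal s < kappa R'" using RR(3) by simp
    then obtain y where y: "0 < y" "ncau R' y = s" using R'.ex_ncau_eq[OF s(1)] by blast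
    have "npsi R x = npsi R' y"
      using RR(4)[OF s] RR(5)[OF s(1) s'] R.R_transform_eq[OF x] R'.R_transform_eq[OF y(1)] y by (simp add: s_def)
    moreover have "1 - npsi R x \<noteq> 0" using R.npsi_less_1[OF x] by simp
    ultimately have "x = y" using R.ncau_eq[OF x] R'.ncau_eq[OF y(1)] y(2) s_def by simp
    with \<open>npsi R x = npsi R' y\<close> show "npsi R x = npsi R' x" by simp
  qed
  note main = this
  show ?thesis
  proof (cases "kappa R \<le> kappa R'")
    case True
    then show ?thesis by (rule main[OF assms(1,2) _ assms(3,4)])
  next
    case False
    then have "kappa R' \<le> kappa R" by simp
    then show ?thesis by (rule main[OF assms(2,1) _ assms(4,3), symmetric])
  qed
qed

lemma R_transform_return_0: "0 < s \<Longrightarrow> R_transform (return borel 0) (- s) = 0"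
  using Rplus_distribution.R_transform_eq[OF Rplus_distribution_return[OF order_refl], of s]
  by (simp add: ncau_return_0 npsi_return_0)

lemma kappa_return_0: "kappa (return borel 0) = \<infinity>"
  by (simp add: kappa_def nn_integral_return)

theorem free_add_conv:
  assumes M: "Rplus_distribution M" and N: "Rplus_distribution N"
  shows "Rplus_distribution (M \<boxplus> N)" "kappa (M \<boxplus> N) \<le> min (kappa M) (kappa N)"
    "\<And>s. 0 < s \<Longrightarrow> ennreal s < kappa (M \<boxplus> N) \<Longrightarrow>
      R_transform (M \<boxplus> N) (- s) = R_transform M (- s) + R_transform N (- s)"
proof -
  let ?P = "\<lambda>R. R \<in> prob_Rplus \<and> kappa R \<le> min (kappa M) (kappa N) \<and>
     (\<forall>t<0. ennreal (- t) < kappa R \<longrightarrow> R_transform R t = R_transform M t + R_transform N t)"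
  let ?Q = "\<lambda>R. Rplus_distribution R \<and> kappa R \<le> min (kappa M) (kappa N) \<and>
     (\<forall>s>0. ennreal s < kappa R \<longrightarrow> R_transform R (- s) = R_transform M (- s) + R_transform N (- s))"
  have PQ: "?P R \<longleftrightarrow> ?Q R" for R
  proof -
    have "(\<forall>t<0. ennreal (- t) < kappa R \<longrightarrow> R_transform R t = R_transform M t + R_transform N t) \<longleftrightarrow>
      (\<forall>s>0. ennreal s < kappa R \<longrightarrow> R_transform R (- s) = R_transform M (- s) + R_transform N (- s))" (is "?l \<longleftrightarrow> ?r")
    proof
      assume ?r
      show ?l
      proof (intro allI impI)
        fix t :: real assume "t < 0" "ennreal (- t) < kappa R"
        with \<open>?r\<close>[rule_format, of "- t"] show "R_transform R t = R_transform M t + R_transform N t" by simp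
      qed
    qed auto
    then show ?thesis by (simp add: prob_Rplus_iff)
  qed
  have "\<exists>R. ?Q R"
  \<comment> \<open>The profile method requires \<open>tau\<close> to be strictly increasing below
    \<open>kappa\<close>, which fails for \<delta>_0, whose R-transform is 0. Being the unit, it
    leaves the other measure as the convolution.\<close>
  proof (cases "M = return borel 0")
    case True
    then show ?thesis using N by (intro exI[of _ N]) (auto simp: kappa_return_0 R_transform_return_0)
  next
    case MF: False
    show ?thesis
    proof (cases "N = return borel 0")
      case True
      then show ?thesis using M by (intro exI[of _ M]) (auto simp: kappa_return_0 R_transform_return_0)
    next
      case False
      show ?thesis by (rule free_add_conv_exists[OF M MF N False]) blast
    qed
  qed
  moreover have "R = R'" if "?Q R" "?Q R'" for R R'
    using that by (intro free_add_conv_unique[of R R' "\<lambda>s. R_transform M (- s) + R_transform N (- s)"]) auto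
  ultimately have "\<exists>!R. ?P R" unfolding PQ by blast
  from theI'[OF this] have "?P (M \<boxplus> N)" unfolding free_add_conv_def .
  then have "?Q (M \<boxplus> N)" unfolding PQ .
  then show "Rplus_distribution (M \<boxplus> N)" "kappa (M \<boxplus> N) \<le> min (kappa M) (kappa N)"
    "\<And>s. 0 < s \<Longrightarrow> ennreal s < kappa (M \<boxplus> N) \<Longrightarrow>
      R_transform (M \<boxplus> N) (- s) = R_transform M (- s) + R_transform N (- s)" by auto
qed

lemma (in Rplus_distribution) S_transform_npsi:
  assumes "M \<noteq> return borel 0" "0 < t" "npsi M x = t" "0 < x"
  shows "S_transform M (- t) = x * (1 - t) / t"
  using S_transform_eq[OF assms(1,4)] ncau_eq[OF assms(4)] assms(3) by simp

text \<open>The value S(-t) = \<open>x * (1 - t) / t\<close> determines \<open>x\<close> from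
  \<open>t = npsi R x\<close>, so \<open>npsi\<close> agrees as long as its values stay below
  \<open>T\<close>. The level \<open>T / 2\<close> marks an interval of arguments where this holds,
  and a short interval fixes the measure.\<close>

lemma free_mult_conv_unique:
  assumes R: "Rplus_distribution R" "R \<noteq> return borel 0" "measure R {0} \<le> 1 - T"
    and R': "Rplus_distribution R'" "R' \<noteq> return borel 0" "measure R' {0} \<le> 1 - T"
    and T: "0 < T" and eq: "\<And>t. 0 < t \<Longrightarrow> t < T \<Longrightarrow> S_transform R (- t) = S_transform R' (- t)"
  shows "R = R'"
proof -
  interpret R: Rplus_distribution R by fact
  interpret R': Rplus_distribution R' by fact
  obtain x0 where x0: "0 < x0" "npsi R x0 = T / 2" using R.ex_npsi_eq[of "T / 2"] T R(3) by auto
  show ?thesis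
  proof (rule npsi_unique[OF R(1) R'(1) x0(1)])
    fix x assume x: "0 < x" "x < x0"
    define t where "t = npsi R x"
    have t: "0 < t" "t < T"
      using R.npsi_pos[OF R(2) x(1)] R.npsi_strict_mono[OF R(2) x] x0(2) T by (auto simp: t_def)
    then obtain y where y: "0 < y" "npsi R' y = t" using R'.ex_npsi_eq[of t] R'(3) by auto
    have "t < 1" using R.npsi_less_1[OF x(1)] by (simp add: t_def)
    moreover have "x * (1 - t) / t = y * (1 - t) / t"
      using eq[OF t] R.S_transform_npsi[OF R(2) t(1) t_def[symmetric] x(1)]
        R'.S_transform_npsi[OF R'(2) t(1) y(2,1)] by simp
    ultimately have "x = y" using t by simp
    then show "npsi R x = npsi R' x" using y t_def by simp
  qed
qed

theorem free_mult_conv: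
  assumes M: "Rplus_distribution M" "M \<noteq> return borel 0" and N: "Rplus_distribution N" "N \<noteq> return borel 0"
  shows "Rplus_distribution (M \<boxtimes> N)" "M \<boxtimes> N \<noteq> return borel 0"
    "measure (M \<boxtimes> N) {0} \<le> max (measure M {0}) (measure N {0})"
    "\<And>t. 0 < t \<Longrightarrow> t < 1 - max (measure M {0}) (measure N {0}) \<Longrightarrow>
      S_transform (M \<boxtimes> N) (- t) = S_transform M (- t) * S_transform N (- t)"
proof -
  define a where "a = max (measure M {0}) (measure N {0})"
  have a: "a < 1"
    using Rplus_distribution.mass_zero_less_1[OF M] Rplus_distribution.mass_zero_less_1[OF N] by (simp add: a_def)
  let ?P = "\<lambda>R. R \<in> prob_Rplus \<and> R \<noteq> return borel 0 \<and> measure R {0} \<le> a \<and>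
     (\<forall>t. -1 + a < t \<and> t < 0 \<longrightarrow> S_transform R t = S_transform M t * S_transform N t)"
  let ?Q = "\<lambda>R. Rplus_distribution R \<and> R \<noteq> return borel 0 \<and> measure R {0} \<le> a \<and>
     (\<forall>t. 0 < t \<and> t < 1 - a \<longrightarrow> S_transform R (- t) = S_transform M (- t) * S_transform N (- t))"
  have PQ: "?P R \<longleftrightarrow> ?Q R" for R
  proof -
    have "(\<forall>t. -1 + a < t \<and> t < 0 \<longrightarrow> S_transform R t = S_transform M t * S_transform N t) \<longleftrightarrow>
      (\<forall>t. 0 < t \<and> t < 1 - a \<longrightarrow> S_transform R (- t) = S_transform M (- t) * S_transform N (- t))" (is "?l \<longleftrightarrow> ?r")
    proof
      assume ?r
      show ?l
      proof (intro allI impI)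
        fix t assume "-1 + a < t \<and> t < 0"
        with \<open>?r\<close>[rule_format, of "- t"] show "S_transform R t = S_transform M t * S_transform N t" by simp
      qed
    qed auto
    then show ?thesis by (simp add: prob_Rplus_iff)
  qed
  have "\<exists>R. ?Q R"
    by (rule free_mult_conv_exists[OF M N]) (auto simp: a_def)
  moreover have "R = R'" if "?Q R" "?Q R'" for R R'
    using that a by (intro free_mult_conv_unique[of R "1 - a" R']) auto
  ultimately have "\<exists>!R. ?P R" unfolding PQ by blast
  from theI'[OF this] have "?P (M \<boxtimes> N)" unfolding free_mult_conv_def a_def using M N by simp
  then have "?Q (M \<boxtimes> N)" unfolding PQ .
  then show "Rplus_distribution (M \<boxtimes> N)" "M \<boxtimes> N \<noteq> return borel 0"
    "measure (M \<boxtimes> N) {0} \<le> max (measure M {0}) (measure N {0})"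
    "\<And>t. 0 < t \<Longrightarrow> t < 1 - max (measure M {0}) (measure N {0}) \<Longrightarrow>
      S_transform (M \<boxtimes> N) (- t) = S_transform M (- t) * S_transform N (- t)"
    by (auto simp: a_def)
qed

section \<open>The inverse Marchenko--Pastur law\<close>

text \<open>The substitution \<open>v = sqrt ((4 - y) / y)\<close> makes all integrands below rational in \<open>v\<close>.\<close>

context
  fixes y :: real assumes y: "0 < y" "y < 4"
begin

lemma mp_sqrt: "sqrt (y * (4 - y)) = y * sqrt ((4 - y) / y)"
proof -
  have "y * (4 - y) = y\<^sup>2 * ((4 - y) / y)" using y by (simp add: power2_eq_square)
  then have "sqrt (y * (4 - y)) = sqrt (y\<^sup>2) * sqrt ((4 - y) / y)" by (metis real_sqrt_mult)
  then show ?thesis using y by (simp only: real_sqrt_abs abs_of_pos)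
qed

lemma mp_root: "0 < sqrt ((4 - y) / y)" "(sqrt ((4 - y) / y))\<^sup>2 = (4 - y) / y"
proof -
  have "0 < (4 - y) / y" using y by (intro divide_pos_pos) auto
  then show "0 < sqrt ((4 - y) / y)" "(sqrt ((4 - y) / y))\<^sup>2 = (4 - y) / y"
    by (simp_all only: real_sqrt_gt_zero real_sqrt_pow2 less_imp_le)
qed

lemma DERIV_mp_root: "((\<lambda>y. sqrt ((4 - y) / y)) has_real_derivative - 2 / (y\<^sup>2 * sqrt ((4 - y) / y))) (at y)"
proof -
  have "((\<lambda>y. (4 - y) / y) has_real_derivative ((- 1) * y - (4 - y) * 1) / (y * y)) (at y)"
    using y by (intro derivative_eq_intros) auto
  moreover have "0 < (4 - y) / y" using y by (intro divide_pos_pos) auto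
  ultimately have "((\<lambda>y. sqrt ((4 - y) / y)) has_real_derivative
      inverse (sqrt ((4 - y) / y)) / 2 * (((- 1) * y - (4 - y) * 1) / (y * y))) (at y)"
    by (intro DERIV_chain2[OF DERIV_real_sqrt])
  also have "inverse v / 2 * (((- 1) * y - (4 - y) * 1) / (y * y)) = - 2 / (y\<^sup>2 * v)" for v
  proof -
    have "((- 1) * y - (4 - y) * 1) = - 4" by simp
    then show ?thesis by (simp add: power2_eq_square inverse_eq_divide mult_ac)
  qed
  finally show ?thesis .
qed

text \<open>The square of the root \<open>v\<close> is \<open>(4 - y) / y\<close>, so
  \<open>y * (1 + k\<^sup>2 * v\<^sup>2)\<close> is linear in \<open>y\<close>. For
  \<open>k = 1\<close> it is the constant 4; for \<open>k\<^sup>2 = x / (x + 4)\<close> it is a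
  multiple of \<open>y + x\<close>, the denominator in the Stieltjes integral.\<close>

lemma DERIV_mp_arctan:
  "((\<lambda>y. arctan (k * sqrt ((4 - y) / y))) has_real_derivative
    (- 2 * k / (y * sqrt ((4 - y) / y))) / (y + k\<^sup>2 * (4 - y))) (at y)"
proof -
  define v where "v = sqrt ((4 - y) / y)"
  have v: "0 < v" "v\<^sup>2 = (4 - y) / y" unfolding v_def by (rule mp_root)+
  have "((\<lambda>y. arctan (k * sqrt ((4 - y) / y))) has_real_derivative
     inverse (1 + (k * v)\<^sup>2) * (k * (- 2 / (y\<^sup>2 * v)))) (at y)"
    unfolding v_def by (rule DERIV_chain2[OF DERIV_arctan DERIV_cmult[OF DERIV_mp_root]])
  also have "1 + (k * v)\<^sup>2 = (y + k\<^sup>2 * (4 - y)) / y"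
    using y by (simp add: power_mult_distrib v(2) add_divide_distrib)
  also have "inverse ((y + k\<^sup>2 * (4 - y)) / y) * (k * (- 2 / (y\<^sup>2 * v))) = (- 2 * k / (y * v)) / (y + k\<^sup>2 * (4 - y))"
    using y v by (simp add: power2_eq_square mult_ac)
  finally show ?thesis unfolding v_def .
qed

end

definition mp_dens :: "real \<Rightarrow> real" where
  "mp_dens y = sqrt (y * (4 - y)) / (2 * pi * y) * indicator {0<..<4} y"

lemma mp_dens_nonneg: "0 \<le> mp_dens y"
  by (auto simp: mp_dens_def indicator_def)

lemma borel_measurable_mp_dens [measurable]: "mp_dens \<in> borel_measurable borel"
  unfolding mp_dens_def by measurable

lemma mp_dens_eq: "0 < y \<Longrightarrow> y < 4 \<Longrightarrow> mp_dens y = sqrt ((4 - y) / y) / (2 * pi)"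
  by (simp add: mp_dens_def mp_sqrt)

lemma marchenko_pastur_eq: "marchenko_pastur = density lborel (\<lambda>y. ennreal (mp_dens y))"
  by (simp add: marchenko_pastur_def mp_dens_def)

lemma mp_arctan_tendsto:
  assumes "0 < k"
  shows "((\<lambda>y. arctan (k * sqrt ((4 - y) / y))) \<longlongrightarrow> pi / 2) (at_right 0)"
    "((\<lambda>y. arctan (k * sqrt ((4 - y) / y))) \<longlongrightarrow> 0) (at_left 4)"
proof -
  have num: "((\<lambda>y::real. 4 - y) \<longlongrightarrow> 4 - 0) (at_right 0)" by (intro tendsto_intros)
  have "filterlim (\<lambda>y::real. inverse y) at_top (at_right 0)" by (rule filterlim_inverse_at_top_right)
  then have "filterlim (\<lambda>y::real. (4 - y) * inverse y) at_top (at_right 0)"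
    using num by (intro filterlim_tendsto_pos_mult_at_top[OF num]) auto
  then have "filterlim (\<lambda>y::real. (4 - y) / y) at_top (at_right 0)" by (simp only: divide_inverse)
  then have "filterlim (\<lambda>y. sqrt ((4 - y) / y)) at_top (at_right 0)"
    by (rule filterlim_compose[OF sqrt_at_top])
  then have "filterlim (\<lambda>y. k * sqrt ((4 - y) / y)) at_top (at_right 0)"
    using assms by (intro filterlim_tendsto_pos_mult_at_top[OF tendsto_const])
  then show "((\<lambda>y. arctan (k * sqrt ((4 - y) / y))) \<longlongrightarrow> pi / 2) (at_right 0)"
    by (rule filterlim_compose[OF tendsto_arctan_at_top])
  have "((\<lambda>y. arctan (k * sqrt ((4 - y) / y))) \<longlongrightarrow> arctan (k * sqrt ((4 - 4) / 4))) (at_left 4)"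
    by (intro tendsto_intros) auto
  then show "((\<lambda>y. arctan (k * sqrt ((4 - y) / y))) \<longlongrightarrow> 0) (at_left 4)" by simp
qed

text \<open>The root blows up at 0, so the end values of the antiderivative enter as one-sided
  limits; a nonnegative integrand makes the improper integral a Lebesgue integral.\<close>

lemma mp_FTC:
  assumes F: "\<And>y. 0 < y \<Longrightarrow> y < 4 \<Longrightarrow> (F has_real_derivative f y) (at y)"
    and f: "continuous_on {0<..<4} f" "\<And>y. 0 < y \<Longrightarrow> y < 4 \<Longrightarrow> 0 \<le> f y"
    and A: "(F \<longlongrightarrow> A) (at_right 0)" and B: "(F \<longlongrightarrow> B) (at_left 4)"
  shows "integrable lborel (\<lambda>y. indicator {0<..<4} y * f y)"
    "(\<integral>y. indicator {0<..<4} y * f y \<partial>lborel) = B - A"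
proof -
  have z: "(0::ereal) = ereal 0" "(4::ereal) = ereal 4" by (simp_all add: zero_ereal_def)
  have "set_integrable lborel (einterval (ereal 0) (ereal 4)) f \<and> (LBINT y=ereal 0..ereal 4. f y) = B - A"
  proof (intro conjI; rule interval_integral_FTC_nonneg[of "ereal 0" "ereal 4" F f A B])
    show "((F \<circ> real_of_ereal) \<longlongrightarrow> A) (at_right (ereal 0))"
      "((F \<circ> real_of_ereal) \<longlongrightarrow> A) (at_right (ereal 0))"
      using A by (simp_all add: ereal_tendsto_simps)
    show "((F \<circ> real_of_ereal) \<longlongrightarrow> B) (at_left (ereal 4))"
      "((F \<circ> real_of_ereal) \<longlongrightarrow> B) (at_left (ereal 4))"
      using B by (simp_all add: ereal_tendsto_simps)
  qed (use F f continuous_on_eq_continuous_at[of "{0<..<4::real}" f] in auto)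
  then have *: "set_integrable lborel {0<..<4} f" "(LBINT y:{0<..<4}. f y) = B - A"
    by (auto simp: interval_lebesgue_integral_le_eq)
  then show "integrable lborel (\<lambda>y. indicator {0<..<4} y * f y)"
    "(\<integral>y. indicator {0<..<4} y * f y \<partial>lborel) = B - A"
    by (auto simp: set_integrable_def set_lebesgue_integral_def)
qed

lemma mp_total_mass: "integrable lborel mp_dens" "(\<integral>y. mp_dens y \<partial>lborel) = 1"
proof -
  \<comment> \<open>With \<open>v = sqrt ((4 - y) / y)\<close>, the square root contributes
    \<open>(2 - y) / (y * v)\<close> to the derivative and the arctangent the missing
    \<open>2 / (y * v)\<close>; their sum is \<open>v\<close>.\<close>
  define F where "F y = (sqrt (y * (4 - y)) - 4 * arctan (1 * sqrt ((4 - y) / y))) / (2 * pi)" for y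
  have e: "indicator {0<..<4} y * (sqrt ((4 - y) / y) / (2 * pi)) = mp_dens y" for y
    by (cases "0 < y \<and> y < 4") (auto simp: mp_dens_eq, auto simp: mp_dens_def)
  have D: "(F has_real_derivative sqrt ((4 - y) / y) / (2 * pi)) (at y)" if y: "0 < y" "y < 4" for y
  proof -
    define v where "v = sqrt ((4 - y) / y)"
    have v: "0 < v" "v\<^sup>2 = (4 - y) / y" unfolding v_def by (rule mp_root[OF y])+
    have "((\<lambda>y. y * (4 - y)) has_real_derivative (4 - 2 * y)) (at y)"
      by (auto intro!: derivative_eq_intros)
    from DERIV_chain2[OF DERIV_real_sqrt this] y
    have *: "((\<lambda>y. sqrt (y * (4 - y))) has_real_derivative inverse (sqrt (y * (4 - y))) / 2 * (4 - 2 * y)) (at y)" by simp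
    have 1: "((\<lambda>y. sqrt (y * (4 - y))) has_real_derivative (2 - y) / (y * v)) (at y)"
    proof -
      have "inverse (sqrt (y * (4 - y))) / 2 * (4 - 2 * y) = inverse (y * v) / 2 * (2 * (2 - y))"
        unfolding mp_sqrt[OF y] v_def[symmetric] by simp
      also have "\<dots> = (2 - y) / (y * v)"
      proof -
        have "inverse a / 2 * (2 * b) = b / a" for a b :: real by (simp add: inverse_eq_divide)
        then show ?thesis by this
      qed
      finally have E: "inverse (sqrt (y * (4 - y))) / 2 * (4 - 2 * y) = (2 - y) / (y * v)" .
      show ?thesis using * unfolding E .
    qed
    have 2: "((\<lambda>y. arctan (1 * sqrt ((4 - y) / y))) has_real_derivative - 2 * 1 / (y * v) / (y + 1\<^sup>2 * (4 - y))) (at y)"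
      unfolding v_def by (rule DERIV_mp_arctan[OF y])
    have "(F has_real_derivative ((2 - y) / (y * v) - 4 * (- 2 * 1 / (y * v) / (y + 1\<^sup>2 * (4 - y)))) / (2 * pi)) (at y)"
      unfolding F_def by (intro DERIV_cdivide DERIV_diff DERIV_cmult 1 2)
    also have "(2 - y) / (y * v) - 4 * (- 2 * 1 / (y * v) / (y + 1\<^sup>2 * (4 - y))) = v"
    proof -
      have "(2 - y) / (y * v) - 4 * (- 2 * 1 / (y * v) / (y + 1\<^sup>2 * (4 - y))) = (4 - y) / y / v"
      proof -
        have "(2 - y) / (y * v) - 4 * (- 2 * 1 / (y * v) / (y + 1\<^sup>2 * (4 - y))) = (2 - y) / (y * v) + 2 / (y * v)" by simp
        also have "\<dots> = (4 - y) / (y * v)" by (simp only: add_divide_distrib[symmetric]) simp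
        finally show ?thesis by simp
      qed
      also have "\<dots> = v" unfolding v(2)[symmetric] using v(1) by (simp add: power2_eq_square)
      finally show ?thesis .
    qed
    finally show ?thesis unfolding v_def .
  qed
  have cont: "continuous_on {0<..<4} (\<lambda>y. sqrt ((4 - y) / y) / (2 * pi))"
    by (intro continuous_intros) auto
  have A: "(F \<longlongrightarrow> (sqrt (0 * (4 - 0)) - 4 * (pi / 2)) / (2 * pi)) (at_right 0)"
    unfolding F_def by (intro tendsto_intros mp_arctan_tendsto) auto
  have B: "(F \<longlongrightarrow> (sqrt (4 * (4 - 4)) - 4 * 0) / (2 * pi)) (at_left 4)"
    unfolding F_def by (intro tendsto_intros mp_arctan_tendsto) auto
  note ftc = mp_FTC[OF D cont _ A B, unfolded e]
  show "integrable lborel mp_dens" by (rule ftc(1)) auto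
  show "(\<integral>y. mp_dens y \<partial>lborel) = 1" by (subst ftc(2)) auto
qed

text \<open>Since \<open>1 / y * x / (1 + 1 / y * x) = x / (y + x)\<close>, this integral is
  \<open>npsi\<close> of the inverse law.\<close>

lemma mp_stieltjes:
  assumes x: "0 < x"
  shows "(\<integral>y. mp_dens y * (x / (y + x)) \<partial>lborel) = x / 2 * (sqrt (1 + 4 / x) - 1)"
proof -
  define q where "q = sqrt (1 + 4 / x)"
  have q: "0 < q" "q\<^sup>2 = (x + 4) / x" using x by (auto simp: q_def add_pos_pos add_divide_distrib)
  \<comment> \<open>Partial fractions in \<open>v\<close>: the integrand splits into the derivatives
    of two arctangents, with \<open>k = 1\<close> and \<open>k = 1 / q\<close>.\<close>
  define F where "F y = x / (2 * pi) * (2 * arctan (1 * sqrt ((4 - y) / y)) - 2 * q * arctan (1 / q * sqrt ((4 - y) / y)))" for y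
  define f where "f y = sqrt ((4 - y) / y) / (2 * pi) * (x / (y + x))" for y
  have e: "indicator {0<..<4} y * f y = mp_dens y * (x / (y + x))" for y
    by (cases "0 < y \<and> y < 4") (auto simp: mp_dens_eq f_def, auto simp: mp_dens_def)
  have D: "(F has_real_derivative f y) (at y)" if y: "0 < y" "y < 4" for y
  proof -
    define v where "v = sqrt ((4 - y) / y)"
    have v: "0 < v" "v\<^sup>2 = (4 - y) / y" unfolding v_def by (rule mp_root[OF y])+
    have 1: "((\<lambda>y. arctan (k * sqrt ((4 - y) / y))) has_real_derivative - 2 * k / (y * v) / (y + k\<^sup>2 * (4 - y))) (at y)" for k
      unfolding v_def by (rule DERIV_mp_arctan[OF y])
    have "(F has_real_derivative x / (2 * pi) * (2 * (- 2 * 1 / (y * v) / (y + 1\<^sup>2 * (4 - y)))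
        - 2 * q * (- 2 * (1 / q) / (y * v) / (y + (1 / q)\<^sup>2 * (4 - y))))) (at y)"
      unfolding F_def by (intro DERIV_cmult DERIV_diff 1)
    also have "(1 / q)\<^sup>2 = x / (x + 4)" by (simp add: power_divide q(2))
    also have "y + x / (x + 4) * (4 - y) = 4 * (y + x) / (x + 4)" using x by (simp add: field_simps)
    also have "2 * (- 2 * 1 / (y * v) / (y + 1\<^sup>2 * (4 - y))) - 2 * q * (- 2 * (1 / q) / (y * v) / (4 * (y + x) / (x + 4)))
        = (4 - y) / y / v / (y + x)"
    proof -
      have "2 * q * (- 2 * (1 / q) / (y * v) / (4 * (y + x) / (x + 4))) = - ((x + 4) / (y * v * (y + x)))"
      proof -
        have *: "2 * q * (- 2 * (1 / q) / a / (4 * b / c)) = - (c / (a * b))" if "a \<noteq> 0" "b \<noteq> 0" "c \<noteq> 0" for a b c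
          using that q(1) by (simp add: field_simps)
        show ?thesis by (rule *) (use x y v in auto)
      qed
      moreover have "2 * (- 2 * 1 / (y * v) / (y + 1\<^sup>2 * (4 - y))) = - ((y + x) / (y * v * (y + x)))"
      proof -
        have *: "2 * (- 2 * 1 / a / (y + 1\<^sup>2 * (4 - y))) = - (b / (a * b))" if "b \<noteq> 0" for a b :: real
          using that by simp
        show ?thesis by (rule *) (use x y in auto)
      qed
      ultimately have "2 * (- 2 * 1 / (y * v) / (y + 1\<^sup>2 * (4 - y))) - 2 * q * (- 2 * (1 / q) / (y * v) / (4 * (y + x) / (x + 4)))
        = (x + 4) / (y * v * (y + x)) - (y + x) / (y * v * (y + x))" by simp
      also have "\<dots> = ((x + 4) - (y + x)) / (y * v * (y + x))" by (rule diff_divide_distrib[symmetric])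
      also have "(x + 4) - (y + x) = 4 - y" by simp
      finally show ?thesis by simp
    qed
    also have "(4 - y) / y / v = v" unfolding v(2)[symmetric] using v(1) by (simp add: power2_eq_square)
    also have "x / (2 * pi) * (v / (y + x)) = f y" by (simp add: f_def v_def)
    finally show ?thesis .
  qed
  have cont: "continuous_on {0<..<4} f"
    unfolding f_def using x by (intro continuous_intros) auto
  have nn: "0 \<le> f y" if "0 < y" "y < 4" for y using that x by (simp add: f_def)
  have A: "(F \<longlongrightarrow> x / (2 * pi) * (2 * (pi / 2) - 2 * q * (pi / 2))) (at_right 0)"
    unfolding F_def using q by (intro tendsto_mult tendsto_diff tendsto_const mp_arctan_tendsto) auto
  have B: "(F \<longlongrightarrow> x / (2 * pi) * (2 * 0 - 2 * q * 0)) (at_left 4)"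
    unfolding F_def using q by (intro tendsto_mult tendsto_diff tendsto_const mp_arctan_tendsto) auto
  have "(\<integral>y. mp_dens y * (x / (y + x)) \<partial>lborel) = x / (2 * pi) * (2 * 0 - 2 * q * 0) - x / (2 * pi) * (2 * (pi / 2) - 2 * q * (pi / 2))"
    using mp_FTC(2)[OF D cont nn A B] unfolding e .
  also have "\<dots> = x / 2 * (q - 1)" by (simp add: field_simps)
  finally show ?thesis unfolding q_def .
qed

lemma prob_space_marchenko_pastur: "prob_space marchenko_pastur"
proof
  have "emeasure marchenko_pastur (space marchenko_pastur) = (\<integral>\<^sup>+y. ennreal (mp_dens y) \<partial>lborel)"
    by (simp add: marchenko_pastur_eq emeasure_density)
  also have "\<dots> = ennreal (\<integral>y. mp_dens y \<partial>lborel)"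
    by (intro nn_integral_eq_integral mp_total_mass) (simp add: mp_dens_nonneg)
  finally show "emeasure marchenko_pastur (space marchenko_pastur) = 1" by (simp add: mp_total_mass)
qed

abbreviation inverse_mp :: "real measure" where
  "inverse_mp \<equiv> measure_powr marchenko_pastur (-1)"

lemma AE_marchenko_pastur: "AE y in marchenko_pastur. 0 < y \<and> y < 4"
  unfolding marchenko_pastur_eq by (subst AE_density) (auto simp: mp_dens_def indicator_def)

lemma sets_marchenko_pastur [simp, measurable_cong]: "sets marchenko_pastur = sets borel"
  by (simp add: marchenko_pastur_eq)

lemma space_marchenko_pastur [simp]: "space marchenko_pastur = UNIV"
  by (simp add: marchenko_pastur_eq)

lemma Rplus_distribution_inverse_mp: "Rplus_distribution inverse_mp"
proof -
  interpret prob_space marchenko_pastur by (rule prob_space_marchenko_pastur)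
  interpret P: real_distribution inverse_mp
    unfolding measure_powr_def by (rule real_distribution_distr) measurable
  have "\<not> y powr -1 < 0" for y :: real using powr_ge_zero[of y "-1"] by linarith
  then have "(\<lambda>y::real. y powr -1) -` {..<0} = {}" by blast
  then have "emeasure inverse_mp {..<0} = emeasure marchenko_pastur {}"
    unfolding measure_powr_def by (subst emeasure_distr) (simp_all only: sets_marchenko_pastur Int_empty_left, auto)
  then show ?thesis by unfold_locales simp
qed

lemma npsi_inverse_mp: assumes x: "0 < x" shows "npsi inverse_mp x = x / 2 * (sqrt (1 + 4 / x) - 1)"
proof -
  have "npsi inverse_mp x = (\<integral>y. (y powr -1) * x / (1 + (y powr -1) * x) \<partial>marchenko_pastur)"
    unfolding npsi_def measure_powr_def by (rule integral_distr) measurable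
  also have "\<dots> = (\<integral>y. x / (y + x) \<partial>marchenko_pastur)"
  proof (rule integral_cong_AE)
    show "AE y in marchenko_pastur. (y powr -1) * x / (1 + (y powr -1) * x) = x / (y + x)"
      using AE_marchenko_pastur
    proof eventually_elim
      case (elim y)
      then have "y powr -1 = 1 / y" by (simp add: powr_minus_divide)
      moreover have "1 / y * x / (1 + 1 / y * x) = x / (y + x)" using elim x by (simp add: divide_simps)
      ultimately show ?case by simp
    qed
  qed measurable
  also have "\<dots> = (\<integral>y. mp_dens y * (x / (y + x)) \<partial>lborel)"
    unfolding marchenko_pastur_eq by (subst integral_density) (auto simp: mp_dens_nonneg)
  also have "\<dots> = x / 2 * (sqrt (1 + 4 / x) - 1)" by (rule mp_stieltjes[OF x])
  finally show ?thesis .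
qed

lemma npsi_inverse_mp_pos: assumes "0 < x" shows "0 < npsi inverse_mp x"
proof -
  have "1 < sqrt (1 + 4 / x)" using assms by simp
  then show ?thesis using assms by (simp add: npsi_inverse_mp)
qed

lemma inverse_mp_ne: "inverse_mp \<noteq> return borel 0"
  using npsi_inverse_mp_pos[of 1] npsi_return_0[of 1] by auto

lemma mass_zero_inverse_mp: "measure inverse_mp {0} = 0"
proof -
  have "emeasure inverse_mp {0} = emeasure marchenko_pastur ((\<lambda>y. y powr -1) -` {0} \<inter> space marchenko_pastur)"
    unfolding measure_powr_def by (rule emeasure_distr) auto
  also have "(\<lambda>y. y powr -1) -` {0} = {0::real}" by (auto simp: powr_eq_0_iff)
  also have "emeasure marchenko_pastur ({0} \<inter> space marchenko_pastur) = 0"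
  proof -
    have "AE y in marchenko_pastur. y \<notin> {0} \<inter> space marchenko_pastur"
      using AE_marchenko_pastur by eventually_elim auto
    then show ?thesis by (subst (asm) AE_iff_measurable[of "{0} \<inter> space marchenko_pastur"]) auto
  qed
  finally show ?thesis by (simp add: measure_def)
qed

lemma S_transform_inverse_mp:
  assumes t: "0 < t" "t < 1" shows "S_transform inverse_mp (- t) = t"
proof -
  interpret Rplus_distribution inverse_mp by (rule Rplus_distribution_inverse_mp)
  obtain x where x: "0 < x" "npsi inverse_mp x = t"
    using ex_npsi_eq[of t] t mass_zero_inverse_mp by auto
  define q where "q = sqrt (1 + 4 / x)"
  have q: "q\<^sup>2 = 1 + 4 / x" using x by (simp add: q_def)
  have tq: "t = x / 2 * (q - 1)" using npsi_inverse_mp[OF x(1)] x by (simp add: q_def)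
  \<comment> \<open>Eliminating the square root leaves \<open>x * (1 - t) = t\<^sup>2\<close>, and
    S(-t) = \<open>x * (1 - t) / t\<close> becomes \<open>t\<close>.\<close>
  have "t * (t + x) = x\<^sup>2 / 4 * (q\<^sup>2 - 1)" unfolding tq by (simp add: power2_eq_square field_simps)
  also have "\<dots> = x" unfolding q using x by (simp add: power2_eq_square)
  finally have "x * (1 - t) = t\<^sup>2" by (simp add: power2_eq_square algebra_simps)
  then have "ncau inverse_mp x = t\<^sup>2" using ncau_eq[OF x(1)] x by simp
  then show ?thesis using S_transform_eq[OF inverse_mp_ne x(1)] x t by (simp add: power2_eq_square)
qed

section \<open>The law of large numbers and the homomorphism\<close>

text \<open>For \<open>y > 0\<close> this is \<open>1 - tau M (1 / y)\<close>. Written as a product,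
  the constraint also makes sense at \<open>y = 0\<close>, where it is void; for a law on the
  half-line the value there is the mass of \<open>M\<close> at 0.\<close>

definition theta_cdf :: "real measure \<Rightarrow> real \<Rightarrow> real" where
  "theta_cdf M y = (if y < 0 then 0 else 1 - (SUP x\<in>{x. 0 < x \<and> y * ncau M x \<le> 1}. npsi M x))"

lemma cdf_Rplus_neg: assumes "Rplus_distribution M" "y < 0" shows "cdf M y = 0"
proof -
  interpret Rplus_distribution M by fact
  have "emeasure M {..y} \<le> emeasure M {..<0}" using assms by (intro emeasure_mono) auto
  then show ?thesis by (simp add: negligible_neg cdf_def measure_def)
qed

context Rplus_distribution
begin

lemma cdf_eq_integral: "cdf M w = (\<integral>u. indicator {..w} u \<partial>M)"
  by (simp add: cdf_def)

lemma one_minus_npsi: assumes "0 < z" shows "1 - npsi M z = (\<integral>u. 1 / (1 + u * z) \<partial>M)"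
proof -
  have "ncau M z = z * (\<integral>u. 1 / (1 + u * z) \<partial>M)"
    unfolding ncau_def by (subst integral_mult_right_zero[symmetric]) simp
  then show ?thesis using ncau_eq[OF assms] assms by simp
qed

text \<open>\<open>1 - npsi M z\<close> is the mean of \<open>1 / (1 + u * z)\<close>, a smoothed
  indicator of \<open>u \<le> 1 / z\<close>. For \<open>u \<le> w\<close> this is at least
  \<open>1 / (1 + z * w)\<close>. The bound is sharp when \<open>z * w\<close> tends to 0;
  \<open>npsi_le_cdf\<close> serves the opposite case of \<open>z * w\<close> tending to
  infinity.\<close>

lemma cdf_le_npsi:
  assumes "0 < z" "0 \<le> w" shows "cdf M w \<le> (1 + z * w) * (1 - npsi M z)"
proof -
  have "cdf M w \<le> (\<integral>u. (1 + z * w) * (1 / (1 + u * z)) \<partial>M)"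
    unfolding cdf_eq_integral
  proof (rule integral_mono_AE)
    show "AE u in M. indicator {..w} u \<le> (1 + z * w) * (1 / (1 + u * z))"
      using AE_nonneg
    proof eventually_elim
      case (elim u)
      have p: "0 < 1 + u * z" using elim assms by (intro one_plus_mult_pos)
      have "u * z \<le> z * w" if "u \<le> w" using that assms mult_left_mono[of u w z] by (simp add: mult.commute)
      then show ?case using p assms by (auto simp: indicator_def)
    qed
    show "integrable M (indicator {..w} :: real \<Rightarrow> real)"
      by (intro integrable_real_indicator) (auto simp: emeasure_finite less_top[symmetric])
    show "integrable M (\<lambda>u. (1 + z * w) * (1 / (1 + u * z)))"
      by (intro integrable_mult_right integrable_inverse_linear assms)
  qed
  also have "\<dots> = (1 + z * w) * (1 - npsi M z)"
    unfolding one_minus_npsi[OF assms(1)] by (rule integral_mult_right_zero)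
  finally show ?thesis .
qed

lemma npsi_le_cdf:
  assumes "0 < z" "0 \<le> w" shows "1 - npsi M z \<le> cdf M w + 1 / (1 + z * w)"
proof -
  have "1 - npsi M z \<le> (\<integral>u. indicator {..w} u + 1 / (1 + z * w) \<partial>M)"
    unfolding one_minus_npsi[OF assms(1)]
  proof (rule integral_mono_AE)
    have w: "0 \<le> 1 / (1 + z * w)" using assms by simp
    show "AE u in M. 1 / (1 + u * z) \<le> indicator {..w} u + 1 / (1 + z * w)"
      using AE_nonneg
    proof eventually_elim
      case (elim u)
      show ?case
      proof (cases "u \<le> w")
        case True
        then have "indicator {..w} u = (1::real)" by simp
        then show ?thesis using mult_div_one_plus_bounds(5)[OF elim assms(1)] w by linarith
      next
        case False
        then have "z * w \<le> u * z" using assms mult_left_mono[of w u z] by (simp add: mult.commute)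
        then have "1 / (1 + u * z) \<le> 1 / (1 + z * w)" using assms by (intro divide_left_mono) (auto intro!: mult_pos_pos add_pos_nonneg)
        then show ?thesis using False by simp
      qed
    qed
    show "integrable M (\<lambda>u. 1 / (1 + u * z))" by (intro integrable_inverse_linear assms)
    show "integrable M (\<lambda>u. indicator {..w} u + 1 / (1 + z * w))"
      by (intro Bochner_Integration.integrable_add integrable_real_indicator integrable_const)
         (auto simp: emeasure_finite less_top[symmetric])
  qed
  also have "\<dots> = cdf M w + 1 / (1 + z * w)"
    unfolding cdf_eq_integral using prob_space
    by (subst Bochner_Integration.integral_add) (auto simp: emeasure_finite less_top[symmetric])
  finally show ?thesis .
qed

lemma cdf_root:
  assumes "0 < n" "0 \<le> y" shows "cdf (measure_powr M (1 / real n)) y = cdf M (y ^ n)"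
proof -
  have "cdf (measure_powr M (1 / real n)) y = measure M ((\<lambda>u. u powr (1 / real n)) -` {..y} \<inter> space M)"
    unfolding cdf_def measure_powr_def by (subst measure_distr) auto
  also have "\<dots> = measure M {..y ^ n}"
  proof (rule finite_measure_eq_AE)
    show "AE u in M. (u \<in> (\<lambda>u. u powr (1 / real n)) -` {..y} \<inter> space M) = (u \<in> {..y ^ n})"
      using AE_nonneg
    proof eventually_elim
      case (elim u)
      have "u powr (1 / real n) \<le> y \<longleftrightarrow> u \<le> y ^ n"
      proof
        assume "u powr (1 / real n) \<le> y"
        then have "(u powr (1 / real n)) ^ n \<le> y ^ n" by (intro power_mono) auto
        moreover have "(u powr (1 / real n)) ^ n = u" using elim assms by (cases "u = 0") (auto simp: powr_powr simp flip: powr_realpow)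
        ultimately show "u \<le> y ^ n" by simp
      next
        assume "u \<le> y ^ n"
        then have "u powr (1 / real n) \<le> (y ^ n) powr (1 / real n)" using elim by (intro powr_mono2) auto
        also have "\<dots> = y" using assms by (cases "y = 0") (auto simp: powr_powr simp flip: powr_realpow)
        finally show "u powr (1 / real n) \<le> y" .
      qed
      then show ?case by simp
    qed
    show "(\<lambda>u. u powr (1 / real n)) -` {..y} \<inter> space M \<in> sets M"
      by (rule measurable_sets[of _ M borel]) auto
  qed simp
  finally show ?thesis by (simp add: cdf_def)
qed

lemma theta_cdf_le: assumes "0 < x" "0 \<le> y" "y * ncau M x \<le> 1" shows "theta_cdf M y \<le> 1 - npsi M x"
proof -
  have "npsi M x \<le> (SUP x\<in>{x. 0 < x \<and> y * ncau M x \<le> 1}. npsi M x)"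
    using assms by (intro cSUP_upper) (auto intro!: bdd_aboveI[of _ 1] less_imp_le npsi_less_1)
  then show ?thesis using assms by (simp add: theta_cdf_def)
qed

lemma theta_set_nonempty: assumes "0 \<le> y" shows "{x. 0 < x \<and> y * ncau M x \<le> 1} \<noteq> {}"
proof -
  define x where "x = 1 / (y + 1)"
  have x: "0 < x" using assms by (simp add: x_def)
  have "y * ncau M x \<le> y * x" using ncau_le[OF x] assms by (intro mult_left_mono)
  also have "\<dots> \<le> 1" using assms by (simp add: x_def)
  finally show ?thesis using x by auto
qed

lemma theta_cdf_ge:
  assumes "0 \<le> y" "\<And>x. 0 < x \<Longrightarrow> y * ncau M x \<le> 1 \<Longrightarrow> c \<le> 1 - npsi M x" shows "c \<le> theta_cdf M y"
proof -
  have "(SUP x\<in>{x. 0 < x \<and> y * ncau M x \<le> 1}. npsi M x) \<le> 1 - c"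
    using assms(2) by (intro cSUP_least theta_set_nonempty assms(1)) force
  then show ?thesis using assms(1) by (simp add: theta_cdf_def)
qed

lemma theta_cdf_nonneg: "0 \<le> theta_cdf M y"
proof (cases "y < 0")
  case False
  then show ?thesis by (intro theta_cdf_ge) (auto intro: less_imp_le npsi_less_1)
qed (simp add: theta_cdf_def)

lemma theta_cdf_mono: assumes "y \<le> y'" shows "theta_cdf M y \<le> theta_cdf M y'"
proof (cases "y < 0")
  case True
  then show ?thesis using theta_cdf_nonneg[of y'] by (simp add: theta_cdf_def)
next
  case False
  show ?thesis
  proof (rule theta_cdf_ge)
    fix x assume "0 < x" "y' * ncau M x \<le> 1"
    moreover have "y * ncau M x \<le> y' * ncau M x" using assms ncau_pos[OF \<open>0 < x\<close>] by (intro mult_right_mono) auto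
    ultimately show "theta_cdf M y \<le> 1 - npsi M x" using False by (intro theta_cdf_le) auto
  qed (use False assms in auto)
qed

lemma theta_cdf_eq_tau: assumes "0 < y" shows "theta_cdf M y = 1 - tau M (1 / y)"
proof -
  have "y * a \<le> 1 \<longleftrightarrow> a \<le> 1 / y" for a using assms by (simp add: pos_le_divide_eq mult.commute)
  then show ?thesis using assms by (simp add: theta_cdf_def tau_def)
qed

text \<open>The supremum admits \<open>y * ncau M x = 1\<close>, but geometric decay needs a ratio
  strictly below 1; continuity of \<open>npsi\<close> allows \<open>x\<close> to be moved slightly
  to the left. The same slack yields right continuity of \<open>theta_cdf\<close>.\<close>

lemma ex_theta_cdf_strict:
  assumes "0 \<le> y" "theta_cdf M y < c"
  obtains x where "0 < x" "y * ncau M x < 1" "1 - npsi M x < c"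
proof -
  have "1 - c < (SUP x\<in>{x. 0 < x \<and> y * ncau M x \<le> 1}. npsi M x)"
    using assms by (simp add: theta_cdf_def)
  moreover have "bdd_above (npsi M ` {x. 0 < x \<and> y * ncau M x \<le> 1})"
    by (auto intro!: bdd_aboveI[of _ 1] less_imp_le npsi_less_1)
  ultimately obtain x where x: "0 < x" "y * ncau M x \<le> 1" "1 - c < npsi M x"
    using less_cSUP_iff[OF theta_set_nonempty[OF assms(1)]] by blast
  have "isCont (npsi M) x"
    using continuous_npsi x(1) continuous_on_eq_continuous_at[of "{0<..}" "npsi M"] by auto
  then have "(npsi M \<longlongrightarrow> npsi M x) (at_left x)"
    by (simp add: isCont_def filterlim_at_split)
  from order_tendstoD(1)[OF this x(3)] have "\<forall>\<^sub>F z in at_left x. 1 - c < npsi M z" .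
  moreover have "\<forall>\<^sub>F z in at_left x. z \<in> {0<..<x}" using x(1) by (rule eventually_at_left_real)
  ultimately have "\<forall>\<^sub>F z in at_left x. 1 - c < npsi M z \<and> z \<in> {0<..<x}" by eventually_elim auto
  then obtain z where z: "1 - c < npsi M z" "0 < z" "z < x"
    using eventually_happens'[OF trivial_limit_at_left_real] by force
  have "y * ncau M z < 1"
  proof (cases "y = 0")
    case False
    then have "y * ncau M z < y * ncau M x" using assms(1) ncau_strict_mono[OF z(2,3)] by (intro mult_strict_left_mono) auto
    then show ?thesis using x(2) by simp
  qed simp
  with z that show ?thesis by auto
qed

lemma theta_cdf_right_continuous: "continuous (at_right y) (theta_cdf M)"
  unfolding continuous_within
proof (cases "y < 0")
  case True
  then have "\<forall>\<^sub>F z in at_right y. z \<in> {y<..<0}" by (rule eventually_at_right_real)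
  then have "\<forall>\<^sub>F z in at_right y. theta_cdf M z = 0" by eventually_elim (simp add: theta_cdf_def)
  then show "(theta_cdf M \<longlongrightarrow> theta_cdf M y) (at_right y)"
    using True by (simp add: theta_cdf_def tendsto_eventually)
next
  case False
  then have y: "0 \<le> y" by simp
  show "(theta_cdf M \<longlongrightarrow> theta_cdf M y) (at_right y)"
  proof (rule order_tendstoI)
    fix c assume c: "c < theta_cdf M y"
    have "\<forall>\<^sub>F z in at_right y. y < z" by (rule eventually_at_right_less)
    then show "\<forall>\<^sub>F z in at_right y. c < theta_cdf M z"
      by eventually_elim (use c theta_cdf_mono in \<open>force intro: less_le_trans\<close>)
  next
    fix c assume "theta_cdf M y < c"
    from ex_theta_cdf_strict[OF y this] obtain x where x: "0 < x" "y * ncau M x < 1" "1 - npsi M x < c" .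
    have "((\<lambda>z. z * ncau M x) \<longlongrightarrow> y * ncau M x) (at_right y)" by (intro tendsto_intros)
    from order_tendstoD(2)[OF this x(2)] have "\<forall>\<^sub>F z in at_right y. z * ncau M x < 1" .
    moreover have "\<forall>\<^sub>F z in at_right y. y < z" by (rule eventually_at_right_less)
    ultimately show "\<forall>\<^sub>F z in at_right y. theta_cdf M z < c"
    proof eventually_elim
      case (elim z)
      then have "theta_cdf M z \<le> 1 - npsi M x" using x y by (intro theta_cdf_le) auto
      then show ?case using x by simp
    qed
  qed
qed

lemma theta_cdf_at_top: "(theta_cdf M \<longlongrightarrow> 1) at_top"
proof (rule order_tendstoI)
  fix c :: real assume "c < 1"
  then obtain x where x: "0 < x" "npsi M x < 1 - c" using ex_npsi_less[of "1 - c"] by auto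
  show "\<forall>\<^sub>F y in at_top. c < theta_cdf M y"
    using eventually_gt_at_top[of "1 / ncau M x"]
  proof eventually_elim
    case (elim y)
    have y: "0 < y" using elim ncau_pos[OF x(1)] by (meson divide_pos_pos less_trans zero_less_one)
    have "1 - npsi M x \<le> theta_cdf M y"
    proof (rule theta_cdf_ge)
      fix z assume z: "0 < z" "y * ncau M z \<le> 1"
      have "1 < y * ncau M x" using elim ncau_pos[OF x(1)] by (simp add: pos_divide_less_eq)
      then have "y * ncau M z < y * ncau M x" using z by simp
      then have "ncau M z < ncau M x" using y by simp
      then have "z < x" using ncau_less_iff z x by simp
      then show "1 - npsi M x \<le> 1 - npsi M z" using npsi_mono[OF z(1), of x] by simp
    qed (use y in simp)
    then show ?case using x by simp
  qed
next
  fix c :: real assume c: "1 < c"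
  have "theta_cdf M y \<le> 1" for y
  proof (cases "y < 0")
    case False
    then obtain x where "0 < x" "y * ncau M x \<le> 1" using theta_set_nonempty[of y] by auto
    then show ?thesis using theta_cdf_le[of x y] npsi_nonneg[of x] False by simp
  qed (simp add: theta_cdf_def)
  then show "\<forall>\<^sub>F y in at_top. theta_cdf M y < c"
    using c by (intro always_eventually) (auto intro: le_less_trans)
qed

lemma theta_cdf_at_bot: "(theta_cdf M \<longlongrightarrow> 0) at_bot"
proof (rule tendsto_eventually)
  show "\<forall>\<^sub>F y in at_bot. theta_cdf M y = 0"
    using eventually_gt_at_bot[of 0] by eventually_elim (simp add: theta_cdf_def)
qed

abbreviation theta_measure :: "real measure" where
  "theta_measure \<equiv> interval_measure (theta_cdf M)"

lemma cdf_theta_measure: "cdf theta_measure = theta_cdf M"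
  by (intro cdf_interval_measure theta_cdf_mono theta_cdf_right_continuous theta_cdf_at_bot)

lemma Rplus_distribution_theta_measure: "Rplus_distribution theta_measure"
proof -
  interpret T: real_distribution theta_measure
    by (intro real_distribution_interval_measure theta_cdf_mono theta_cdf_right_continuous theta_cdf_at_bot theta_cdf_at_top)
  have "(cdf theta_measure \<longlongrightarrow> measure theta_measure {..<0}) (at_left 0)" by (rule T.cdf_at_left)
  moreover have "(cdf theta_measure \<longlongrightarrow> 0) (at_left 0)"
    unfolding cdf_theta_measure by (rule tendsto_eventually) (auto simp: theta_cdf_def eventually_at_filter)
  ultimately have "measure theta_measure {..<0} = 0" using tendsto_unique[OF trivial_limit_at_left_real] by blast
  then show ?thesis by unfold_locales (simp add: T.emeasure_eq_measure)
qed

end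

text \<open>The mass at 0 never exceeds that of \<open>P\<close>, so one interval of
  \<open>t\<close> serves all powers. The induction starts with \<delta>_1, whose S-transform is
  1.\<close>

lemma free_mult_power_props:
  assumes P: "Rplus_distribution P" "P \<noteq> return borel 0"
  shows "Rplus_distribution (free_mult_power P n) \<and> free_mult_power P n \<noteq> return borel 0 \<and>
    measure (free_mult_power P n) {0} \<le> measure P {0} \<and>
    (\<forall>t. 0 < t \<longrightarrow> t < 1 - measure P {0} \<longrightarrow> S_transform (free_mult_power P n) (- t) = S_transform P (- t) ^ n)"
proof (induction n)
  case 0
  interpret R: Rplus_distribution "return borel (1::real)" by (rule Rplus_distribution_return) simp
  have np: "npsi (return borel 1) x = x / (1 + x)" for x by (simp add: npsi_def integral_return)
  have ne: "return borel 1 \<noteq> return borel (0::real)"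
    using np[of 1] npsi_return_0[of 1] by auto
  have "S_transform (return borel 1) (- t) = 1" if "0 < t" "t < 1 - measure P {0}" for t
  proof -
    have t: "t < 1" using that measure_nonneg[of P "{0}"] by linarith
    define x where "x = t / (1 - t)"
    have x: "0 < x" using that t by (simp add: x_def)
    have "1 + x = 1 / (1 - t)" using t by (simp add: x_def field_simps)
    then have "npsi (return borel 1) x = t" using t by (simp add: np) (simp add: x_def)
    then have "S_transform (return borel 1) (- t) = x * (1 - t) / t"
      using R.S_transform_npsi[OF ne that(1) _ x] by simp
    then show ?thesis using t that by (simp add: x_def)
  qed
  moreover have "measure (return borel (1::real)) {0} = 0" by (simp add: measure_return)
  ultimately show ?case using R.Rplus_distribution_axioms ne by simp
next
  case (Suc n)
  define Q where "Q = free_mult_power P n"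
  have Q: "Rplus_distribution Q" "Q \<noteq> return borel 0" "measure Q {0} \<le> measure P {0}"
    "\<And>t. 0 < t \<Longrightarrow> t < 1 - measure P {0} \<Longrightarrow> S_transform Q (- t) = S_transform P (- t) ^ n"
    using Suc by (auto simp: Q_def)
  have "max (measure Q {0}) (measure P {0}) = measure P {0}" using Q(3) by simp
  with free_mult_conv[OF Q(1,2) P] Q(4) show ?case
    by (simp add: Q_def[symmetric] mult.commute)
qed

text \<open>This solves \<open>x * (1 - t) / t = g ^ n\<close> for \<open>x\<close>: the level
  \<open>t\<close> is attained at an argument that varies geometrically in \<open>n\<close>, with
  rate \<open>g\<close>.\<close>

lemma npsi_free_mult_power:
  assumes P: "Rplus_distribution P" "P \<noteq> return borel 0" and t: "0 < t" "t < 1 - measure P {0}"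
    and S: "S_transform P (- t) = g"
  shows "0 < g" "npsi (free_mult_power P n) (t / (1 - t) * g ^ n) = t"
proof -
  interpret P: Rplus_distribution P by fact
  note p = free_mult_power_props[OF P, of n]
  interpret Q: Rplus_distribution "free_mult_power P n" using p by simp
  have t1: "t < 1" using t measure_nonneg[of P "{0}"] by linarith
  obtain x where x: "0 < x" "npsi P x = t" using P.ex_npsi_eq[OF t] by blast
  have "g = x * (1 - t) / t" using P.S_transform_npsi[OF P(2) t(1) x(2,1)] S by simp
  then show "0 < g" using x t t1 by simp
  obtain z where z: "0 < z" "npsi (free_mult_power P n) z = t"
    using Q.ex_npsi_eq[of t] t p by auto
  have "g ^ n = z * (1 - t) / t" using Q.S_transform_npsi[OF _ t(1) z(2,1)] p S t by auto
  then have "z = t / (1 - t) * g ^ n" using t t1 by (simp add: field_simps)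
  then show "npsi (free_mult_power P n) (t / (1 - t) * g ^ n) = t" using z by simp
qed

lemma weak_limit_unique:
  assumes "\<And>n. real_distribution (M n)" "real_distribution A" "real_distribution B"
    "weak_conv_m M A" "weak_conv_m M B"
  shows "A = B"
proof (rule Levy_uniqueness[OF assms(2,3)])
  show "char A = char B"
  proof
    fix t
    show "char A t = char B t"
      using levy_continuity1[OF assms(1,2,4), of t] levy_continuity1[OF assms(1,3,5), of t] by (rule LIMSEQ_unique)
  qed
qed

theorem Theta_eq:
  assumes M: "Rplus_distribution M"
  shows "Theta M = interval_measure (theta_cdf M)"
proof -
  interpret M: Rplus_distribution M by fact
  define P where "P = inverse_mp \<boxtimes> M"
  define \<rho> where "\<rho> n = measure_powr (free_mult_power P n) (1 / real n)" for n
  \<comment> \<open>At \<open>t = npsi M x\<close> the S-transform of the inverse law contributes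
    \<open>t\<close> and that of \<open>M\<close> contributes \<open>ncau M x / t\<close>, so their
    product is \<open>ncau M x\<close>. For \<delta>_0 there is no S-transform, and the convention
    for \<open>\<boxtimes>\<close> applies.\<close>
  have P_cases: "(P = return borel 0 \<and> M = return borel 0) \<or> (Rplus_distribution P \<and> P \<noteq> return borel 0 \<and>
      M \<noteq> return borel 0 \<and> (\<forall>x>0. npsi M x < 1 - measure P {0} \<and> S_transform P (- npsi M x) = ncau M x))"
  proof (cases "M = return borel 0")
    case True
    then show ?thesis by (simp add: P_def free_mult_conv_def)
  next
    case False
    note p = free_mult_conv[OF Rplus_distribution_inverse_mp inverse_mp_ne M False, folded P_def, unfolded mass_zero_inverse_mp]
    have mx: "max 0 (measure M {0}) = measure M {0}" by simp
    have "npsi M x < 1 - measure P {0} \<and> S_transform P (- npsi M x) = ncau M x" if x: "0 < x" for x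
    proof
      show "npsi M x < 1 - measure P {0}"
        using M.npsi_less[OF False x] p(3) unfolding mx by linarith
      have "S_transform P (- npsi M x) = npsi M x * (ncau M x / npsi M x)"
        using p(4)[OF M.npsi_pos[OF False x]] M.npsi_less[OF False x] M.S_transform_eq[OF False x]
          S_transform_inverse_mp[OF M.npsi_pos[OF False x] M.npsi_less_1[OF x]] unfolding mx by simp
      then show "S_transform P (- npsi M x) = ncau M x" using M.npsi_pos[OF False x] by simp
    qed
    with p(1,2) False show ?thesis by blast
  qed
  have powers_0: "free_mult_power P n = (if n = 0 then return borel 1 else return borel 0)" if "P = return borel 0" for n
    using that by (cases n) (simp_all add: free_mult_conv_def)
  have powers: "Rplus_distribution (free_mult_power P n)" for n
    using P_cases
  proof (elim disjE conjE)
    assume "P = return borel 0"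
    from powers_0[OF this, of n] show ?thesis by (auto intro: Rplus_distribution_return)
  qed (use free_mult_power_props in blast)
  \<comment> \<open>The constant \<open>c\<close> is \<open>t / (1 - t)\<close> with
    \<open>t = npsi M x\<close>; being independent of \<open>n\<close>, it has no influence on the
    limit of the roots. For \<delta>_0 any constant works, but only for \<open>n > 0\<close>, since
    the empty power is \<delta>_1.\<close>
  have npsi_powers: "\<exists>c>0. \<forall>n>0. npsi (free_mult_power P n) (c * ncau M x ^ n) = npsi M x" if x: "0 < x" for x
    using P_cases
  proof (elim disjE conjE)
    assume 0: "P = return borel 0" "M = return borel 0"
    show ?thesis by (intro exI[of _ 1]) (simp add: powers_0[OF 0(1)] 0(2) npsi_return_0)
  next
    assume P: "Rplus_distribution P" "P \<noteq> return borel 0" "M \<noteq> return borel 0"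
      and "\<forall>x>0. npsi M x < 1 - measure P {0} \<and> S_transform P (- npsi M x) = ncau M x"
    then have "npsi M x < 1 - measure P {0}" "S_transform P (- npsi M x) = ncau M x" using x by auto
    note np = npsi_free_mult_power(2)[OF P(1,2) M.npsi_pos[OF P(3) x] this]
    have "0 < npsi M x / (1 - npsi M x)" using M.npsi_pos[OF P(3) x] M.npsi_less_1[OF x] by simp
    with np show ?thesis by blast
  qed
  have ev: "\<forall>\<^sub>F n in sequentially. 0 < (n::nat)" by (rule eventually_gt_at_top)
  have root: "cdf (\<rho> n) y = cdf (free_mult_power P n) (y ^ n)" if "0 < n" "0 < y" for n y
    unfolding \<rho>_def using Rplus_distribution.cdf_root[OF powers that(1), of y] that by simp
  \<comment> \<open>With \<open>z = c * ncau M x ^ n\<close> and \<open>w = y ^ n\<close> the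
    product \<open>z * w\<close> is \<open>c * r ^ n\<close>. Here \<open>r > 1\<close> makes the
    error \<open>1 / (1 + z * w)\<close> vanish; in the upper estimate \<open>r < 1\<close> makes
    the factor \<open>1 + z * w\<close> tend to 1.\<close>
  have lower: "\<forall>\<^sub>F n in sequentially. 1 - npsi M x - e < cdf (\<rho> n) y"
    if x: "0 < x" and y: "0 < y" and r1: "1 < y * ncau M x" and e: "0 < e" for x y e
  proof -
    obtain c where c: "0 < c" "\<And>n. 0 < n \<Longrightarrow> npsi (free_mult_power P n) (c * ncau M x ^ n) = npsi M x"
      using npsi_powers[OF x] by blast
    define r where "r = y * ncau M x"
    have r: "0 < r" "1 < r" using r1 by (auto simp: r_def)
    have zr: "c * ncau M x ^ n * y ^ n = c * r ^ n" for n by (simp add: r_def power_mult_distrib mult_ac)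
    have zp: "0 < c * ncau M x ^ n" for n using c M.ncau_pos[OF x] by simp
    have "(\<lambda>n. 1 / c * (1 / r) ^ n) \<longlonglongrightarrow> 1 / c * 0"
      using r by (intro tendsto_mult tendsto_const LIMSEQ_realpow_zero) auto
    then have "\<forall>\<^sub>F n in sequentially. 1 / c * (1 / r) ^ n < e" using e by (intro order_tendstoD(2)) auto
    with ev show ?thesis
    proof eventually_elim
      case (elim n)
      have "1 - npsi M x \<le> cdf (\<rho> n) y + 1 / (1 + c * r ^ n)"
        using Rplus_distribution.npsi_le_cdf[OF powers zp, of "y ^ n" n n] y c(2)[OF elim(1)]
        by (simp add: root[OF elim(1) y] zr)
      also have "1 / (1 + c * r ^ n) \<le> 1 / (c * r ^ n)"
        using c r by (intro divide_left_mono) (auto intro!: mult_pos_pos add_pos_pos)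
      also have "\<dots> = 1 / c * (1 / r) ^ n" by (simp add: power_one_over)
      finally show ?case using elim(2) by simp
    qed
  qed
  have upper: "\<forall>\<^sub>F n in sequentially. cdf (\<rho> n) y < 1 - npsi M x + e"
    if x: "0 < x" and y: "0 < y" and r1: "y * ncau M x < 1" and e: "0 < e" for x y e
  proof -
    obtain c where c: "0 < c" "\<And>n. 0 < n \<Longrightarrow> npsi (free_mult_power P n) (c * ncau M x ^ n) = npsi M x"
      using npsi_powers[OF x] by blast
    define r where "r = y * ncau M x"
    have r: "0 < r" "r < 1" using r1 y M.ncau_pos[OF x] by (auto simp: r_def)
    have zr: "c * ncau M x ^ n * y ^ n = c * r ^ n" for n by (simp add: r_def power_mult_distrib mult_ac)
    have zp: "0 < c * ncau M x ^ n" for n using c M.ncau_pos[OF x] by simp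
    have "(\<lambda>n. (1 + c * r ^ n) * (1 - npsi M x)) \<longlonglongrightarrow> (1 + c * 0) * (1 - npsi M x)"
      using r by (intro tendsto_intros LIMSEQ_realpow_zero) auto
    then have "\<forall>\<^sub>F n in sequentially. (1 + c * r ^ n) * (1 - npsi M x) < 1 - npsi M x + e"
      using e by (intro order_tendstoD(2)) auto
    with ev show ?thesis
    proof eventually_elim
      case (elim n)
      have "cdf (\<rho> n) y \<le> (1 + c * r ^ n) * (1 - npsi M x)"
        using Rplus_distribution.cdf_le_npsi[OF powers zp, of "y ^ n" n n] y c(2)[OF elim(1)]
        by (simp add: root[OF elim(1) y] zr)
      then show ?case using elim(2) by simp
    qed
  qed
  have pos: "(\<lambda>n. cdf (\<rho> n) y) \<longlonglongrightarrow> theta_cdf M y" if y: "0 < y" for y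
  proof (rule order_tendstoI)
    fix c assume "theta_cdf M y < c"
    from M.ex_theta_cdf_strict[OF less_imp_le[OF y] this]
    obtain x where x: "0 < x" "y * ncau M x < 1" "1 - npsi M x < c" .
    from upper[OF x(1) y x(2), of "c - (1 - npsi M x)"] x(3)
    show "\<forall>\<^sub>F n in sequentially. cdf (\<rho> n) y < c" by simp
  next
    fix c assume c: "c < theta_cdf M y"
    show "\<forall>\<^sub>F n in sequentially. c < cdf (\<rho> n) y"
    \<comment> \<open>Below \<open>kappa\<close> an argument slightly to the right of the solution
      of \<open>ncau M x = 1 / y\<close> gives \<open>r > 1\<close>. From \<open>kappa\<close> on no
      argument does, but then the limit value is 0 and distribution functions are
      nonnegative.\<close>
    proof (cases "ennreal (1 / y) < kappa M")
      case True
      then obtain x where x: "0 < x" "ncau M x = 1 / y" using M.ex_ncau_eq[of "1 / y"] y by auto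
      have th: "theta_cdf M y = 1 - npsi M x" using M.theta_cdf_eq_tau[OF y] M.tau_ncau[OF x(1)] x(2) by simp
      have "isCont (npsi M) x"
        using M.continuous_npsi x(1) continuous_on_eq_continuous_at[of "{0<..}" "npsi M"] by auto
      then have "(npsi M \<longlongrightarrow> npsi M x) (at_right x)"
        by (simp add: isCont_def filterlim_at_split)
      moreover have "npsi M x < 1 - c" using c th by simp
      ultimately have "\<forall>\<^sub>F z in at_right x. npsi M z < 1 - c" by (rule order_tendstoD(2))
      moreover have "\<forall>\<^sub>F z in at_right x. x < z" by (rule eventually_at_right_less)
      ultimately have "\<forall>\<^sub>F z in at_right x. npsi M z < 1 - c \<and> x < z" by eventually_elim auto
      then obtain z where z: "npsi M z < 1 - c" "x < z"
        using eventually_happens'[OF trivial_limit_at_right_real] by blast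
      have z0: "0 < z" using z x by simp
      have "1 / y < ncau M z" using M.ncau_strict_mono[OF x(1) z(2)] x(2) by simp
      then have "1 < y * ncau M z" using y by (simp add: pos_divide_less_eq mult.commute)
      from lower[OF z0 y this, of "1 - npsi M z - c"] z show ?thesis by simp
    next
      case False
      then have "tau M (1 / y) = 1" using y by (intro M.tau_eq_1) auto
      then have "c < 0" using c M.theta_cdf_eq_tau[OF y] by simp
      then show ?thesis by (intro always_eventually allI) (auto simp: cdf_def intro: less_le_trans)
    qed
  qed
  let ?\<theta> = "interval_measure (theta_cdf M)"
  interpret \<theta>: Rplus_distribution ?\<theta> by (rule M.Rplus_distribution_theta_measure)
  have dist: "real_distribution (\<rho> n)" for n
  proof -
    interpret Q: Rplus_distribution "free_mult_power P n" by (rule powers)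
    show ?thesis unfolding \<rho>_def measure_powr_def by (rule Q.real_distribution_distr) measurable
  qed
  have neg: "cdf (\<rho> n) y = 0" if "y < 0" for n y
  proof -
    interpret Q: Rplus_distribution "free_mult_power P n" by (rule powers)
    have "\<not> u powr (1 / real n) \<le> y" for u using powr_ge_zero[of u "1 / real n"] that by linarith
    then have "(\<lambda>u. u powr (1 / real n)) -` {..y} = {}" by blast
    moreover have "cdf (\<rho> n) y = measure (free_mult_power P n) ((\<lambda>u. u powr (1 / real n)) -` {..y} \<inter> space (free_mult_power P n))"
      unfolding cdf_def \<rho>_def measure_powr_def by (subst measure_distr) auto
    ultimately show ?thesis by simp
  qed
  have wc: "weak_conv_m \<rho> ?\<theta>"
    unfolding weak_conv_m_def weak_conv_def M.cdf_theta_measure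
  proof (intro allI impI)
    fix y assume cont: "isCont (theta_cdf M) y"
    consider "y < 0" | "y = 0" | "0 < y" by linarith
    then show "(\<lambda>n. cdf (\<rho> n) y) \<longlonglongrightarrow> theta_cdf M y"
    proof cases
      case 1
      then show ?thesis by (simp add: neg theta_cdf_def)
    next
      \<comment> \<open>The two estimates require \<open>y > 0\<close>. A limit that is continuous
        at 0 has no mass there, and the limits at small \<open>y > 0\<close> squeeze
        \<open>cdf (\<rho> n) 0\<close> to 0 by monotonicity.\<close>
      case 2
      have "(theta_cdf M \<longlongrightarrow> theta_cdf M 0) (at_left 0)" using cont 2 by (simp add: isCont_def filterlim_at_split)
      moreover have "(theta_cdf M \<longlongrightarrow> 0) (at_left 0)"
        by (rule tendsto_eventually) (auto simp: theta_cdf_def eventually_at_filter)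
      ultimately have z: "theta_cdf M 0 = 0" using tendsto_unique[OF trivial_limit_at_left_real] by blast
      show ?thesis unfolding 2 z
      proof (rule order_tendstoI)
        fix c :: real assume c: "0 < c"
        have "(theta_cdf M \<longlongrightarrow> theta_cdf M 0) (at_right 0)" using M.theta_cdf_right_continuous[of 0] by (simp add: continuous_within)
        from order_tendstoD(2)[OF this, of c] c z have "\<forall>\<^sub>F y in at_right 0. theta_cdf M y < c" by simp
        moreover have "\<forall>\<^sub>F y in at_right (0::real). 0 < y" by (rule eventually_at_right_less)
        ultimately have "\<forall>\<^sub>F y in at_right 0. theta_cdf M y < c \<and> 0 < y" by eventually_elim auto
        then obtain y where y: "theta_cdf M y < c" "0 < y"
          using eventually_happens'[OF trivial_limit_at_right_real] by blast
        from order_tendstoD(2)[OF pos[OF y(2)] y(1)]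
        show "\<forall>\<^sub>F n in sequentially. cdf (\<rho> n) 0 < c"
        proof eventually_elim
          case (elim n)
          interpret R: real_distribution "\<rho> n" by (rule dist)
          show ?case using R.cdf_nondecreasing[of 0 y] y elim by simp
        qed
      next
        fix c :: real assume "c < 0"
        then show "\<forall>\<^sub>F n in sequentially. c < cdf (\<rho> n) 0"
          by (intro always_eventually allI) (auto simp: cdf_def intro: less_le_trans)
      qed
    qed (rule pos)
  qed
  have "Phi P = ?\<theta>"
    unfolding Phi_def \<rho>_def[symmetric]
  proof (rule the_equality)
    show "?\<theta> \<in> prob_Rplus \<and> weak_conv_m \<rho> ?\<theta>"
      using wc M.Rplus_distribution_theta_measure by (simp add: prob_Rplus_iff)
    fix R assume R: "R \<in> prob_Rplus \<and> weak_conv_m \<rho> R"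
    then show "R = ?\<theta>"
      using weak_limit_unique[OF dist _ \<theta>.real_distribution_axioms _ wc] by (auto simp: prob_Rplus_def)
  qed
  then show ?thesis by (simp add: Theta_def P_def)
qed

text \<open>Below \<open>kappa (M \<boxplus> N)\<close> this is additivity of \<open>tau\<close>.
  From there on \<open>tau\<close> of the convolution is 1, and the sum
  \<open>tau M s + tau N s\<close> has reached at least 1: it dominates every value
  \<open>npsi R x\<close>, and these have supremum 1. Cutting at 0 is therefore exact.\<close>

lemma theta_cdf_free_add_conv:
  assumes M: "Rplus_distribution M" and N: "Rplus_distribution N" and y: "0 < y"
  shows "theta_cdf (M \<boxplus> N) y = max (theta_cdf M y + theta_cdf N y - 1) 0"
proof -
  define R where "R = M \<boxplus> N"
  note R = free_add_conv[OF M N, folded R_def]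
  interpret M: Rplus_distribution M by fact
  interpret N: Rplus_distribution N by fact
  interpret R: Rplus_distribution R by (rule R(1))
  have tau: "tau R s = tau M s + tau N s" if s: "0 < s" "ennreal s < kappa R" for s
  proof -
    have "ennreal s < kappa M" "ennreal s < kappa N" using s R(2) by (auto intro: less_le_trans)
    then show ?thesis
      using R(3)[OF s] R.R_transform_tau[OF s] M.R_transform_tau[OF s(1)] N.R_transform_tau[OF s(1)] by simp
  qed
  define s where "s = 1 / y"
  have s: "0 < s" using y by (simp add: s_def)
  have "tau R s = min (tau M s + tau N s) 1"
  proof (cases "ennreal s < kappa R")
    case True
    have "tau R s \<le> 1" by (rule R.tau_le[OF s]) (auto intro: less_imp_le R.npsi_less_1)
    then show ?thesis using tau[OF s True] by simp
  next
    case False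
    then have k: "kappa R \<le> ennreal s" by simp
    have 1: "tau R s = 1" by (rule R.tau_eq_1[OF s k])
    have "tau R s \<le> tau M s + tau N s"
    proof (rule R.tau_le[OF s])
      fix x assume x: "0 < x" "ncau R x \<le> s"
      have "npsi R x = tau M (ncau R x) + tau N (ncau R x)"
        using tau[OF R.ncau_pos[OF x(1)] R.ncau_less_kappa[OF x(1)]] R.tau_ncau[OF x(1)] by simp
      also have "\<dots> \<le> tau M s + tau N s"
        using R.ncau_pos[OF x(1)] x(2) by (intro add_mono M.tau_mono N.tau_mono)
      finally show "npsi R x \<le> tau M s + tau N s" .
    qed
    with 1 show ?thesis by simp
  qed
  then show ?thesis
    using R.theta_cdf_eq_tau[OF y] M.theta_cdf_eq_tau[OF y] N.theta_cdf_eq_tau[OF y]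
    unfolding R_def[symmetric] s_def[symmetric] by (simp add: min_def max_def)
qed

lemma measure_Icc_eq_cdf:
  assumes "Rplus_distribution M" shows "measure M {0..t} = cdf M t"
proof -
  interpret Rplus_distribution M by fact
  show ?thesis unfolding cdf_def
    by (rule finite_measure_eq_AE) (use AE_nonneg in \<open>auto elim!: eventually_mono\<close>)
qed

theorem theorem3p3:
  "Theta \<in> prob_Rplus \<rightarrow> prob_Rplus \<and>
   (\<forall>\<mu>\<in>prob_Rplus. \<forall>\<nu>\<in>prob_Rplus. Theta (\<mu> \<boxplus> \<nu>) = Theta \<mu> \<or>\<^sub>f Theta \<nu>)"
proof (intro conjI ballI funcsetI)
  show T: "Theta \<mu> \<in> prob_Rplus" if "\<mu> \<in> prob_Rplus" for \<mu>
    using that Rplus_distribution.Rplus_distribution_theta_measure[of \<mu>]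
    by (simp add: prob_Rplus_iff Theta_eq)
  fix M N assume MN: "M \<in> prob_Rplus" "N \<in> prob_Rplus"
  then have M: "Rplus_distribution M" and N: "Rplus_distribution N" by (simp_all add: prob_Rplus_iff)
  have R: "Rplus_distribution (M \<boxplus> N)" by (rule free_add_conv(1)[OF M N])
  have cdf: "measure (Theta L) {0..t} = theta_cdf L t" if "Rplus_distribution L" for L t
    using measure_Icc_eq_cdf[OF Rplus_distribution.Rplus_distribution_theta_measure[OF that]]
      Rplus_distribution.cdf_theta_measure[OF that] by (simp add: Theta_eq[OF that])
  have eq: "theta_cdf (M \<boxplus> N) t = max (theta_cdf M t + theta_cdf N t - 1) 0" if "0 \<le> t" for t
  proof (cases "t = 0")
    case True
    have lim: "(theta_cdf L \<longlongrightarrow> theta_cdf L 0) (at_right 0)" if "Rplus_distribution L" for L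
      using Rplus_distribution.theta_cdf_right_continuous[OF that, of 0] by (simp add: continuous_within)
    have "((\<lambda>t. max (theta_cdf M t + theta_cdf N t - 1) 0) \<longlongrightarrow> max (theta_cdf M 0 + theta_cdf N 0 - 1) 0) (at_right 0)"
      by (intro tendsto_max tendsto_diff tendsto_add tendsto_const lim M N)
    moreover have "\<forall>\<^sub>F t in at_right 0. theta_cdf (M \<boxplus> N) t = max (theta_cdf M t + theta_cdf N t - 1) 0"
      using eventually_at_right_less[of 0] by eventually_elim (rule theta_cdf_free_add_conv[OF M N])
    ultimately have "(theta_cdf (M \<boxplus> N) \<longlongrightarrow> max (theta_cdf M 0 + theta_cdf N 0 - 1) 0) (at_right 0)"
      by (simp add: tendsto_cong)
    from tendsto_unique[OF trivial_limit_at_right_real lim[OF R] this] show ?thesis using True by simp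
  next
    case False
    then show ?thesis using theta_cdf_free_add_conv[OF M N, of t] that by simp
  qed
  have "Theta M \<or>\<^sub>f Theta N = Theta (M \<boxplus> N)"
    unfolding free_max_conv_def
  proof (rule the_equality)
    show main: "Theta (M \<boxplus> N) \<in> prob_Rplus \<and> (\<forall>t\<ge>0. measure (Theta (M \<boxplus> N)) {0..t} =
        max (measure (Theta M) {0..t} + measure (Theta N) {0..t} - 1) 0)"
      using T[of "M \<boxplus> N"] R by (simp add: cdf M N R eq prob_Rplus_iff)
    fix L assume L: "L \<in> prob_Rplus \<and> (\<forall>t\<ge>0. measure L {0..t} =
        max (measure (Theta M) {0..t} + measure (Theta N) {0..t} - 1) 0)"
    then have RL: "Rplus_distribution L" by (simp add: prob_Rplus_iff)
    have RT: "Rplus_distribution (Theta (M \<boxplus> N))" using main by (simp add: prob_Rplus_iff)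
    show "L = Theta (M \<boxplus> N)"
    proof (rule cdf_unique)
      show "cdf L = cdf (Theta (M \<boxplus> N))"
      proof
        fix t
        show "cdf L t = cdf (Theta (M \<boxplus> N)) t"
        proof (cases "t < 0")
          case True
          then show ?thesis using cdf_Rplus_neg RL RT by simp
        next
          case False
          then have "measure L {0..t} = measure (Theta (M \<boxplus> N)) {0..t}" using L main by auto
          then show ?thesis by (simp add: measure_Icc_eq_cdf RL RT)
        qed
      qed
    qed (use RL RT in \<open>auto simp: Rplus_distribution_def\<close>)
  qed
  then show "Theta (M \<boxplus> N) = Theta M \<or>\<^sub>f Theta N" by simp
qed

end
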